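(* Let $n\ge3$. Let $\Gamma\subset\mathbb R^n$ be an open convex symmetric cone with vertex at the origin such that $\Gamma_n\subset\Gamma\subset\Gamma_1$, and let $f\in C^1(\Gamma)$ be symmetric in $\Gamma$ with $f>0$ and $f_{\lambda_i}:=\partial f/\partial\lambda_i>0$ in $\Gamma$ for every $i$. Let $K$ be a positive $C^1$ function on $\mathbb S^n$ such that $\nabla_{\frac{\partial}{\partial\theta_{n+1}}}K\ge0$ and is not identically zero on $\mathbb S^n\setminus\{\mathbf n,\mathbf s\}$. Then the problem $$f(\lambda(A_{g_1}))=K,\quad\lambda(A_{g_1})\in\Gamma\quad\text{and}\quad v>0\quad\text{on }\mathbb S^n,\qquad g_1=v^{\frac4{n-2}}g_0,$$ has no solution $v\in C^2(\mathbb S^n)$.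
   Context: $\mathbb S^n\subset\mathbb R^{n+1}$ is the unit sphere, $g_0$ its standard metric, points written $\theta=(\theta_1,\dots,\theta_{n+1})$; $\mathbf n=(0,\dots,0,1)$, $\mathbf s=(0,\dots,0,-1)$. $\Gamma_1:=\{\lambda\in\mathbb R^n:\sum_i\lambda_i>0\}$ and $\Gamma_n:=\{\lambda\in\mathbb R^n:\lambda_i>0\text{ for all }i\}$; $\Gamma$ symmetric means it is invariant under permutations of the coordinates. The Schouten tensor of a metric $g$ is $$A_g=\frac1{n-2}\left(Ric_g-\frac{R_g}{2(n-1)}g\right),$$ with $Ric_g$, $R_g$ the Ricci tensor and scalar curvature; $\lambda(A_{g_1})$ denotes the eigenvalues of $A_{g_1}$ with respect to $g_1$. Explicitly, for $0<v\in C^2$ and $g_1=v^{\frac4{n-2}}g_0$, $$A_{g_1}=-\tfrac2{n-2}v^{-1}\nabla^2_{g_0}v+\tfrac{2n}{(n-2)^2}v^{-2}\nabla_{g_0}v\otimes\nabla_{g_0}v-\tfrac2{(n-2)^2}v^{-2}|\nabla_{g_0}v|^2g_0+A_{g_0}.$$ $\nabla_{\frac{\partial}{\partial\theta_{n+1}}}K$ denotes the derivative of $K$ along the meridians in the direction of increasing $\theta_{n+1}$; the condition on it means that in geodesic polar coordinates $(r,\omega)$ centered at $\mathbf s$, $r\mapsto K(r,\omega)$ is non-decreasing on $(0,\pi)$ for each fixed $\omega$, and $K$ is non-constant. *)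

theory Defs
  imports "HOL-Analysis.Analysis"
begin

definition C1_on :: "'a::real_normed_vector set \<Rightarrow> ('a \<Rightarrow> 'b::real_normed_vector) \<Rightarrow> bool" where
  "C1_on U h \<longleftrightarrow> (\<exists>h'. (\<forall>x\<in>U. (h has_derivative blinfun_apply (h' x)) (at x)) \<and> continuous_on U h')"

definition C2_on :: "'a::real_normed_vector set \<Rightarrow> ('a \<Rightarrow> 'b::real_normed_vector) \<Rightarrow> bool" where
  "C2_on U h \<longleftrightarrow> (\<exists>h'. (\<forall>x\<in>U. (h has_derivative blinfun_apply (h' x)) (at x)) \<and> C1_on U h')"

definition partial :: "'n \<Rightarrow> (real^'n \<Rightarrow> 'b::real_normed_vector) \<Rightarrow> real^'n \<Rightarrow> 'b" where
  "partial i h x = frechet_derivative h (at x) (axis i 1)"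

text \<open>A metric on a coordinate domain is given by its matrix \<open>x \<mapsto> (g\<^sub>i\<^sub>j(x))\<close>.\<close>

definition christoffel :: "(real^'n \<Rightarrow> real^'n^'n) \<Rightarrow> 'n \<Rightarrow> 'n \<Rightarrow> 'n \<Rightarrow> real^'n \<Rightarrow> real" where
  "christoffel g k i j x =
     (1/2) * (\<Sum>l\<in>UNIV. matrix_inv (g x) $ k $ l *
        (partial i (\<lambda>y. g y $ j $ l) x + partial j (\<lambda>y. g y $ i $ l) x
          - partial l (\<lambda>y. g y $ i $ j) x))"

text \<open>The sign convention is the one for which round spheres have positive Ricci curvature.\<close>

definition ricci :: "(real^'n \<Rightarrow> real^'n^'n) \<Rightarrow> real^'n \<Rightarrow> real^'n^'n" where
  "ricci g x = (\<chi> i j.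
       (\<Sum>k\<in>UNIV. partial k (christoffel g k i j) x)
     - (\<Sum>k\<in>UNIV. partial j (christoffel g k i k) x)
     + (\<Sum>k\<in>UNIV. \<Sum>l\<in>UNIV. christoffel g k k l x * christoffel g l i j x)
     - (\<Sum>k\<in>UNIV. \<Sum>l\<in>UNIV. christoffel g k j l x * christoffel g l i k x))"

definition scalar_curv :: "(real^'n \<Rightarrow> real^'n^'n) \<Rightarrow> real^'n \<Rightarrow> real" where
  "scalar_curv g x = (\<Sum>i\<in>UNIV. \<Sum>j\<in>UNIV. matrix_inv (g x) $ i $ j * ricci g x $ i $ j)"

definition schouten :: "(real^'n \<Rightarrow> real^'n^'n) \<Rightarrow> real^'n \<Rightarrow> real^'n^'n" where
  "schouten g x = (1 / (real CARD('n) - 2)) *\<^sub>R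
     (ricci g x - (scalar_curv g x / (2 * (real CARD('n) - 1))) *\<^sub>R g x)"

text \<open>\<open>l\<close> lists, with multiplicity and in some order, the eigenvalues of the bilinear form \<open>A\<close>
  with respect to the metric \<open>g\<close>: each \<open>\<mu>\<close> occurs as often as the dimension of its eigenspace.
  Since \<open>l\<close> has exactly \<open>n\<close> entries, such an \<open>l\<close> exists for symmetric \<open>A\<close> and positive
  definite \<open>g\<close>, and is then unique up to permutation.\<close>

definition eigenvalues_wrt :: "real^'n^'n \<Rightarrow> real^'n^'n \<Rightarrow> real^'n \<Rightarrow> bool" where
  "eigenvalues_wrt g A l \<longleftrightarrow>
     (\<forall>\<mu>. card {i. l $ i = \<mu>} = dim {X. A *v X = \<mu> *\<^sub>R (g *v X)})"

text \<open>\<open>\<real>\<^sup>n\<^sup>+\<^sup>1\<close> is represented as \<open>\<real>\<^sup>n \<times> \<real>\<close>, with \<open>\<theta>\<^sub>n\<^sub>+\<^sub>1\<close> the second component and \<open>n = CARD('n)\<close>;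
  the unit sphere is \<open>sphere 0 1\<close> in this type and its poles are \<open>(0, 1)\<close> and \<open>(0, -1)\<close>.
  Functions on the sphere are functions on \<open>\<real>\<^sup>n \<times> \<real>\<close> of which only the values on \<open>sphere 0 1\<close>
  are ever used.

  The smooth structure is given by the inverses of the two stereographic projections,
  from \<open>(0, 1)\<close> (for \<open>e = 1\<close>) and from \<open>(0, -1)\<close> (for \<open>e = -1\<close>).\<close>

definition stereo :: "real \<Rightarrow> real^'n \<Rightarrow> (real^'n) \<times> real" where
  "stereo e x = ((2 / (1 + (norm x)\<^sup>2)) *\<^sub>R x, e * ((norm x)\<^sup>2 - 1) / ((norm x)\<^sup>2 + 1))"

definition sphere_params :: "(real^'n \<Rightarrow> (real^'n) \<times> real) set" where
  "sphere_params = {stereo 1, stereo (-1)}"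

definition C1_sphere :: "((real^'n) \<times> real \<Rightarrow> real) \<Rightarrow> bool" where
  "C1_sphere h \<longleftrightarrow> (\<forall>\<phi>\<in>sphere_params. C1_on UNIV (h \<circ> \<phi>))"

definition C2_sphere :: "((real^'n) \<times> real \<Rightarrow> real) \<Rightarrow> bool" where
  "C2_sphere h \<longleftrightarrow> (\<forall>\<phi>\<in>sphere_params. C2_on UNIV (h \<circ> \<phi>))"

text \<open>A metric on the sphere assigns to each point \<open>\<theta>\<close> a bilinear form, relevant only on vectors
  tangent to the sphere at \<open>\<theta>\<close>.\<close>

definition round_metric :: "(real^'n) \<times> real \<Rightarrow> (real^'n) \<times> real \<Rightarrow> (real^'n) \<times> real \<Rightarrow> real" where
  "round_metric \<theta> X Y = X \<bullet> Y"

definition conformal_metric ::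
    "((real^'n) \<times> real \<Rightarrow> real) \<Rightarrow> (real^'n) \<times> real \<Rightarrow> (real^'n) \<times> real \<Rightarrow> (real^'n) \<times> real \<Rightarrow> real" where
  "conformal_metric v \<theta> X Y = v \<theta> powr (4 / (real CARD('n) - 2)) * round_metric \<theta> X Y"

definition metric_in_coords ::
    "((real^'n) \<times> real \<Rightarrow> (real^'n) \<times> real \<Rightarrow> (real^'n) \<times> real \<Rightarrow> real) \<Rightarrow>
     (real^'n \<Rightarrow> (real^'n) \<times> real) \<Rightarrow> real^'n \<Rightarrow> real^'n^'n" where
  "metric_in_coords g \<phi> x = (\<chi> i j. g (\<phi> x) (partial i \<phi> x) (partial j \<phi> x))"

text \<open>\<open>l\<close> is \<open>\<lambda>(A\<^sub>g)\<close> at the point \<open>\<theta>\<close>. The eigenvalues do not depend on the chart, so it is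
  required of every chart around \<open>\<theta>\<close>.\<close>

definition schouten_eigenvalues ::
    "((real^'n) \<times> real \<Rightarrow> (real^'n) \<times> real \<Rightarrow> (real^'n) \<times> real \<Rightarrow> real) \<Rightarrow>
     (real^'n) \<times> real \<Rightarrow> real^'n \<Rightarrow> bool" where
  "schouten_eigenvalues g \<theta> l \<longleftrightarrow>
     (\<forall>\<phi>\<in>sphere_params. \<forall>x. \<phi> x = \<theta> \<longrightarrow>
        eigenvalues_wrt (metric_in_coords g \<phi> x) (schouten (metric_in_coords g \<phi>) x) l)"

text \<open>Geodesic polar coordinates \<open>(r, \<omega>)\<close> centred at \<open>(0, -1)\<close>; for \<open>0 < r < \<pi>\<close> and \<open>norm \<omega> = 1\<close>
  they cover the sphere minus its poles, and \<open>\<theta>\<^sub>n\<^sub>+\<^sub>1 = - cos r\<close> increases with \<open>r\<close>.\<close>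

definition polar :: "real^'n \<Rightarrow> real \<Rightarrow> (real^'n) \<times> real" where
  "polar \<omega> r = (sin r *\<^sub>R \<omega>, - cos r)"

definition meridian_deriv :: "((real^'n) \<times> real \<Rightarrow> real) \<Rightarrow> real^'n \<Rightarrow> real \<Rightarrow> real" where
  "meridian_deriv K \<omega> r = deriv (\<lambda>t. K (polar \<omega> t)) r"

definition Gamma_1 :: "(real^'n) set" where
  "Gamma_1 = {l. (\<Sum>i\<in>UNIV. l $ i) > 0}"

definition Gamma_n :: "(real^'n) set" where
  "Gamma_n = {l. \<forall>i. l $ i > 0}"

definition permute :: "('n \<Rightarrow> 'n) \<Rightarrow> real^'n \<Rightarrow> real^'n" where
  "permute \<sigma> l = (\<chi> i. l $ \<sigma> i)"

definition symmetric_set :: "(real^'n) set \<Rightarrow> bool" where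
  "symmetric_set S \<longleftrightarrow> (\<forall>\<sigma> l. bij \<sigma> \<longrightarrow> l \<in> S \<longrightarrow> permute \<sigma> l \<in> S)"

definition symmetric_fun_on :: "(real^'n) set \<Rightarrow> (real^'n \<Rightarrow> real) \<Rightarrow> bool" where
  "symmetric_fun_on S f \<longleftrightarrow> (\<forall>\<sigma> l. bij \<sigma> \<longrightarrow> l \<in> S \<longrightarrow> f (permute \<sigma> l) = f l)"

text \<open>The library's \<open>cone\<close> contains its vertex; here the vertex is not required to belong to the cone.\<close>

definition open_cone :: "(real^'n) set \<Rightarrow> bool" where
  "open_cone S \<longleftrightarrow> open S \<and> (\<forall>l\<in>S. \<forall>t>0. t *\<^sub>R l \<in> S)"

end

theory Submission
  imports Defs
begin

text \<open>
  The proof is the method of moving spheres. In the stereographic chart centred at \<open>(0, 1)\<close> the metric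
  \<open>g\<^sub>1\<close> is \<open>p\<^sup>-\<^sup>2\<close> times the Euclidean one, in the chart centred at \<open>(0, -1)\<close> it is \<open>q\<^sup>-\<^sup>2\<close> times the
  Euclidean one, where \<open>p\<close> and \<open>q\<close> are positive \<open>C\<^sup>2\<close> functions on \<open>\<real>\<^sup>n\<close> with
  \<open>p(y) = |y|\<^sup>2 q(y/|y|\<^sup>2)\<close>. In terms of these functions the dimension disappears from the equation:
  the eigenvalues of the Schouten tensor of \<open>w\<^sup>-\<^sup>2 I\<close>, with respect to this metric, are those of
  \<open>S[w] = w D\<^sup>2w - |Dw|\<^sup>2/2 I\<close> (\<open>schouten_conformally_flat\<close>).

  The expression \<open>S\<close> does not change under \<open>q\<^sub>\<rho>(y) = \<rho>\<^sup>2 q(y/\<rho>\<^sup>2)\<close>. Hence on the ball \<open>|y| \<le> \<rho>\<close> both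
  \<open>p\<close> and \<open>q\<^sub>\<rho>\<close> solve the equation, the right-hand sides being the values of \<open>K\<close> at two points of one
  meridian, and the two functions agree on \<open>|y| = \<rho>\<close>. The point belonging to \<open>q\<^sub>\<rho>\<close> is the one closer
  to \<open>(0, -1)\<close>, so the monotonicity of \<open>K\<close> says \<open>f(\<lambda>(S[q\<^sub>\<rho>])) \<le> f(\<lambda>(S[p]))\<close>: this is the sign for which
  \<open>p \<le> q\<^sub>\<rho>\<close> obeys a maximum principle. The inequality \<open>p \<le> q\<^sub>\<rho>\<close> holds on the ball for large \<open>\<rho>\<close> and
  fails at \<open>y = 0\<close> for small \<open>\<rho>\<close>. At the smallest \<open>\<rho>\<close> down to which it holds, either \<open>p = q\<^sub>\<rho>\<close> on
  the ball, or \<open>p < q\<^sub>\<rho>\<close> inside with a strict inequality between the normal derivatives on the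
  boundary, and in the second case \<open>\<rho>\<close> could be decreased further
  (\<open>kelvin_pair_radial_coincidence\<close>). So \<open>p = q\<^sub>\<rho>\<close> for some \<open>\<rho>\<close>. Then \<open>K\<close> takes equal values at
  the two points of each pair; these pairs exhaust the meridians, and a nondecreasing function that
  agrees at points tending to both ends of an interval is constant. This contradicts the
  assumption that the derivative of \<open>K\<close> along the meridians is not identically zero.

  Neither concavity nor homogeneity of \<open>f\<close> is assumed, and \<open>f\<close> is only \<open>C\<^sup>1\<close>. So the Hopf lemma and the strong maximum
  principle are proved for the nonlinear equation itself (\<open>hopf_boundary_point\<close>,
  \<open>strong_maximum_principle\<close>). The barrier changes the matrix \<open>S\<close> by a positive multiple of the
  identity minus a much larger multiple of a rank-one projection. Subtracting the rank-one
  part raises no ordered eigenvalue, and lowers their sum by its trace, so \<open>f\<close> drops by a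
  definite amount that the multiple of the identity cannot compensate
  (\<open>spectral_function_decrease\<close>). What this needs from linear algebra is the monotonicity of the
  ordered eigenvalues under the order of quadratic forms (\<open>ordered_spectrum_mono\<close>). Near the
  boundary point under consideration all spectra stay close to one point of \<open>\<Gamma>\<close>, except that of \<open>S[p]\<close>,
  which is joined to the others by a segment inside the convex set \<open>\<Gamma>\<close>.
\<close>

section \<open>Ordered spectra of symmetric matrices\<close>

text \<open>The index type carries no order of its own; its enumeration \<open>to_nat\<close> provides one, so that
  ordered spectra can be compared entry by entry.\<close>
definition nondecreasing :: "real^'n \<Rightarrow> bool" where
  "nondecreasing l \<longleftrightarrow> (\<forall>i j. to_nat i \<le> to_nat j \<longrightarrow> l $ i \<le> l $ j)"

definition orthonormal_frame :: "('n \<Rightarrow> real^'n) \<Rightarrow> bool" where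
  "orthonormal_frame e \<longleftrightarrow> (\<forall>i j. e i \<bullet> e j = (if i = j then 1 else 0))"

definition eigenframe :: "real^'n^'n \<Rightarrow> real^'n \<Rightarrow> ('n \<Rightarrow> real^'n) \<Rightarrow> bool" where
  "eigenframe A l e \<longleftrightarrow> orthonormal_frame e \<and> (\<forall>i. A *v e i = (l $ i) *\<^sub>R e i)"

definition ordered_spectrum :: "real^'n^'n \<Rightarrow> real^'n \<Rightarrow> bool" where
  "ordered_spectrum A l \<longleftrightarrow> nondecreasing l \<and> (\<exists>e. eigenframe A l e)"

lemma nondecreasing_permutation_exists:
  fixes l :: "real^'n"
  shows "\<exists>\<sigma>. bij \<sigma> \<and> nondecreasing (permute \<sigma> l)"
proof -
  obtain zs where zs: "set zs = (UNIV::'n set)" "distinct zs"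
    using finite_distinct_list[OF finite_class.finite_UNIV] by blast
  define xs where "xs = sort_key (\<lambda>i. l $ i) zs"
  define ys where "ys = sort_key to_nat zs"
  have xs: "set xs = UNIV" "distinct xs" "length xs = CARD('n)" "sorted (map (\<lambda>i. l $ i) xs)"
    unfolding xs_def using zs distinct_card[of zs] by auto
  have ys: "set ys = UNIV" "distinct ys" "length ys = CARD('n)" "sorted (map to_nat ys)"
    unfolding ys_def using zs distinct_card[of zs] by auto
  have bx: "bij_betw (\<lambda>k. xs ! k) {..<CARD('n)} UNIV"
    using bij_betw_nth[of xs "{..<CARD('n)}" UNIV] xs by auto
  have "bij_betw (\<lambda>k. ys ! k) {..<CARD('n)} UNIV"
    using bij_betw_nth[of ys "{..<CARD('n)}" UNIV] ys by auto
  then obtain g where g: "bij_betw g UNIV {..<CARD('n)}" "\<And>i. ys ! (g i) = i"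
    by (metis UNIV_I bij_betw_inv_into bij_betw_inv_into_right)
  have "bij (\<lambda>i. xs ! g i)"
    using bij_betw_trans[OF g(1) bx] by (simp add: o_def)
  moreover have "nondecreasing (permute (\<lambda>i. xs ! g i) l)"
    unfolding nondecreasing_def permute_def
  proof (intro allI impI)
    fix i j :: 'n assume ij: "to_nat i \<le> to_nat j"
    have gl: "g i < CARD('n)" "g j < CARD('n)" using g(1) by (auto simp: bij_betw_def)
    have "g i \<le> g j"
    proof (rule ccontr)
      assume "\<not> g i \<le> g j"
      hence "to_nat (ys ! g j) \<le> to_nat (ys ! g i)"
        using sorted_nth_mono[OF ys(4), of "g j" "g i"] gl ys(3) by simp
      hence "to_nat i = to_nat j" using ij g(2) by simp
      thus False using \<open>\<not> g i \<le> g j\<close> by simp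
    qed
    thus "(\<chi> i. l $ (xs ! g i)) $ i \<le> (\<chi> i. l $ (xs ! g i)) $ j"
      using sorted_nth_mono[OF xs(4), of "g i" "g j"] gl xs(3) by simp
  qed
  ultimately show ?thesis by blast
qed

text \<open>If the \<open>i\<close>-th entry of \<open>l\<close> exceeded \<open>c = m $ i\<close>, then only indices before \<open>i\<close> could have
  \<open>l\<close>-entry at most \<open>c\<close>, while all indices up to \<open>i\<close> have \<open>m\<close>-entry at most \<open>c\<close>.\<close>
lemma nondecreasing_le_if_counts:
  fixes l m :: "real^'n"
  assumes "nondecreasing l" "nondecreasing m"
    and count: "\<And>c. card {i. m $ i \<le> c} \<le> card {i. l $ i \<le> c}"
  shows "l $ i \<le> m $ i"
proof (rule ccontr)
  assume less: "\<not> l $ i \<le> m $ i"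
  have "{j. l $ j \<le> m $ i} \<subseteq> {j::'n. to_nat j < to_nat i}"
    using assms(1) less unfolding nondecreasing_def by (smt (verit) Collect_mono not_le)
  moreover have "{j::'n. to_nat j < to_nat i} \<subset> {j. to_nat j \<le> to_nat i}"
    by (rule psubsetI) (auto simp: set_eq_iff intro: exI[of _ i])
  moreover have "{j::'n. to_nat j \<le> to_nat i} \<subseteq> {j. m $ j \<le> m $ i}"
    using assms(2) unfolding nondecreasing_def by auto
  ultimately have "card {j. l $ j \<le> m $ i} < card {j. m $ j \<le> m $ i}"
    by (intro psubset_card_mono) auto
  thus False using count[of "m $ i"] by simp
qed

lemma orthonormal_frame_inj: "orthonormal_frame e \<Longrightarrow> inj e"
  unfolding orthonormal_frame_def inj_def by (metis zero_neq_one)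

lemma orthonormal_frame_independent:
  assumes "orthonormal_frame e" shows "independent (e ` I)"
proof (rule pairwise_orthogonal_independent)
  show "pairwise orthogonal (e ` I)"
    using assms unfolding pairwise_def orthogonal_def orthonormal_frame_def by auto
  show "0 \<notin> e ` I"
    using assms unfolding orthonormal_frame_def by (metis imageE inner_zero_left zero_neq_one)
qed

lemma orthonormal_frame_dim:
  assumes "orthonormal_frame e" shows "dim (span (e ` I)) = card I"
  using orthonormal_frame_independent[OF assms, of I] orthonormal_frame_inj[OF assms]
  by (simp add: dim_eq_card_independent card_image inj_on_subset)

lemma orthonormal_frame_expansion:
  fixes e :: "'n::finite \<Rightarrow> real^'n"
  assumes "orthonormal_frame e" shows "x = (\<Sum>i\<in>UNIV. (x \<bullet> e i) *\<^sub>R e i)"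
proof -
  have "span (range e) = UNIV"
    using orthonormal_frame_dim[OF assms, of UNIV] by (metis DIM_cart DIM_real dim_eq_full dim_span mult.right_neutral)
  define y where "y = x - (\<Sum>i\<in>UNIV. (x \<bullet> e i) *\<^sub>R e i)"
  have "y \<bullet> e j = 0" for j
    using assms unfolding y_def orthonormal_frame_def
    by (simp add: inner_diff_left inner_sum_left if_distrib[of "\<lambda>t. _ * t"] cong: if_cong)
  hence "\<forall>z\<in>range e. orthogonal y z" by (auto simp: orthogonal_def)
  hence "orthogonal y y"
    using orthogonal_to_span[of y "range e" y] \<open>span (range e) = UNIV\<close> by blast
  thus ?thesis by (simp add: y_def orthogonal_def)
qed

lemma orthonormal_frame_span_coeff:
  assumes "orthonormal_frame e" "x \<in> span (e ` I)" "j \<notin> I" shows "x \<bullet> e j = 0"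
proof -
  have "orthogonal (e j) x"
    by (rule orthogonal_to_span[OF assms(2)])
      (use assms in \<open>auto simp: orthonormal_frame_def orthogonal_def\<close>)
  thus ?thesis by (simp add: orthogonal_def inner_commute)
qed

lemma orthonormal_frame_norm:
  fixes e :: "'n::finite \<Rightarrow> real^'n"
  assumes "orthonormal_frame e" shows "x \<bullet> x = (\<Sum>i\<in>UNIV. (x \<bullet> e i)\<^sup>2)"
  by (subst (2) orthonormal_frame_expansion[OF assms])
    (simp add: inner_sum_right power2_eq_square)

lemma eigenframe_apply:
  fixes e :: "'n::finite \<Rightarrow> real^'n"
  assumes "eigenframe A l e" shows "A *v x = (\<Sum>i\<in>UNIV. (l $ i * (x \<bullet> e i)) *\<^sub>R e i)"
proof -
  have on: "orthonormal_frame e" and ev: "\<And>i. A *v e i = (l $ i) *\<^sub>R e i"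
    using assms by (auto simp: eigenframe_def)
  have "A *v x = A *v (\<Sum>i\<in>UNIV. (x \<bullet> e i) *\<^sub>R e i)"
    using orthonormal_frame_expansion[OF on, of x] by simp
  also have "\<dots> = (\<Sum>i\<in>UNIV. (x \<bullet> e i) *\<^sub>R (A *v e i))"
    by (simp add: linear_sum[OF matrix_vector_mul_linear] matrix_vector_mult_scaleR)
  finally show ?thesis by (simp add: ev mult.commute)
qed

lemma eigenframe_quadratic:
  fixes e :: "'n::finite \<Rightarrow> real^'n"
  assumes "eigenframe A l e" shows "x \<bullet> (A *v x) = (\<Sum>i\<in>UNIV. l $ i * (x \<bullet> e i)\<^sup>2)"
  by (simp add: eigenframe_apply[OF assms] inner_sum_right power2_eq_square mult.assoc)

text \<open>The half of the minimax principle that gives Weyl's inequality. On the span \<open>V\<close> of the eigenvectors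
  of \<open>B\<close> with eigenvalue at most \<open>c\<close> the form of \<open>B\<close> is at most \<open>c |x|\<^sup>2\<close>; on the span \<open>U\<close> of those of
  \<open>A\<close> with eigenvalue above \<open>c\<close> the form of \<open>A\<close> exceeds \<open>c |x|\<^sup>2\<close> away from \<open>0\<close>. So \<open>V\<close> and \<open>U\<close> meet
  only in \<open>0\<close>, and their dimensions add up to at most \<open>n\<close>.\<close>
lemma eigenframe_count_mono:
  fixes A B :: "real^'n^'n"
  assumes A: "eigenframe A l e" and B: "eigenframe B m h"
    and le: "\<And>x. x \<bullet> (A *v x) \<le> x \<bullet> (B *v x)"
  shows "card {i. m $ i \<le> c} \<le> card {i. l $ i \<le> c}"
proof -
  let ?V = "span (h ` {i. m $ i \<le> c})" and ?U = "span (e ` {i. \<not> l $ i \<le> c})"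
  have one: "orthonormal_frame e" and onh: "orthonormal_frame h"
    using A B by (auto simp: eigenframe_def)
  have "x = 0" if xV: "x \<in> ?V" and xU: "x \<in> ?U" for x
  proof (rule ccontr)
    assume "x \<noteq> 0"
    have "x \<bullet> (B *v x) \<le> c * (x \<bullet> x)"
      unfolding eigenframe_quadratic[OF B] orthonormal_frame_norm[OF onh] sum_distrib_left
    proof (rule sum_mono)
      fix i show "m $ i * (x \<bullet> h i)\<^sup>2 \<le> c * (x \<bullet> h i)\<^sup>2"
        using orthonormal_frame_span_coeff[OF onh xV, of i] 
        by (cases "m $ i \<le> c") (auto intro: mult_right_mono)
    qed
    moreover have "c * (x \<bullet> x) < x \<bullet> (A *v x)"
      unfolding eigenframe_quadratic[OF A] orthonormal_frame_norm[OF one] sum_distrib_left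
    proof (rule sum_strict_mono_ex1)
      show "\<forall>i\<in>UNIV. c * (x \<bullet> e i)\<^sup>2 \<le> l $ i * (x \<bullet> e i)\<^sup>2"
      proof
        fix i show "c * (x \<bullet> e i)\<^sup>2 \<le> l $ i * (x \<bullet> e i)\<^sup>2"
          using orthonormal_frame_span_coeff[OF one xU, of i]
          by (cases "l $ i \<le> c") (auto intro: mult_right_mono)
      qed
      obtain i where i: "x \<bullet> e i \<noteq> 0"
        using \<open>x \<noteq> 0\<close> orthonormal_frame_expansion[OF one, of x] by fastforce
      hence "c < l $ i" using orthonormal_frame_span_coeff[OF one xU, of i] by force
      thus "\<exists>i\<in>UNIV. c * (x \<bullet> e i)\<^sup>2 < l $ i * (x \<bullet> e i)\<^sup>2"
        using i by (intro bexI[of _ i]) auto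
    qed simp
    ultimately show False using le[of x] by simp
  qed
  hence "?V \<inter> ?U = {0}" using span_zero by blast
  hence "dim {x + y |x y. x \<in> ?V \<and> y \<in> ?U} = dim ?V + dim ?U"
    using dim_sums_Int[of ?V ?U] by simp
  hence "card {i. m $ i \<le> c} + card {i. \<not> l $ i \<le> c} \<le> CARD('n)"
    using dim_subset_UNIV[of "{x + y |x y. x \<in> ?V \<and> y \<in> ?U}"]
    by (simp only: orthonormal_frame_dim[OF one] orthonormal_frame_dim[OF onh] DIM_cart DIM_real mult_1_right)
  moreover have "card {i. l $ i \<le> c} + card {i. \<not> l $ i \<le> c} = CARD('n)"
    by (subst card_Un_disjoint[symmetric]) (auto intro: arg_cong[where f = card])
  ultimately show ?thesis by linarith
qed

lemma ordered_spectrum_mono: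
  assumes "ordered_spectrum A l" "ordered_spectrum B m"
    and "\<And>x. x \<bullet> (A *v x) \<le> x \<bullet> (B *v x)"
  shows "l $ i \<le> m $ i"
  using assms nondecreasing_le_if_counts[of l m] eigenframe_count_mono[of A l _ B m]
  unfolding ordered_spectrum_def by blast

lemma ordered_spectrum_add_scalar:
  assumes "ordered_spectrum A l"
  shows "ordered_spectrum (A + t *\<^sub>R mat 1) (\<chi> i. l $ i + t)"
  using assms unfolding ordered_spectrum_def eigenframe_def nondecreasing_def
  by (simp add: matrix_vector_mult_add_rdistrib scaleR_matrix_vector_assoc[symmetric] scaleR_add_left)

text \<open>In an orthonormal eigenbasis, which forms an orthogonal matrix \<open>Q\<close>, the diagonal of
  \<open>Q A Q\<^sup>T\<close> consists of the eigenvalues; conjugation preserves the trace.\<close>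
lemma ordered_spectrum_trace:
  fixes A :: "real^'n^'n"
  assumes "ordered_spectrum A l"
  shows "(\<Sum>i\<in>UNIV. l $ i) = trace A"
proof -
  obtain e where e: "eigenframe A l e" using assms by (auto simp: ordered_spectrum_def)
  hence on: "orthonormal_frame e" by (simp add: eigenframe_def)
  define Q :: "real^'n^'n" where "Q = (\<chi> i. e i)"
  have "Q ** transpose Q = mat 1"
    using on by (simp add: Q_def vec_eq_iff matrix_matrix_mult_def transpose_def mat_def
        orthonormal_frame_def inner_vec_def)
  hence Q: "transpose Q ** Q = mat 1" using matrix_left_right_inverse by blast
  have "trace A = trace (A ** (transpose Q ** Q))" by (simp add: Q)
  also have "\<dots> = trace (Q ** (A ** transpose Q))"
    by (metis matrix_mul_assoc trace_mul_sym)
  also have "\<dots> = (\<Sum>i\<in>UNIV. e i \<bullet> (A *v e i))"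
    by (simp add: trace_def Q_def matrix_matrix_mult_def transpose_def inner_vec_def
        matrix_vector_mult_def)
  also have "\<dots> = (\<Sum>i\<in>UNIV. l $ i)"
    using e on by (simp add: eigenframe_def orthonormal_frame_def)
  finally show ?thesis by simp
qed

lemma symmetric_matrix_inner:
  fixes A :: "real^'n^'n"
  assumes "transpose A = A" shows "x \<bullet> (A *v y) = (A *v x) \<bullet> y"
  using assms by (metis dot_lmul_matrix vector_transpose_matrix)

text \<open>A maximum point of \<open>x \<bullet> A x\<close> on the unit sphere of \<open>V\<close> is an eigenvector: with the maximum \<open>\<mu>\<close>
  the vector \<open>z = A v - \<mu> v\<close> lies in \<open>V\<close> and is orthogonal to \<open>v\<close>, and moving from \<open>v\<close> in the
  direction \<open>z\<close> would increase the quotient to first order by \<open>2 |z|\<^sup>2\<close>.\<close>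
lemma symmetric_matrix_invariant_eigenvector:
  fixes A :: "real^'n^'n"
  assumes sym: "transpose A = A" and V: "subspace V" and inv: "\<And>x. x \<in> V \<Longrightarrow> A *v x \<in> V"
    and nontriv: "\<exists>x\<in>V. x \<noteq> 0"
  shows "\<exists>v\<in>V. norm v = 1 \<and> (\<exists>\<mu>. A *v v = \<mu> *\<^sub>R v)"
proof -
  let ?S = "V \<inter> sphere 0 1"
  have "compact ?S" using V by (simp add: closed_subspace closed_Int_compact)
  obtain x0 where x0: "x0 \<in> V" "x0 \<noteq> 0" using nontriv by blast
  hence "(1 / norm x0) *\<^sub>R x0 \<in> ?S" using V by (simp add: subspace_scale)
  hence "?S \<noteq> {}" by blast
  have "continuous_on ?S (\<lambda>x. x \<bullet> (A *v x))"
    by (intro continuous_intros linear_continuous_on_compose[OF _ matrix_vector_mul_linear])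
  from continuous_attains_sup[OF \<open>compact ?S\<close> \<open>?S \<noteq> {}\<close> this]
  obtain v where v: "v \<in> ?S" and max: "\<And>y. y \<in> ?S \<Longrightarrow> y \<bullet> (A *v y) \<le> v \<bullet> (A *v v)" by blast
  define \<mu> where "\<mu> = v \<bullet> (A *v v)"
  have vv: "v \<bullet> v = 1" using v by (simp add: dot_square_norm)
  have le: "y \<bullet> (A *v y) \<le> \<mu> * (y \<bullet> y)" if "y \<in> V" for y
  proof (cases "y = 0")
    case False
    let ?y = "(1 / norm y) *\<^sub>R y"
    have "?y \<in> ?S" using that False V by (simp add: subspace_scale)
    hence "?y \<bullet> (A *v ?y) \<le> \<mu>" using max unfolding \<mu>_def by blast
    hence "(y \<bullet> (A *v y)) / (norm y)\<^sup>2 \<le> \<mu>"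
      by (simp add: matrix_vector_mult_scaleR power2_eq_square)
    thus ?thesis using False by (simp add: dot_square_norm divide_le_eq)
  qed simp
  define z where "z = A *v v - \<mu> *\<^sub>R v"
  have zV: "z \<in> V" unfolding z_def using v V inv by (simp add: subspace_diff subspace_scale)
  have zv: "z \<bullet> v = 0" unfolding z_def \<mu>_def using vv
    by (simp add: inner_diff_left inner_commute[of "A *v v" v])
  have zAv: "z \<bullet> (A *v v) = z \<bullet> z"
    using zv by (simp add: z_def inner_diff_right inner_diff_left algebra_simps)
  \<comment> \<open>The left side is linear and the right side quadratic in the step length, so a small step refutes a nonzero vector.\<close>
  have "2 * t * (z \<bullet> z) \<le> t\<^sup>2 * (\<mu> * (z \<bullet> z) - z \<bullet> (A *v z))" for t
  proof -
    have "v + t *\<^sub>R z \<in> V" using v zV V by (simp add: subspace_add subspace_scale)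
    from le[OF this] have "\<mu> + 2 * t * (z \<bullet> (A *v v)) + t\<^sup>2 * (z \<bullet> (A *v z)) \<le> \<mu> * (1 + t\<^sup>2 * (z \<bullet> z))"
      using symmetric_matrix_inner[OF sym, of v z] zv vv
      by (simp add: matrix_vector_right_distrib matrix_vector_mult_scaleR inner_add_left
          inner_add_right \<mu>_def[symmetric] inner_commute power2_eq_square algebra_simps)
    thus ?thesis by (simp add: zAv algebra_simps)
  qed
  note quad = this
  have "z \<bullet> z = 0"
  proof (rule ccontr)
    assume "z \<bullet> z \<noteq> 0"
    hence pos: "z \<bullet> z > 0" by simp
    define k where "k = \<bar>\<mu> * (z \<bullet> z) - z \<bullet> (A *v z)\<bar> + 1"
    have k: "k > 0" unfolding k_def by simp
    define t where "t = (z \<bullet> z) / k"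
    have t: "t > 0" using pos k by (simp add: t_def)
    have "\<mu> * (z \<bullet> z) - z \<bullet> (A *v z) \<le> k" unfolding k_def by linarith
    hence "2 * t * (z \<bullet> z) \<le> t\<^sup>2 * k"
      using order_trans[OF quad[of t] mult_left_mono] by simp
    also have "t\<^sup>2 * k = t * (z \<bullet> z)" using k by (simp add: t_def power2_eq_square)
    finally show False using t pos by simp
  qed
  hence "A *v v = \<mu> *\<^sub>R v" by (simp add: z_def)
  thus ?thesis using v by auto
qed

text \<open>Spectral theorem by induction: the orthogonal complement of a set of eigenvectors is invariant
  under a symmetric matrix, so it contains a further eigenvector.\<close>
lemma symmetric_matrix_orthonormal_eigenvectors:
  fixes A :: "real^'n^'n"
  assumes sym: "transpose A = A" and "k \<le> CARD('n)"
  shows "\<exists>B. finite B \<and> card B = k \<and> pairwise orthogonal B \<and>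
    (\<forall>b\<in>B. norm b = 1 \<and> (\<exists>\<mu>. A *v b = \<mu> *\<^sub>R b))"
  using assms(2)
proof (induction k)
  case 0 show ?case by (intro exI[of _ "{}"]) auto
next
  case (Suc k)
  then obtain B where B: "finite B" "card B = k" "pairwise orthogonal B"
    "\<And>b. b \<in> B \<Longrightarrow> norm b = 1" "\<And>b. b \<in> B \<Longrightarrow> \<exists>\<mu>. A *v b = \<mu> *\<^sub>R b" by auto
  let ?V = "{x. \<forall>b\<in>B. orthogonal b x}"
  have V: "subspace ?V" by (rule subspace_orthogonal_to_vectors)
  have inv: "A *v x \<in> ?V" if "x \<in> ?V" for x
    using that B(5) symmetric_matrix_inner[OF sym] by (fastforce simp: orthogonal_def)
  have "dim (span B) < DIM(real^'n)"
    using dim_le_card'[OF B(1)] B(2) Suc.prems by simp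
  then obtain x where x: "x \<noteq> 0" "\<And>y. y \<in> span B \<Longrightarrow> orthogonal x y"
    using orthogonal_to_subspace_exists[of "B"] by auto
  have "\<exists>x\<in>?V. x \<noteq> 0"
    using x by (intro bexI[of _ x]) (auto simp: orthogonal_commute span_base)
  from symmetric_matrix_invariant_eigenvector[OF sym V inv this]
  obtain v where v: "v \<in> ?V" "norm v = 1" "\<exists>\<mu>. A *v v = \<mu> *\<^sub>R v" by blast
  have "v \<notin> B"
  proof
    assume "v \<in> B" hence "orthogonal v v" using v(1) by blast
    thus False using v(2) by (simp add: orthogonal_def)
  qed
  moreover have "pairwise orthogonal (insert v B)"
    using B(3) v(1) by (auto simp: pairwise_insert orthogonal_commute)
  ultimately show ?case
    using B v by (intro exI[of _ "insert v B"]) auto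
qed

lemma symmetric_matrix_eigenframe:
  fixes A :: "real^'n^'n"
  assumes sym: "transpose A = A"
  shows "\<exists>l e. eigenframe A l e"
proof -
  obtain B where B: "finite B" "card B = CARD('n)" "pairwise orthogonal B"
    "\<And>b. b \<in> B \<Longrightarrow> norm b = 1" "\<And>b. b \<in> B \<Longrightarrow> \<exists>\<mu>. A *v b = \<mu> *\<^sub>R b"
    using symmetric_matrix_orthonormal_eigenvectors[OF sym, of "CARD('n)"] by auto
  obtain e where e: "bij_betw e (UNIV::'n set) B"
    using finite_same_card_bij[of "UNIV::'n set" B] B by auto
  have eB: "e i \<in> B" for i using e by (auto simp: bij_betw_def)
  obtain \<mu> where "\<And>i. A *v e i = \<mu> i *\<^sub>R e i"
    using B(5)[OF eB] by metis
  moreover have "orthonormal_frame e"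
    unfolding orthonormal_frame_def
  proof (intro allI)
    fix i j
    show "e i \<bullet> e j = (if i = j then 1 else 0)"
    proof (cases "i = j")
      case True thus ?thesis using B(4)[OF eB] by (simp add: dot_square_norm)
    next
      case False
      hence "e i \<noteq> e j" using e by (meson UNIV_I bij_betw_imp_inj_on inj_onD)
      thus ?thesis using False B(3) eB unfolding pairwise_def orthogonal_def by simp
    qed
  qed
  ultimately have "eigenframe A (\<chi> i. \<mu> i) e" by (simp add: eigenframe_def)
  thus ?thesis by blast
qed

lemma eigenframe_permute:
  assumes "eigenframe A l e" "bij \<sigma>"
  shows "eigenframe A (permute \<sigma> l) (e \<circ> \<sigma>)"
  using assms unfolding eigenframe_def orthonormal_frame_def permute_def
  by (auto simp: bij_def inj_eq)

lemma symmetric_matrix_ordered_spectrum: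
  fixes A :: "real^'n^'n"
  assumes "transpose A = A"
  shows "\<exists>l. ordered_spectrum A l"
  using symmetric_matrix_eigenframe[OF assms] nondecreasing_permutation_exists eigenframe_permute
  unfolding ordered_spectrum_def by metis

lemma eigenframe_eigenspace_dim:
  fixes A :: "real^'n^'n"
  assumes "eigenframe A l e"
  shows "dim {X. A *v X = \<mu> *\<^sub>R X} = card {i. l $ i = \<mu>}"
proof -
  have on: "orthonormal_frame e" using assms by (simp add: eigenframe_def)
  have "{X. A *v X = \<mu> *\<^sub>R X} = span (e ` {i. l $ i = \<mu>})"
  proof (intro subset_antisym subsetI)
    fix X assume "X \<in> {X. A *v X = \<mu> *\<^sub>R X}"
    hence X: "A *v X = \<mu> *\<^sub>R X" by simp
    have coeff: "X \<bullet> e j = 0" if "l $ j \<noteq> \<mu>" for j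
    proof -
      have "(A *v X) \<bullet> e j = l $ j * (X \<bullet> e j)"
        using on by (simp add: eigenframe_apply[OF assms] inner_sum_left
            orthonormal_frame_def if_distrib[of "\<lambda>t. _ * t"] cong: if_cong)
      thus ?thesis using X that by simp
    qed
    have "X = (\<Sum>i\<in>UNIV. (X \<bullet> e i) *\<^sub>R e i)" by (rule orthonormal_frame_expansion[OF on])
    also have "\<dots> \<in> span (e ` {i. l $ i = \<mu>})"
    proof (rule span_sum)
      fix i show "(X \<bullet> e i) *\<^sub>R e i \<in> span (e ` {i. l $ i = \<mu>})"
        by (cases "l $ i = \<mu>") (auto simp: coeff span_zero intro: span_scale span_base)
    qed
    finally show "X \<in> span (e ` {i. l $ i = \<mu>})" .
  next
    fix X assume X: "X \<in> span (e ` {i. l $ i = \<mu>})"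
    have "A *v X = (\<Sum>i\<in>UNIV. \<mu> *\<^sub>R ((X \<bullet> e i) *\<^sub>R e i))"
      unfolding eigenframe_apply[OF assms]
    proof (rule sum.cong[OF refl])
      fix i show "(l $ i * (X \<bullet> e i)) *\<^sub>R e i = \<mu> *\<^sub>R ((X \<bullet> e i) *\<^sub>R e i)"
        using orthonormal_frame_span_coeff[OF on X, of i] by (cases "l $ i = \<mu>") auto
    qed
    also have "\<dots> = \<mu> *\<^sub>R X"
      unfolding scaleR_sum_right[symmetric] orthonormal_frame_expansion[OF on, of X, symmetric] ..
    finally show "X \<in> {X. A *v X = \<mu> *\<^sub>R X}" by simp
  qed
  thus ?thesis using orthonormal_frame_dim[OF on] by simp
qed

lemma card_sublevels_eq:
  fixes l m :: "real^'n"
  assumes "\<And>\<mu>. card {i. l $ i = \<mu>} = card {i. m $ i = \<mu>}"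
  shows "card {i. l $ i \<le> c} = card {i. m $ i \<le> c}"
proof -
  let ?T = "{t \<in> range (($) l) \<union> range (($) m). t \<le> c}"
  have "card {i. k $ i \<le> c} = (\<Sum>t\<in>?T. card {i. k $ i = t})" if "k = l \<or> k = m" for k
  proof -
    have "{i. k $ i \<le> c} = (\<Union>t\<in>?T. {i. k $ i = t})" using that by auto
    moreover have "card (\<Union>t\<in>?T. {i. k $ i = t}) = (\<Sum>t\<in>?T. card {i. k $ i = t})"
      by (rule card_UN_disjoint) auto
    ultimately show ?thesis by simp
  qed
  thus ?thesis using assms by simp
qed

text \<open>The eigenspace for \<open>\<mu>\<close> is spanned by the members of an orthonormal eigenbasis with eigenvalue \<open>\<mu>\<close>,
  so \<open>l\<close> and the eigenvalues of the basis contain each \<open>\<mu>\<close> equally often.\<close>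
lemma eigenvalues_ordered_spectrum:
  fixes A :: "real^'n^'n"
  assumes sym: "transpose A = A" and l: "\<And>\<mu>. card {i. l $ i = \<mu>} = dim {X. A *v X = \<mu> *\<^sub>R X}"
  shows "\<exists>\<sigma>. bij \<sigma> \<and> ordered_spectrum A (permute \<sigma> l)"
proof -
  obtain m where m: "ordered_spectrum A m" using symmetric_matrix_ordered_spectrum[OF sym] by blast
  then obtain e where e: "eigenframe A m e" by (auto simp: ordered_spectrum_def)
  obtain \<sigma> where \<sigma>: "bij \<sigma>" "nondecreasing (permute \<sigma> l)" using nondecreasing_permutation_exists by blast
  have "card {i. permute \<sigma> l $ i = \<mu>} = card {i. m $ i = \<mu>}" for \<mu>
  proof -
    have "\<sigma> ` {i. l $ \<sigma> i = \<mu>} = {i. l $ i = \<mu>}"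
      using \<sigma>(1) by (auto simp: bij_def image_iff)
    hence "card {i. l $ \<sigma> i = \<mu>} = card {i. l $ i = \<mu>}"
      using \<sigma>(1) by (metis bij_is_inj card_image inj_on_subset subset_UNIV)
    thus ?thesis using l eigenframe_eigenspace_dim[OF e] by (simp add: permute_def)
  qed
  note cnt = card_sublevels_eq[OF this]
  have "permute \<sigma> l = m"
    using nondecreasing_le_if_counts[of "permute \<sigma> l" m] nondecreasing_le_if_counts[of m "permute \<sigma> l"]
      \<sigma>(2) m cnt unfolding ordered_spectrum_def vec_eq_iff by (metis order.refl order_antisym)
  thus ?thesis using \<sigma> m by auto
qed

section \<open>Functions with a continuous Hessian\<close>

definition outer :: "real^'n \<Rightarrow> real^'n \<Rightarrow> real^'n^'n" where
  "outer a b = (\<chi> i j. a $ i * b $ j)"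

lemma outer_mult_vec: "outer a b *v h = (b \<bullet> h) *\<^sub>R a"
  by (simp add: outer_def vec_eq_iff matrix_vector_mult_def inner_vec_def sum_distrib_left mult_ac)

lemma continuous_on_outer [continuous_intros]:
  assumes "continuous_on S a" "continuous_on S b"
  shows "continuous_on S (\<lambda>x. outer (a x) (b x))"
  unfolding outer_def
  by (intro continuous_on_vec_lambda continuous_on_mult continuous_on_component assms)

text \<open>Twice continuous differentiability with named gradient and Hessian, on the whole space: the charts of
  the sphere used here are defined on all of \<open>\<real>\<^sup>n\<close>.\<close>
definition has_hessian ::
    "(real^'n \<Rightarrow> real) \<Rightarrow> (real^'n \<Rightarrow> real^'n) \<Rightarrow> (real^'n \<Rightarrow> real^'n^'n) \<Rightarrow> bool" where
  "has_hessian u g H \<longleftrightarrow>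
     (\<forall>x. (u has_derivative (\<lambda>h. g x \<bullet> h)) (at x)) \<and>
     (\<forall>x. (g has_derivative (\<lambda>h. H x *v h)) (at x)) \<and> continuous_on UNIV H"

lemma has_hessianD:
  assumes "has_hessian u g H"
  shows "(u has_derivative (\<lambda>h. g x \<bullet> h)) (at x)" "(g has_derivative (\<lambda>h. H x *v h)) (at x)"
    "continuous_on UNIV u" "continuous_on UNIV g" "continuous_on UNIV H"
proof -
  show u: "(u has_derivative (\<lambda>h. g x \<bullet> h)) (at x)"
    and g: "(g has_derivative (\<lambda>h. H x *v h)) (at x)" for x
    using assms by (auto simp: has_hessian_def)
  show "continuous_on UNIV u" "continuous_on UNIV g"
    using has_derivative_continuous[OF u] has_derivative_continuous[OF g]
    by (auto simp: continuous_on_eq_continuous_at)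
  show "continuous_on UNIV H" using assms by (auto simp: has_hessian_def)
qed

lemma linear_eq_inner_axis:
  fixes L :: "real^'n \<Rightarrow> real"
  assumes "linear L" shows "L h = (\<chi> i. L (axis i 1)) \<bullet> h"
proof -
  have "L h = L (\<Sum>i\<in>UNIV. h $ i *\<^sub>R axis i 1)" by (simp only: basis_expansion scalar_mult_eq_scaleR[symmetric])
  also have "\<dots> = (\<Sum>i\<in>UNIV. h $ i * L (axis i 1))"
    using assms by (simp add: linear_sum linear_scale)
  finally show ?thesis by (simp add: inner_vec_def mult.commute)
qed

lemma C1_on_gradient:
  fixes f :: "real^'n \<Rightarrow> real"
  assumes "C1_on U f"
  obtains g where "\<And>x. x \<in> U \<Longrightarrow> (f has_derivative (\<lambda>h. g x \<bullet> h)) (at x)" "continuous_on U g"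
proof -
  obtain f' where f': "\<And>x. x \<in> U \<Longrightarrow> (f has_derivative blinfun_apply (f' x)) (at x)"
    "continuous_on U f'" using assms by (auto simp: C1_on_def)
  have lin: "blinfun_apply (f' x) h = (\<chi> i. blinfun_apply (f' x) (axis i 1)) \<bullet> h" for x h
    by (rule linear_eq_inner_axis) (simp add: blinfun.bounded_linear_right bounded_linear.linear)
  show thesis
  proof (rule that[of "\<lambda>x. \<chi> i. blinfun_apply (f' x) (axis i 1)"])
    fix x assume "x \<in> U"
    thus "(f has_derivative (\<lambda>h. (\<chi> i. blinfun_apply (f' x) (axis i 1)) \<bullet> h)) (at x)"
      using f'(1) lin[of x] by (metis (no_types, lifting) ext)
  next
    show "continuous_on U (\<lambda>x. \<chi> i. blinfun_apply (f' x) (axis i 1))"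
      by (intro continuous_on_vec_lambda continuous_intros f')
  qed
qed

lemma C2_on_has_hessian:
  fixes u :: "real^'n \<Rightarrow> real"
  assumes "C2_on UNIV u"
  obtains g H where "has_hessian u g H"
proof -
  obtain u' where u': "\<And>x. (u has_derivative blinfun_apply (u' x)) (at x)" and "C1_on UNIV u'"
    using assms by (auto simp: C2_on_def)
  then obtain u'' where u'': "\<And>x. (u' has_derivative blinfun_apply (u'' x)) (at x)"
    "continuous_on UNIV u''" by (auto simp: C1_on_def)
  define g where "g x = (\<chi> i. blinfun_apply (u' x) (axis i 1))" for x
  define H where "H x = (\<chi> i j. blinfun_apply (blinfun_apply (u'' x) (axis j 1)) (axis i 1))" for x
  have "blinfun_apply (u' x) h = g x \<bullet> h" for x h
    unfolding g_def
    by (rule linear_eq_inner_axis) (simp add: blinfun.bounded_linear_right bounded_linear.linear)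
  hence 1: "(u has_derivative (\<lambda>h. g x \<bullet> h)) (at x)" for x
    using u'[of x] by (metis (no_types, lifting) ext)
  have 2: "(g has_derivative (\<lambda>h. H x *v h)) (at x)" for x
  proof -
    have "(g has_derivative (\<lambda>h. \<chi> i. blinfun_apply (blinfun_apply (u'' x) h) (axis i 1))) (at x)"
      unfolding g_def
      by (subst has_derivative_componentwise_within)
        (auto simp: Basis_vec_def inner_axis intro!: derivative_eq_intros u'' 
          bounded_linear.has_derivative[OF blinfun.bounded_linear_left])
    moreover have "(\<chi> i. blinfun_apply (blinfun_apply (u'' x) h) (axis i 1)) = H x *v h" for h
    proof -
      have "blinfun_apply (blinfun_apply (u'' x) h) (axis i 1)
          = (\<chi> j. blinfun_apply (blinfun_apply (u'' x) (axis j 1)) (axis i 1)) \<bullet> h" for i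
        by (rule linear_eq_inner_axis[of "\<lambda>h. blinfun_apply (blinfun_apply (u'' x) h) (axis i 1)"])
          (simp add: bounded_linear.linear[OF bounded_linear_compose[OF blinfun.bounded_linear_left blinfun.bounded_linear_right]])
      thus ?thesis by (simp add: H_def vec_eq_iff matrix_vector_mult_def inner_vec_def)
    qed
    ultimately show ?thesis by simp
  qed
  have "continuous_on UNIV H" unfolding H_def
    by (intro continuous_on_vec_lambda continuous_intros u'')
  thus thesis using 1 2 that[of g H] by (auto simp: has_hessian_def)
qed

lemma has_hessian_const: "has_hessian (\<lambda>x. c) (\<lambda>x. 0) (\<lambda>x. 0)"
  by (auto simp: has_hessian_def)

lemma has_hessian_add:
  assumes "has_hessian u gu Hu" "has_hessian w gw Hw"
  shows "has_hessian (\<lambda>x. u x + w x) (\<lambda>x. gu x + gw x) (\<lambda>x. Hu x + Hw x)"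
  using assms unfolding has_hessian_def
  by (auto intro!: derivative_eq_intros continuous_intros simp: inner_add_left matrix_vector_mult_add_rdistrib)

lemma has_hessian_mult:
  assumes "has_hessian u gu Hu" "has_hessian w gw Hw"
  shows "has_hessian (\<lambda>x. u x * w x) (\<lambda>x. u x *\<^sub>R gw x + w x *\<^sub>R gu x)
    (\<lambda>x. u x *\<^sub>R Hw x + w x *\<^sub>R Hu x + outer (gw x) (gu x) + outer (gu x) (gw x))"
proof -
  note u = has_hessianD[OF assms(1)] and w = has_hessianD[OF assms(2)]
  show ?thesis unfolding has_hessian_def
  proof (intro conjI allI)
    fix x
    show "((\<lambda>x. u x * w x) has_derivative (\<lambda>h. (u x *\<^sub>R gw x + w x *\<^sub>R gu x) \<bullet> h)) (at x)"
      by (auto intro!: derivative_eq_intros u w simp: inner_add_left algebra_simps)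
    show "((\<lambda>x. u x *\<^sub>R gw x + w x *\<^sub>R gu x) has_derivative
        (\<lambda>h. (u x *\<^sub>R Hw x + w x *\<^sub>R Hu x + outer (gw x) (gu x) + outer (gu x) (gw x)) *v h)) (at x)"
      by (auto intro!: derivative_eq_intros u w
          simp: matrix_vector_mult_add_rdistrib outer_mult_vec scaleR_matrix_vector_assoc[symmetric])
    show "continuous_on UNIV
        (\<lambda>x. u x *\<^sub>R Hw x + w x *\<^sub>R Hu x + outer (gw x) (gu x) + outer (gu x) (gw x))"
      by (intro continuous_intros u w)
  qed
qed

lemma has_hessian_cmult:
  assumes "has_hessian u g H"
  shows "has_hessian (\<lambda>x. c * u x) (\<lambda>x. c *\<^sub>R g x) (\<lambda>x. c *\<^sub>R H x)"
  using has_hessian_mult[OF has_hessian_const[of c] assms]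
  by (simp add: outer_def zero_vec_def[symmetric])

lemma has_hessian_diff:
  assumes "has_hessian u gu Hu" "has_hessian w gw Hw"
  shows "has_hessian (\<lambda>x. u x - w x) (\<lambda>x. gu x - gw x) (\<lambda>x. Hu x - Hw x)"
  using has_hessian_add[OF assms(1) has_hessian_cmult[OF assms(2), of "-1"]] by simp

lemma has_hessian_compose_real:
  assumes "has_hessian u g H"
    and "\<And>x. (\<psi> has_real_derivative \<psi>' (u x)) (at (u x))"
    and "\<And>x. (\<psi>' has_real_derivative \<psi>'' (u x)) (at (u x))"
    and "continuous_on UNIV (\<lambda>x. \<psi>'' (u x))"
  shows "has_hessian (\<lambda>x. \<psi> (u x)) (\<lambda>x. \<psi>' (u x) *\<^sub>R g x)
    (\<lambda>x. \<psi>' (u x) *\<^sub>R H x + \<psi>'' (u x) *\<^sub>R outer (g x) (g x))"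
proof -
  note u = has_hessianD[OF assms(1)]
  have 1: "((\<lambda>x. \<psi> (u x)) has_derivative (\<lambda>h. \<psi>' (u x) * (g x \<bullet> h))) (at x)"
    and 2: "((\<lambda>x. \<psi>' (u x)) has_derivative (\<lambda>h. \<psi>'' (u x) * (g x \<bullet> h))) (at x)" for x
    using has_derivative_compose[OF u(1) assms(2)[unfolded has_field_derivative_def]]
      has_derivative_compose[OF u(1) assms(3)[unfolded has_field_derivative_def]] by auto
  have c: "continuous_on UNIV (\<lambda>x. \<psi>' (u x))"
    using has_derivative_continuous[OF 2] by (auto simp: continuous_on_eq_continuous_at)
  show ?thesis unfolding has_hessian_def
  proof (intro conjI allI)
    fix x
    show "((\<lambda>x. \<psi> (u x)) has_derivative (\<lambda>h. (\<psi>' (u x) *\<^sub>R g x) \<bullet> h)) (at x)"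
      using 1[of x] by simp
    show "((\<lambda>x. \<psi>' (u x) *\<^sub>R g x) has_derivative
        (\<lambda>h. (\<psi>' (u x) *\<^sub>R H x + \<psi>'' (u x) *\<^sub>R outer (g x) (g x)) *v h)) (at x)"
      by (auto intro!: derivative_eq_intros 2 u
          simp: matrix_vector_mult_add_rdistrib outer_mult_vec scaleR_matrix_vector_assoc[symmetric])
    show "continuous_on UNIV (\<lambda>x. \<psi>' (u x) *\<^sub>R H x + \<psi>'' (u x) *\<^sub>R outer (g x) (g x))"
      by (intro continuous_intros u c assms(4))
  qed
qed

lemma has_hessian_norm_square:
  "has_hessian (\<lambda>x. (x - c) \<bullet> (x - c)) (\<lambda>x. 2 *\<^sub>R (x - c)) (\<lambda>x. 2 *\<^sub>R mat 1)"
  unfolding has_hessian_def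
  by (auto intro!: derivative_eq_intros simp: inner_commute scaleR_matrix_vector_assoc[symmetric])

lemma has_hessian_dilation:
  assumes "has_hessian u g H"
  shows "has_hessian (\<lambda>x. u (k *\<^sub>R x)) (\<lambda>x. k *\<^sub>R g (k *\<^sub>R x)) (\<lambda>x. (k * k) *\<^sub>R H (k *\<^sub>R x))"
proof -
  note u = has_hessianD[OF assms]
  have d: "((\<lambda>x. k *\<^sub>R x) has_derivative (\<lambda>h. k *\<^sub>R h)) (at x)" for x :: "real^'n"
    by (auto intro!: derivative_eq_intros)
  show ?thesis unfolding has_hessian_def
  proof (intro conjI allI)
    fix x
    show "((\<lambda>x. u (k *\<^sub>R x)) has_derivative (\<lambda>h. (k *\<^sub>R g (k *\<^sub>R x)) \<bullet> h)) (at x)"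
      using has_derivative_compose[OF d u(1)] by simp
    show "((\<lambda>x. k *\<^sub>R g (k *\<^sub>R x)) has_derivative (\<lambda>h. ((k * k) *\<^sub>R H (k *\<^sub>R x)) *v h)) (at x)"
      using has_derivative_scaleR_right[OF has_derivative_compose[OF d u(2)], of k]
      by (simp add: matrix_vector_mult_scaleR scaleR_matrix_vector_assoc[symmetric])
    show "continuous_on UNIV (\<lambda>x. (k * k) *\<^sub>R H (k *\<^sub>R x))"
      by (intro continuous_intros continuous_on_compose2[OF u(5)]) auto
  qed
qed

lemma mvt_segment:
  fixes f :: "'a::real_normed_vector \<Rightarrow> real"
  assumes "\<And>x. x \<in> closed_segment a b \<Longrightarrow> (f has_derivative f' x) (at x)"
  shows "\<exists>x\<in>closed_segment a b. f b - f a = f' x (b - a)"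
proof -
  have seg: "a + t *\<^sub>R (b - a) \<in> closed_segment a b" if "t \<in> {0..1}" for t
    using that unfolding closed_segment_def by (auto intro!: exI[of _ t] simp: algebra_simps)
  have d: "((\<lambda>t. f (a + t *\<^sub>R (b - a))) has_derivative (\<lambda>s. f' (a + t *\<^sub>R (b - a)) (s *\<^sub>R (b - a))))
      (at t within {0..1})" if "t \<in> {0..1}" for t
  proof -
    have "((\<lambda>t. a + t *\<^sub>R (b - a)) has_derivative (\<lambda>s. s *\<^sub>R (b - a))) (at t within {0..1})"
      by (auto intro!: derivative_eq_intros)
    from has_derivative_compose[OF this assms[OF seg[OF that]]] show ?thesis .
  qed
  obtain t where "t \<in> {0<..<1::real}" "f (a + 1 *\<^sub>R (b - a)) - f (a + 0 *\<^sub>R (b - a))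
      = f' (a + t *\<^sub>R (b - a)) ((1 - 0) *\<^sub>R (b - a))"
    using mvt_simple[of 0 1 "\<lambda>t. f (a + t *\<^sub>R (b - a))"
        "\<lambda>t s. f' (a + t *\<^sub>R (b - a)) (s *\<^sub>R (b - a))"] d by auto
  thus ?thesis using seg[of t] by auto
qed

text \<open>Two applications of the mean value theorem, one in each direction. The left side is symmetric in \<open>a\<close>
  and \<open>b\<close>, and this gives the symmetry of the Hessian when \<open>t\<close> tends to \<open>0\<close>.\<close>
lemma has_hessian_second_difference:
  fixes a b :: "real^'n"
  assumes "has_hessian u g H" "t \<ge> 0"
  shows "\<exists>s\<in>{0..t}. \<exists>s'\<in>{0..t}. u (x + t *\<^sub>R a + t *\<^sub>R b) - u (x + t *\<^sub>R a) - u (x + t *\<^sub>R b) + u x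
    = t\<^sup>2 * (a \<bullet> (H (x + s *\<^sub>R a + s' *\<^sub>R b) *v b))"
proof -
  note u = has_hessianD[OF assms(1)]
  have "((\<lambda>y. u (y + t *\<^sub>R b) - u y) has_derivative (\<lambda>h. (g (y + t *\<^sub>R b) - g y) \<bullet> h)) (at y)" for y
    by (auto intro!: derivative_eq_intros has_derivative_compose[OF _ u(1)] u(1) simp: inner_diff_left)
  from mvt_segment[of x "x + t *\<^sub>R a", OF this]
  obtain y where y: "y \<in> closed_segment x (x + t *\<^sub>R a)"
    "u (x + t *\<^sub>R a + t *\<^sub>R b) - u (x + t *\<^sub>R a) - (u (x + t *\<^sub>R b) - u x)
      = (g (y + t *\<^sub>R b) - g y) \<bullet> (t *\<^sub>R a)" by auto
  have "((\<lambda>z. g z \<bullet> a) has_derivative (\<lambda>h. (H z *v h) \<bullet> a)) (at z)" for z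
    by (auto intro!: derivative_eq_intros u)
  from mvt_segment[of y "y + t *\<^sub>R b", OF this]
  obtain z where z: "z \<in> closed_segment y (y + t *\<^sub>R b)"
    "g (y + t *\<^sub>R b) \<bullet> a - g y \<bullet> a = (H z *v (t *\<^sub>R b)) \<bullet> a" by auto
  obtain s where s: "s \<in> {0..1}" "y = x + (s * t) *\<^sub>R a"
    using y(1) by (auto simp: closed_segment_def algebra_simps)
  obtain s' where s': "s' \<in> {0..1}" "z = y + (s' * t) *\<^sub>R b"
    using z(1) by (auto simp: closed_segment_def algebra_simps)
  have "s * t \<in> {0..t}" "s' * t \<in> {0..t}" using s s' assms(2) by (auto intro: mult_left_le_one_le)
  moreover have "u (x + t *\<^sub>R a + t *\<^sub>R b) - u (x + t *\<^sub>R a) - u (x + t *\<^sub>R b) + u x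
    = t\<^sup>2 * (a \<bullet> (H (x + (s * t) *\<^sub>R a + (s' * t) *\<^sub>R b) *v b))"
    using y(2) z(2) s(2) s'(2)
    by (simp add: inner_diff_left matrix_vector_mult_scaleR power2_eq_square inner_commute algebra_simps)
  ultimately show ?thesis by blast
qed

lemma continuous_on_quadratic_form [continuous_intros]:
  assumes "continuous_on S H"
  shows "continuous_on S (\<lambda>x. a \<bullet> (H x *v (b::real^'n)))"
  unfolding inner_vec_def matrix_vector_mult_def
  by (auto intro!: continuous_intros assms)

lemma has_hessian_symmetric:
  assumes "has_hessian u g H"
  shows "transpose (H x) = H x"
proof -
  have sym: "a \<bullet> (H x *v b) = b \<bullet> (H x *v a)" for a b
  proof (rule ccontr)
    assume ne: "\<not> ?thesis"
    define \<epsilon> where "\<epsilon> = \<bar>a \<bullet> (H x *v b) - b \<bullet> (H x *v a)\<bar> / 2"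
    have \<epsilon>: "\<epsilon> > 0" using ne by (simp add: \<epsilon>_def)
    have cont: "isCont (\<lambda>y. c \<bullet> (H y *v d)) x" for c d
      using continuous_on_quadratic_form[OF has_hessianD(5)[OF assms], of c d]
      by (simp add: continuous_on_eq_continuous_at)
    obtain \<delta>1 where \<delta>1: "\<delta>1 > 0" "\<And>y. norm (y - x) < \<delta>1 \<Longrightarrow> \<bar>a \<bullet> (H y *v b) - a \<bullet> (H x *v b)\<bar> < \<epsilon>"
      using cont[of a b] \<epsilon> unfolding continuous_at_eps_delta dist_norm by (metis real_norm_def)
    obtain \<delta>2 where \<delta>2: "\<delta>2 > 0" "\<And>y. norm (y - x) < \<delta>2 \<Longrightarrow> \<bar>b \<bullet> (H y *v a) - b \<bullet> (H x *v a)\<bar> < \<epsilon>"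
      using cont[of b a] \<epsilon> unfolding continuous_at_eps_delta dist_norm by (metis real_norm_def)
    define t where "t = min \<delta>1 \<delta>2 / (2 * (norm a + norm b + 1))"
    have t: "t > 0" unfolding t_def using \<delta>1 \<delta>2
      by (intro divide_pos_pos) (auto simp: add_nonneg_pos)
    have "norm a + norm b + 1 > 0" by (simp add: add_nonneg_pos)
    moreover have "m / (2 * k) * k = m / 2" if "k > 0" for m k :: real using that by simp
    ultimately have "t * (norm a + norm b + 1) = min \<delta>1 \<delta>2 / 2" unfolding t_def by blast
    hence tb: "t * (norm a + norm b + 1) < min \<delta>1 \<delta>2" using \<delta>1 \<delta>2 by linarith
    have small: "norm (s *\<^sub>R c + s' *\<^sub>R d) < min \<delta>1 \<delta>2"
      if "s \<in> {0..t}" "s' \<in> {0..t}" "norm c + norm d = norm a + norm b" for s s' c d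
    proof -
      have "norm (s *\<^sub>R c + s' *\<^sub>R d) \<le> s * norm c + s' * norm d"
        using norm_triangle_ineq[of "s *\<^sub>R c" "s' *\<^sub>R d"] that by simp
      also have "\<dots> \<le> t * norm c + t * norm d"
        using that by (intro add_mono mult_right_mono) auto
      also have "\<dots> \<le> t * (norm a + norm b + 1)"
        using that(3) t by (simp add: distrib_left[symmetric])
      finally show ?thesis using tb by simp
    qed
    let ?\<Delta> = "u (x + t *\<^sub>R a + t *\<^sub>R b) - u (x + t *\<^sub>R a) - u (x + t *\<^sub>R b) + u x"
    obtain s s' where s: "s \<in> {0..t}" "s' \<in> {0..t}"
      "?\<Delta> = t\<^sup>2 * (a \<bullet> (H (x + s *\<^sub>R a + s' *\<^sub>R b) *v b))"
      using has_hessian_second_difference[OF assms, of t x a b] t by auto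
    obtain r r' where r: "r \<in> {0..t}" "r' \<in> {0..t}"
      "?\<Delta> = t\<^sup>2 * (b \<bullet> (H (x + r *\<^sub>R b + r' *\<^sub>R a) *v a))"
      using has_hessian_second_difference[OF assms, of t x b a] t by (auto simp: algebra_simps)
    have "a \<bullet> (H (x + (s *\<^sub>R a + s' *\<^sub>R b)) *v b) = b \<bullet> (H (x + (r *\<^sub>R b + r' *\<^sub>R a)) *v a)"
      using s(3) r(3) t by (simp add: add.assoc)
    moreover have "\<bar>a \<bullet> (H (x + (s *\<^sub>R a + s' *\<^sub>R b)) *v b) - a \<bullet> (H x *v b)\<bar> < \<epsilon>"
      by (rule \<delta>1(2)) (use small[OF s(1,2), of a b] in auto)
    moreover have "\<bar>b \<bullet> (H (x + (r *\<^sub>R b + r' *\<^sub>R a)) *v a) - b \<bullet> (H x *v a)\<bar> < \<epsilon>"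
      by (rule \<delta>2(2)) (use small[OF r(1,2), of b a] in auto)
    moreover have "X \<noteq> Y" if "\<bar>X - p\<bar> < \<bar>p - q\<bar> / 2" "\<bar>Y - q\<bar> < \<bar>p - q\<bar> / 2" for X Y p q :: real
      using that by (auto simp: abs_if split: if_splits)
    ultimately show False unfolding \<epsilon>_def by blast
  qed
  have entry: "axis i 1 \<bullet> (H x *v axis j 1) = H x $ i $ j" for i j
    by (simp add: inner_axis' matrix_vector_mult_basis column_def)
  show ?thesis using sym[of "axis _ 1" "axis _ 1"] by (simp add: vec_eq_iff transpose_def entry)
qed

lemma has_hessian_local_min:
  assumes "has_hessian u g H" "open S" "x \<in> S" and min: "\<And>y. y \<in> S \<Longrightarrow> u x \<le> u y"
  shows "g x = 0" "0 \<le> v \<bullet> (H x *v v)"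
proof -
  note u = has_hessianD[OF assms(1)]
  have "(\<lambda>h. g x \<bullet> h) = (\<lambda>h. 0)"
    using differential_zero_maxmin[OF \<open>x \<in> S\<close> \<open>open S\<close> u(1)] min by blast
  hence g: "g x \<bullet> h = 0" for h by metis
  thus g0: "g x = 0" by (metis inner_eq_zero_iff)
  show "0 \<le> v \<bullet> (H x *v v)"
  proof (rule ccontr)
    assume neg: "\<not> ?thesis"
    have line: "((\<lambda>t. x + t *\<^sub>R v) has_derivative (\<lambda>s. s *\<^sub>R v)) (at t)" for t
      by (auto intro!: derivative_eq_intros)
    have d1: "((\<lambda>t. u (x + t *\<^sub>R v)) has_real_derivative g (x + t *\<^sub>R v) \<bullet> v) (at t)" for t
      using has_derivative_compose[OF line u(1)[of "x + t *\<^sub>R v"]]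
      by (simp add: has_field_derivative_def mult_commute_abs)
    have d2: "((\<lambda>t. g (x + t *\<^sub>R v) \<bullet> v) has_real_derivative v \<bullet> (H x *v v)) (at 0)"
      using has_derivative_inner_left[OF has_derivative_compose[OF line u(2)[of "x + 0 *\<^sub>R v"]], of v]
      by (simp add: has_field_derivative_def matrix_vector_mult_scaleR inner_commute mult_commute_abs)
    obtain d where d: "d > 0" "\<And>t. 0 < t \<Longrightarrow> t < d \<Longrightarrow> g (x + t *\<^sub>R v) \<bullet> v < 0"
      using DERIV_neg_dec_right[OF d2] neg g0 by auto
    obtain r where r: "r > 0" "ball x r \<subseteq> S" using assms(2,3) openE by blast
    define t where "t = min (d / 2) (r / (2 * (norm v + 1)))"
    have t: "t > 0" "t < d" using d r by (auto simp: t_def add_nonneg_pos)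
    have "t * (norm v + 1) \<le> r / (2 * (norm v + 1)) * (norm v + 1)"
      unfolding t_def by (intro mult_right_mono) auto
    also have "\<dots> = r / 2"
    proof -
      have "norm v + 1 > 0" by (simp add: add_nonneg_pos)
      moreover have "r / (2 * k) * k = r / 2" if "k > 0" for k :: real using that by simp
      ultimately show ?thesis by blast
    qed
    finally have "t * (norm v + 1) \<le> r / 2" .
    hence "t * norm v < r" using t r by (simp add: algebra_simps)
    hence "x + t *\<^sub>R v \<in> S" using r(2) t by (auto simp: dist_norm)
    hence "u x \<le> u (x + t *\<^sub>R v)" by (rule min)
    moreover obtain s where "0 < s" "s < t" "u (x + t *\<^sub>R v) - u (x + 0 *\<^sub>R v) = (t - 0) * (g (x + s *\<^sub>R v) \<bullet> v)"
      using MVT2[of 0 t "\<lambda>t. u (x + t *\<^sub>R v)" "\<lambda>t. g (x + t *\<^sub>R v) \<bullet> v"] d1 t by auto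
    ultimately show False using mult_pos_neg[OF t(1) d(2)[of s]] t by simp
  qed
qed
text \<open>Hopf's barrier. For large \<open>a\<close> the Hessian is dominated by the rank-one term, which is of order
  \<open>a\<^sup>2\<close>; the gradient and the remaining terms are of order \<open>a\<close>.\<close>
lemma has_hessian_gaussian_barrier:
  fixes c :: "real^'n"
  shows "has_hessian (\<lambda>x. exp (- a * ((x - c) \<bullet> (x - c))) - k)
    (\<lambda>x. (- 2 * a * exp (- a * ((x - c) \<bullet> (x - c)))) *\<^sub>R (x - c))
    (\<lambda>x. exp (- a * ((x - c) \<bullet> (x - c))) *\<^sub>R ((4 * a\<^sup>2) *\<^sub>R outer (x - c) (x - c) - (2 * a) *\<^sub>R mat 1))"
proof -
  have outer2: "outer (2 *\<^sub>R z) (2 *\<^sub>R z) = 4 *\<^sub>R outer z (z::real^'n)" for z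
    by (simp add: outer_def vec_eq_iff)
  have "has_hessian (\<lambda>x. exp (- a * ((x - c) \<bullet> (x - c))))
    (\<lambda>x. (- a * exp (- a * ((x - c) \<bullet> (x - c)))) *\<^sub>R (2 *\<^sub>R (x - c)))
    (\<lambda>x. (- a * exp (- a * ((x - c) \<bullet> (x - c)))) *\<^sub>R (2 *\<^sub>R mat 1) +
      (a\<^sup>2 * exp (- a * ((x - c) \<bullet> (x - c)))) *\<^sub>R outer (2 *\<^sub>R (x - c)) (2 *\<^sub>R (x - c)))"
    by (rule has_hessian_compose_real[OF has_hessian_norm_square, where \<psi> = "\<lambda>s. exp (- a * s)"])
      (auto intro!: derivative_eq_intros continuous_intros simp: power2_eq_square)
  note hess = has_hessian_diff[OF this has_hessian_const[of k]]
  have grad: "(- a * e) *\<^sub>R (2 *\<^sub>R z) - 0 = (- 2 * a * e) *\<^sub>R z" for e and z :: "real^'n" by simp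
  have hessian: "(- a * e) *\<^sub>R (2 *\<^sub>R mat 1) + (a\<^sup>2 * e) *\<^sub>R outer (2 *\<^sub>R z) (2 *\<^sub>R z) - 0
      = e *\<^sub>R ((4 * a\<^sup>2) *\<^sub>R outer z z - (2 * a) *\<^sub>R mat 1)" for e and z :: "real^'n"
    by (simp add: outer2 algebra_simps)
  show ?thesis using hess unfolding grad hessian .
qed

section \<open>The Schouten tensor of a conformally flat metric\<close>

text \<open>For a function \<open>w\<close> with gradient \<open>g\<close> and Hessian \<open>H\<close> at a point, the matrix whose eigenvalues are
  those of the Schouten tensor of \<open>w\<^sup>-\<^sup>2 I\<close> with respect to \<open>w\<^sup>-\<^sup>2 I\<close>. The sphere with its round
  metric is the case \<open>w = (1 + |x|\<^sup>2)/2\<close>, where it is \<open>I/2\<close>.\<close>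
definition schouten_form :: "real \<Rightarrow> real^'n \<Rightarrow> real^'n^'n \<Rightarrow> real^'n^'n" where
  "schouten_form w g H = w *\<^sub>R H - ((g \<bullet> g) / 2) *\<^sub>R mat 1"

lemma schouten_form_quadratic:
  "x \<bullet> (schouten_form w g H *v x) = w * (x \<bullet> (H *v x)) - (g \<bullet> g) / 2 * (x \<bullet> x)"
  by (simp add: schouten_form_def matrix_vector_mult_diff_rdistrib inner_diff_right
      scaleR_matrix_vector_assoc[symmetric])

lemma schouten_form_symmetric: "transpose H = H \<Longrightarrow> transpose (schouten_form w g H) = schouten_form w g H"
  unfolding schouten_form_def transpose_def mat_def vec_eq_iff by (simp add: eq_commute)

definition kronecker :: "'a \<Rightarrow> 'a \<Rightarrow> real" where
  "kronecker i j = (if i = j then 1 else 0)"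

lemma kronecker_sym: "kronecker i j = kronecker j i"
  and kronecker_same [simp]: "kronecker i i = 1"
  by (auto simp: kronecker_def)

lemma sum_kronecker [simp]:
  fixes a :: "'n::finite \<Rightarrow> real"
  shows "(\<Sum>l\<in>UNIV. a l * kronecker k l) = a k" "(\<Sum>l\<in>UNIV. a l * kronecker l k) = a k"
    "(\<Sum>l\<in>UNIV. kronecker k l * a l) = a k" "(\<Sum>l\<in>UNIV. kronecker l k * a l) = a k"
  by (simp_all add: kronecker_def if_distrib[of "\<lambda>x. _ * x"] if_distrib[of "\<lambda>x. x * _"] cong: if_cong)

lemma partial_has_derivative: "(u has_derivative u') (at x) \<Longrightarrow> partial i u x = u' (axis i 1)"
  unfolding partial_def by (simp add: frechet_derivative_at[symmetric])

lemma matrix_inv_scalar: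
  assumes "c \<noteq> 0" shows "matrix_inv (c *\<^sub>R mat 1 :: real^'n^'n) = (1 / c) *\<^sub>R mat 1"
  unfolding matrix_inv_def
proof (rule some_equality)
  show inv: "c *\<^sub>R mat 1 ** (1 / c) *\<^sub>R mat 1 = (mat 1 :: real^'n^'n) \<and>
      (1 / c) *\<^sub>R mat 1 ** c *\<^sub>R mat 1 = (mat 1 :: real^'n^'n)"
    using assms by (simp add: matrix_scalar_ac)
  fix B :: "real^'n^'n" assume B: "c *\<^sub>R mat 1 ** B = mat 1 \<and> B ** c *\<^sub>R mat 1 = mat 1"
  have "B = (B ** c *\<^sub>R mat 1) ** (1 / c) *\<^sub>R mat 1"
    using inv by (simp add: matrix_mul_assoc[symmetric])
  thus "B = (1 / c) *\<^sub>R mat 1" using B by simp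
qed

lemma mat_1_kronecker: "(mat 1 :: real^'n^'n) $ i $ j = kronecker i j"
  by (simp add: mat_def kronecker_def)

text \<open>Writing a conformal metric as \<open>w\<^sup>-\<^sup>2 I\<close> makes everything depend on the logarithmic gradient
  \<open>p = Dw/w\<close> only.\<close>
lemma christoffel_conformally_flat:
  fixes w :: "real^'n \<Rightarrow> real"
  assumes h: "has_hessian w gw Hw" and pos: "\<And>x. 0 < w x"
  shows "christoffel (\<lambda>x. (1 / (w x)\<^sup>2) *\<^sub>R mat 1) k i j x =
    - (gw x $ i / w x * kronecker j k + gw x $ j / w x * kronecker i k - gw x $ k / w x * kronecker i j)"
proof -
  note dw = has_hessianD[OF h]
  have part: "partial m (\<lambda>y. ((1 / (w y)\<^sup>2) *\<^sub>R mat 1 :: real^'n^'n) $ a $ b) x = - 2 * gw x $ m / (w x)^3 * kronecker a b"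
    for m a b
  proof -
    have "((\<lambda>y. ((1 / (w y)\<^sup>2) *\<^sub>R mat 1 :: real^'n^'n) $ a $ b) has_derivative
        (\<lambda>h. - 2 * (gw x \<bullet> h) / (w x)^3 * kronecker a b)) (at x)"
      using pos[of x] unfolding mat_1_kronecker vector_scaleR_component real_scaleR_def
      by (auto intro!: derivative_eq_intros dw simp: field_simps power2_eq_square power3_eq_cube)
    thus ?thesis by (simp add: partial_has_derivative inner_axis)
  qed
  have "matrix_inv ((1 / (w x)\<^sup>2) *\<^sub>R mat 1 :: real^'n^'n) $ k $ l = (w x)\<^sup>2 * kronecker k l" for l
    using pos[of x] by (simp add: matrix_inv_scalar mat_1_kronecker)
  hence "christoffel (\<lambda>x. (1 / (w x)\<^sup>2) *\<^sub>R mat 1) k i j x = (1/2) * (\<Sum>l\<in>UNIV. kronecker k l * ((w x)\<^sup>2 *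
      (- 2 * gw x $ i / (w x)^3 * kronecker j l + - 2 * gw x $ j / (w x)^3 * kronecker i l
        - - 2 * gw x $ l / (w x)^3 * kronecker i j)))"
    unfolding christoffel_def part by (simp add: mult_ac)
  also have "\<dots> = (1/2) * ((w x)\<^sup>2 * (- 2 * gw x $ i / (w x)^3 * kronecker j k
      + - 2 * gw x $ j / (w x)^3 * kronecker i k - - 2 * gw x $ k / (w x)^3 * kronecker i j))"
    by (simp only: sum_kronecker)
  also have "\<dots> = - (gw x $ i / w x * kronecker j k + gw x $ j / w x * kronecker i k
      - gw x $ k / w x * kronecker i j)"
    using pos[of x] by (simp add: field_simps power2_eq_square power3_eq_cube)
  finally show ?thesis .
qed

text \<open>With \<open>P = Dp\<close>, which is symmetric since the Hessian of \<open>w\<close> is, the derivative terms give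
  \<open>(n - 2) P + tr P I\<close> and the quadratic terms give \<open>(n - 2) (p \<otimes> p - |p|\<^sup>2 I)\<close>. Since
  \<open>P + p \<otimes> p = D\<^sup>2w/w\<close>, the products of first derivatives survive only in the multiple of \<open>I\<close>.\<close>
lemma ricci_conformally_flat:
  fixes w :: "real^'n \<Rightarrow> real"
  assumes h: "has_hessian w gw Hw" and pos: "\<And>x. 0 < w x"
  shows "ricci (\<lambda>x. (1 / (w x)\<^sup>2) *\<^sub>R mat 1) x $ i $ j =
    (real CARD('n) - 2) * (Hw x $ i $ j / w x) +
    (trace (Hw x) / w x - (real CARD('n) - 1) * (gw x \<bullet> gw x / (w x)\<^sup>2)) * kronecker i j"
proof -
  note dw = has_hessianD[OF h]
  let ?n = "real CARD('n)"
  define p where "p i = gw x $ i / w x" for i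
  define P where "P i m = Hw x $ i $ m / w x - p i * p m" for i m
  define G where "G k i j = p i * kronecker j k + p j * kronecker i k - p k * kronecker i j" for k i j
  define N where "N = (\<Sum>k\<in>UNIV. p k * p k)"
  have sym: "P i m = P m i" for i m
  proof -
    have "Hw x $ m $ i = Hw x $ i $ m"
      using has_hessian_symmetric[OF h, of x] by (metis transpose_def vec_lambda_beta)
    thus ?thesis by (simp add: P_def mult.commute)
  qed
  have chr: "christoffel (\<lambda>x. (1 / (w x)\<^sup>2) *\<^sub>R mat 1) k i j x = - G k i j" for k i j
    by (simp add: christoffel_conformally_flat[OF h pos] G_def p_def)
  have dp: "((\<lambda>y. gw y $ i / w y) has_derivative
      (\<lambda>h. (Hw x *v h) $ i / w x - gw x $ i * (gw x \<bullet> h) / (w x)\<^sup>2)) (at x)" for i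
  proof -
    have "((\<lambda>y. gw y $ i) has_derivative (\<lambda>h. (Hw x *v h) $ i)) (at x)"
      by (rule bounded_linear.has_derivative[OF bounded_linear_vec_nth dw(2)])
    from has_derivative_divide[OF this dw(1)] show ?thesis
      using pos[of x] by (simp add: field_simps power2_eq_square)
  qed
  have part: "partial m (christoffel (\<lambda>x. (1 / (w x)\<^sup>2) *\<^sub>R mat 1) k i j) x
      = - (P i m * kronecker j k + P j m * kronecker i k - P k m * kronecker i j)" for m k i j
  proof -
    have "(christoffel (\<lambda>x. (1 / (w x)\<^sup>2) *\<^sub>R mat 1) k i j has_derivative
      (\<lambda>h. - (((Hw x *v h) $ i / w x - gw x $ i * (gw x \<bullet> h) / (w x)\<^sup>2) * kronecker j k
        + ((Hw x *v h) $ j / w x - gw x $ j * (gw x \<bullet> h) / (w x)\<^sup>2) * kronecker i k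
        - ((Hw x *v h) $ k / w x - gw x $ k * (gw x \<bullet> h) / (w x)\<^sup>2) * kronecker i j))) (at x)"
      unfolding christoffel_conformally_flat[OF h pos, abs_def]
      by (intro has_derivative_minus has_derivative_add has_derivative_diff has_derivative_mult_left dp)
    thus ?thesis
      by (simp add: partial_has_derivative matrix_vector_mult_basis column_def inner_axis P_def p_def
          power2_eq_square)
  qed
  have Gkk: "(\<Sum>k\<in>UNIV. G k k l) = ?n * p l" for l
  proof -
    have "G k k l = p l" for k by (simp add: G_def kronecker_def)
    thus ?thesis by simp
  qed
  have contract: "(\<Sum>l\<in>UNIV. a l * G l i k) = p i * a k + p k * a i - (\<Sum>l\<in>UNIV. a l * p l) * kronecker i k" for a i k
    unfolding G_def
    by (simp add: distrib_left right_diff_distrib sum.distrib sum_subtractf mult.assoc[symmetric]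
        sum_distrib_right[symmetric] mult.commute[of "a _"])
  have T3: "(\<Sum>k\<in>UNIV. \<Sum>l\<in>UNIV. G k k l * G l i j) = ?n * (2 * p i * p j - N * kronecker i j)"
  proof -
    have "(\<Sum>k\<in>UNIV. \<Sum>l\<in>UNIV. G k k l * G l i j) = (\<Sum>l\<in>UNIV. (\<Sum>k\<in>UNIV. G k k l) * G l i j)"
      by (subst sum.swap) (simp add: sum_distrib_right)
    also have "\<dots> = ?n * (\<Sum>l\<in>UNIV. p l * G l i j)"
      by (simp add: Gkk sum_distrib_left mult.assoc)
    finally show ?thesis by (simp add: contract N_def algebra_simps)
  qed
  have T4: "(\<Sum>k\<in>UNIV. \<Sum>l\<in>UNIV. G k j l * G l i k) = (?n + 2) * p i * p j - 2 * N * kronecker i j"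
  proof -
    have 1: "G k j k = p j" for k by (simp add: G_def kronecker_def)
    have 2: "(\<Sum>l\<in>UNIV. G k j l * p l) = N * kronecker j k" for k
    proof -
      have "(\<Sum>l\<in>UNIV. G k j l * p l) = (\<Sum>l\<in>UNIV. (p j * p l) * kronecker l k)
          + (\<Sum>l\<in>UNIV. p l * p l) * kronecker j k - (\<Sum>l\<in>UNIV. (p k * p l) * kronecker j l)"
        unfolding G_def sum_distrib_right sum.distrib[symmetric] sum_subtractf[symmetric]
        by (intro sum.cong) (auto simp: algebra_simps)
      thus ?thesis by (simp add: N_def)
    qed
    have "(\<Sum>k\<in>UNIV. \<Sum>l\<in>UNIV. G k j l * G l i k)
        = (\<Sum>k\<in>UNIV. p i * p j + p k * G k j i - N * kronecker j k * kronecker i k)"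
      by (simp add: contract 1 2)
    also have "\<dots> = ?n * (p i * p j) + (\<Sum>k\<in>UNIV. p k * G k j i) - (\<Sum>k\<in>UNIV. N * kronecker j k * kronecker i k)"
      by (simp add: sum.distrib sum_subtractf)
    also have "(\<Sum>k\<in>UNIV. p k * G k j i) = 2 * p i * p j - N * kronecker i j"
      by (simp add: contract N_def kronecker_sym[of j i])
    also have "(\<Sum>k\<in>UNIV. N * kronecker j k * kronecker i k) = N * kronecker i j"
      by (simp add: kronecker_sym[of j i])
    finally show ?thesis by (simp add: algebra_simps)
  qed
  have T1: "(\<Sum>k\<in>UNIV. - (P i k * kronecker j k + P j k * kronecker i k - P k k * kronecker i j))
      = - 2 * P i j + (\<Sum>k\<in>UNIV. P k k) * kronecker i j"
    using sym[of j i] by (simp add: sum.distrib sum_subtractf sum_negf sum_distrib_right)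
  have T2: "(\<Sum>k\<in>UNIV. - (P i j * kronecker k k + P k j * kronecker i k - P k j * kronecker i k))
      = - ?n * P i j"
    by simp
  have "ricci (\<lambda>x. (1 / (w x)\<^sup>2) *\<^sub>R mat 1) x $ i $ j =
      (\<Sum>k\<in>UNIV. - (P i k * kronecker j k + P j k * kronecker i k - P k k * kronecker i j))
      - (\<Sum>k\<in>UNIV. - (P i j * kronecker k k + P k j * kronecker i k - P k j * kronecker i k))
      + (\<Sum>k\<in>UNIV. \<Sum>l\<in>UNIV. G k k l * G l i j) - (\<Sum>k\<in>UNIV. \<Sum>l\<in>UNIV. G k j l * G l i k)"
    unfolding ricci_def by (simp only: vec_lambda_beta part chr minus_mult_minus)
  also have "\<dots> = (?n - 2) * (P i j + p i * p j) + ((\<Sum>k\<in>UNIV. P k k) - (?n - 2) * N) * kronecker i j"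
    unfolding T1 T2 T3 T4 by (simp add: algebra_simps)
  also have "(\<Sum>k\<in>UNIV. P k k) = trace (Hw x) / w x - N"
    by (simp add: P_def N_def sum_subtractf trace_def sum_divide_distrib)
  also have "P i j + p i * p j = Hw x $ i $ j / w x" by (simp add: P_def)
  also have "trace (Hw x) / w x - N - (?n - 2) * N = trace (Hw x) / w x - (?n - 1) * N"
    by (simp add: algebra_simps)
  also have "N = gw x \<bullet> gw x / (w x)\<^sup>2"
    by (simp add: N_def p_def inner_vec_def sum_divide_distrib power2_eq_square)
  finally show ?thesis .
qed

lemma schouten_conformally_flat:
  fixes w :: "real^'n \<Rightarrow> real"
  assumes n: "CARD('n) \<ge> 3" and h: "has_hessian w gw Hw" and pos: "\<And>x. 0 < w x"
  shows "schouten (\<lambda>x. (1 / (w x)\<^sup>2) *\<^sub>R mat 1) x =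
    (1 / (w x)\<^sup>2) *\<^sub>R schouten_form (w x) (gw x) (Hw x)"
proof -
  let ?n = "real CARD('n)" and ?g = "\<lambda>x. (1 / (w x)\<^sup>2) *\<^sub>R (mat 1 :: real^'n^'n)"
  define Q where "Q = gw x \<bullet> gw x / (w x)\<^sup>2"
  define \<tau> where "\<tau> = trace (Hw x) / w x"
  have n3: "?n \<ge> 3" using n by simp
  have w0: "w x \<noteq> 0" using pos[of x] by simp
  have ric: "ricci ?g x $ i $ j = (?n - 2) * (Hw x $ i $ j / w x) + (\<tau> - (?n - 1) * Q) * kronecker i j" for i j
    unfolding \<tau>_def Q_def by (rule ricci_conformally_flat[OF h pos])
  have inv: "matrix_inv (?g x) $ i $ j = (w x)\<^sup>2 * kronecker i j" for i j
    using w0 by (simp add: matrix_inv_scalar mat_1_kronecker)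
  have "scalar_curv ?g x = (w x)\<^sup>2 * (\<Sum>i\<in>UNIV. ricci ?g x $ i $ i)"
    unfolding scalar_curv_def inv mult.assoc sum_distrib_left[symmetric] sum_kronecker ..
  also have "(\<Sum>i\<in>UNIV. ricci ?g x $ i $ i) = (?n - 2) * \<tau> + ?n * (\<tau> - (?n - 1) * Q)"
    by (simp add: ric sum.distrib \<tau>_def trace_def sum_distrib_left[symmetric] sum_divide_distrib[symmetric])
  finally have scal: "scalar_curv ?g x / (2 * (?n - 1)) = (w x)\<^sup>2 * (\<tau> - ?n * Q / 2)"
    using n3 by (simp add: field_simps)
  have "schouten ?g x $ i $ j = Hw x $ i $ j / w x - Q / 2 * kronecker i j" for i j
  proof -
    have "schouten ?g x $ i $ j = (1 / (?n - 2)) * (((?n - 2) * (Hw x $ i $ j / w x)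
        + (\<tau> - (?n - 1) * Q) * kronecker i j) - (\<tau> - ?n * Q / 2) * kronecker i j)"
      unfolding schouten_def scal by (simp add: ric mat_1_kronecker w0)
    also have "\<dots> = (1 / (?n - 2)) * ((?n - 2) * (Hw x $ i $ j / w x - Q / 2 * kronecker i j))"
      by (simp add: field_simps)
    finally show ?thesis using n3 by simp
  qed
  thus ?thesis
    using w0 by (simp add: schouten_form_def vec_eq_iff mat_1_kronecker Q_def field_simps power2_eq_square)
qed

section \<open>Monotone functions of the ordered spectrum\<close>

lemma norm_matrix_vector_le:
  fixes M :: "real^'n^'m" shows "norm (M *v x) \<le> norm M * norm x"
proof -
  have "norm (M *v x) = L2_set (\<lambda>i. \<bar>M $ i \<bullet> x\<bar>) UNIV"
    unfolding norm_vec_def[of "M *v x"] by (simp add: matrix_vector_mul_component)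
  also have "\<dots> \<le> L2_set (\<lambda>i. norm (M $ i) * norm x) UNIV"
    by (intro L2_set_mono) (auto simp: Cauchy_Schwarz_ineq2)
  also have "\<dots> = norm M * norm x" by (simp add: L2_set_left_distrib norm_vec_def[of M])
  finally show ?thesis .
qed

lemma quadratic_spectral_le_norm:
  fixes M :: "real^'n^'n" shows "\<bar>x \<bullet> (M *v x)\<bar> \<le> norm M * (x \<bullet> x)"
proof -
  have "\<bar>x \<bullet> (M *v x)\<bar> \<le> norm x * norm (M *v x)" by (rule Cauchy_Schwarz_ineq2)
  also have "\<dots> \<le> norm x * (norm M * norm x)" by (intro mult_left_mono norm_matrix_vector_le) auto
  finally show ?thesis by (simp add: dot_square_norm power2_eq_square mult_ac)
qed

lemma eventually_nhds_less:
  fixes F :: "real^'n \<Rightarrow> real"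
  assumes "continuous_on UNIV F" "F x < c"
  shows "\<forall>\<^sub>F y in nhds x. F y < c"
  using open_Collect_less[OF assms(1) continuous_on_const, of c] assms(2)
  unfolding eventually_nhds by blast

text \<open>Convexity is what makes this hold for arbitrary points of the domain: the segment between them stays
  inside.\<close>
lemma mono_if_gradient_nonneg:
  fixes f :: "real^'n \<Rightarrow> real"
  assumes "convex \<Gamma>" "\<And>x. x \<in> \<Gamma> \<Longrightarrow> (f has_derivative (\<lambda>h. D x \<bullet> h)) (at x)"
    and "\<And>x i. x \<in> \<Gamma> \<Longrightarrow> 0 \<le> D x $ i"
    and "l \<in> \<Gamma>" "m \<in> \<Gamma>" "\<And>i. l $ i \<le> m $ i"
  shows "f l \<le> f m"
proof -
  have seg: "closed_segment l m \<subseteq> \<Gamma>" using assms(1,4,5) by (simp add: closed_segment_subset)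
  obtain x where "x \<in> \<Gamma>" "f m - f l = D x \<bullet> (m - l)"
    using mvt_segment[of l m f "\<lambda>x h. D x \<bullet> h"] assms(2) seg by blast
  moreover have "0 \<le> D x \<bullet> (m - l)"
    unfolding inner_vec_def by (intro sum_nonneg) (simp add: assms(3,6) \<open>x \<in> \<Gamma>\<close>)
  ultimately show ?thesis by simp
qed

text \<open>Raising all entries by \<open>t\<close> costs at most \<open>C t\<close>, and the amounts by which \<open>m\<close> stays below
  \<open>l + t\<close> are gained back at a rate of at least \<open>c\<close>, whichever entries they occur in.\<close>
lemma local_increment_bound:
  fixes f :: "real^'n \<Rightarrow> real"
  assumes "open \<Gamma>" "\<And>x. x \<in> \<Gamma> \<Longrightarrow> (f has_derivative (\<lambda>h. D x \<bullet> h)) (at x)"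
    and cont: "continuous_on \<Gamma> D" and pos: "\<And>x i. x \<in> \<Gamma> \<Longrightarrow> 0 < D x $ i" and l0: "l0 \<in> \<Gamma>"
  obtains r c C where "r > 0" "c > 0" "C > 0" "ball l0 r \<subseteq> \<Gamma>"
    "\<And>l m t. l \<in> ball l0 r \<Longrightarrow> m \<in> ball l0 r \<Longrightarrow> t \<ge> 0 \<Longrightarrow> (\<And>i. m $ i \<le> l $ i + t) \<Longrightarrow>
       f m - f l \<le> C * t - c * (\<Sum>i\<in>UNIV. l $ i + t - m $ i)"
proof -
  obtain r0 where r0: "r0 > 0" "cball l0 r0 \<subseteq> \<Gamma>"
    using assms(1) l0 open_contains_cball by metis
  \<comment> \<open>Half the smallest partial derivative at the centre: nearby, the partial derivatives stay above the other half.\<close>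
  define c where "c = Min (range (\<lambda>i. D l0 $ i)) / 2"
  have c: "c > 0" unfolding c_def using pos[OF l0] by simp
  have cD: "2 * c \<le> D l0 $ i" for i unfolding c_def by simp
  obtain d where d: "d > 0" "\<And>x. x \<in> \<Gamma> \<Longrightarrow> dist x l0 < d \<Longrightarrow> dist (D x) (D l0) < c"
    using cont l0 c unfolding continuous_on_iff by metis
  define r where "r = min r0 d"
  have r: "r > 0" "ball l0 r \<subseteq> \<Gamma>" using r0 d by (auto simp: r_def)
  have near: "\<bar>D x $ i - D l0 $ i\<bar> < c" if "x \<in> ball l0 r" for x i
  proof -
    have "dist (D x) (D l0) < c"
      using d(2)[of x] that r(2) by (auto simp: r_def dist_commute)
    thus ?thesis using dist_vec_nth_le[of "D x" i "D l0"] by (simp add: dist_real_def)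
  qed
  define C where "C = (\<Sum>i\<in>(UNIV::'n set). D l0 $ i + c)"
  have C: "C > 0" unfolding C_def using pos[OF l0] c by (intro sum_pos) (auto intro: add_pos_pos)
  show thesis
  proof (rule that[OF r(1) c C r(2)])
    fix l m t assume lm: "l \<in> ball l0 r" "m \<in> ball l0 r" and t: "(t::real) \<ge> 0"
      and le: "\<And>i. m $ i \<le> l $ i + t"
    have seg: "closed_segment l m \<subseteq> ball l0 r"
      using lm by (simp add: closed_segment_subset)
    obtain x where x: "x \<in> ball l0 r" "f m - f l = D x \<bullet> (m - l)"
      using mvt_segment[of l m f "\<lambda>x h. D x \<bullet> h"] assms(2) seg r(2) by blast
    have "D x \<bullet> (m - l) = (\<Sum>i\<in>UNIV. D x $ i * t - D x $ i * (l $ i + t - m $ i))"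
      unfolding inner_vec_def by (intro sum.cong) (auto simp: algebra_simps)
    also have "\<dots> \<le> (\<Sum>i\<in>UNIV. (D l0 $ i + c) * t - c * (l $ i + t - m $ i))"
    proof (intro sum_mono diff_mono mult_right_mono)
      fix i
      have "\<bar>D x $ i - D l0 $ i\<bar> < c" by (rule near[OF x(1)])
      thus "D x $ i \<le> D l0 $ i + c" "c \<le> D x $ i" using cD[of i] by linarith+
      show "0 \<le> l $ i + t - m $ i" using le[of i] by simp
    qed (rule t)
    also have "\<dots> = C * t - c * (\<Sum>i\<in>UNIV. l $ i + t - m $ i)"
      unfolding C_def sum_distrib_left sum_distrib_right sum_subtractf[symmetric] ..
    finally show "f m - f l \<le> C * t - c * (\<Sum>i\<in>UNIV. l $ i + t - m $ i)" using x(2) by simp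
  qed
qed

lemma ordered_spectrum_upper:
  assumes "ordered_spectrum A l" "ordered_spectrum B m"
    and "\<And>x. x \<bullet> (A *v x) \<le> x \<bullet> (B *v x) + t * (x \<bullet> x)"
  shows "l $ i \<le> m $ i + t"
proof -
  have "l $ i \<le> (\<chi> i. m $ i + t) $ i"
    by (rule ordered_spectrum_mono[OF assms(1) ordered_spectrum_add_scalar[OF assms(2)]])
      (use assms(3) in \<open>simp add: matrix_vector_mult_add_rdistrib scaleR_matrix_vector_assoc[symmetric] inner_add_right\<close>)
  thus ?thesis by simp
qed

lemma trace_outer: "trace (outer z z) = (z::real^'n) \<bullet> z"
  by (simp add: trace_def outer_def inner_vec_def)

lemma trace_scaleR: "trace (t *\<^sub>R (A::real^'n^'n)) = t * trace A"
  by (simp add: trace_def sum_distrib_left)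

lemma norm_le_sum_components:
  fixes x :: "real^'n" assumes "\<And>i. \<bar>x $ i\<bar> \<le> e" shows "norm x \<le> real CARD('n) * e"
  using norm_le_l1_cart[of x] sum_bounded_above[of "UNIV::'n set" "\<lambda>i. \<bar>x $ i\<bar>" e] assms by simp

text \<open>The quantitative ellipticity behind the Hopf lemma. Adding \<open>t I - s z z\<^sup>T\<close> to a matrix near \<open>A0\<close>
  raises no ordered eigenvalue by more than \<open>t\<close>, while the eigenvalues of the result fall short of
  those of \<open>A + t I\<close> by \<open>s |z|\<^sup>2\<close> in total, which is read off the trace. Near \<open>l0\<close> all
  partial derivatives of \<open>f\<close> are bounded below, so \<open>f\<close> drops in proportion to this total, however it
  is distributed over the eigenvalues.\<close>
lemma spectral_function_decrease:
  fixes f :: "real^'n \<Rightarrow> real" and A0 :: "real^'n^'n"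
  assumes "open \<Gamma>" "\<And>x. x \<in> \<Gamma> \<Longrightarrow> (f has_derivative (\<lambda>h. D x \<bullet> h)) (at x)"
    and cont: "continuous_on \<Gamma> D" and pos: "\<And>x i. x \<in> \<Gamma> \<Longrightarrow> 0 < D x $ i"
    and l0: "l0 \<in> \<Gamma>" "ordered_spectrum A0 l0"
  obtains \<eta> c C where "\<eta> > 0" "c > 0" "C > 0"
    "\<And>A l s t z. \<lbrakk>transpose A = A; ordered_spectrum A l;
        \<And>x. \<bar>x \<bullet> (A *v x) - x \<bullet> (A0 *v x)\<bar> \<le> \<eta> * (x \<bullet> x);
        0 \<le> s; s * (z \<bullet> z) \<le> \<eta>; 0 \<le> t; t \<le> \<eta>\<rbrakk> \<Longrightarrow>
      \<exists>m\<in>\<Gamma>. ordered_spectrum (A + t *\<^sub>R mat 1 - s *\<^sub>R outer z z) m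
        \<and> f m - f l \<le> C * t - c * s * (z \<bullet> z)"
proof -
  obtain r c C where rcC: "r > 0" "c > 0" "C > 0" "ball l0 r \<subseteq> \<Gamma>"
    and inc: "\<And>l m t. l \<in> ball l0 r \<Longrightarrow> m \<in> ball l0 r \<Longrightarrow> t \<ge> 0 \<Longrightarrow> (\<And>i. m $ i \<le> l $ i + t) \<Longrightarrow>
       f m - f l \<le> C * t - c * (\<Sum>i\<in>UNIV. l $ i + t - m $ i)"
    using local_increment_bound[OF assms(1-4) l0(1)] by blast
  \<comment> \<open>Each entry of the spectra moves by at most twice this number, hence their norm by less than the radius.\<close>
  define \<eta> where "\<eta> = r / (4 * real CARD('n))"
  have \<eta>: "\<eta> > 0" "real CARD('n) * (2 * \<eta>) < r" using rcC(1) by (auto simp: \<eta>_def)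
  show thesis
  proof (rule that[OF \<eta>(1) rcC(2,3)])
    fix A :: "real^'n^'n" and l :: "real^'n" and s t :: real and z :: "real^'n"
    assume sym: "transpose A = A" and l: "ordered_spectrum A l"
      and close: "\<And>x. \<bar>x \<bullet> (A *v x) - x \<bullet> (A0 *v x)\<bar> \<le> \<eta> * (x \<bullet> x)"
      and s: "0 \<le> s" "s * (z \<bullet> z) \<le> \<eta>" and t: "0 \<le> t" "t \<le> \<eta>"
    define M where "M = A + t *\<^sub>R mat 1 - s *\<^sub>R outer z z"
    have "transpose M = M"
      using sym unfolding M_def transpose_def mat_def outer_def vec_eq_iff by (simp add: eq_commute mult.commute)
    then obtain m where m: "ordered_spectrum M m" using symmetric_matrix_ordered_spectrum by blast
    have Mx: "x \<bullet> (M *v x) = x \<bullet> (A *v x) + t * (x \<bullet> x) - s * (z \<bullet> x)\<^sup>2" for x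
      by (simp add: M_def matrix_vector_mult_diff_rdistrib matrix_vector_mult_add_rdistrib inner_diff_right
          inner_add_right scaleR_matrix_vector_assoc[symmetric] outer_mult_vec power2_eq_square inner_commute)
    have up: "m $ i \<le> l $ i + t" for i
      by (rule ordered_spectrum_upper[OF m l]) (use s in \<open>simp add: Mx\<close>)
    have lo: "l $ i \<le> m $ i + s * (z \<bullet> z)" for i
    proof (rule ordered_spectrum_upper[OF l m])
      fix x
      have "s * (z \<bullet> x)\<^sup>2 \<le> s * (z \<bullet> z) * (x \<bullet> x)"
        using Cauchy_Schwarz_ineq[of z x] s by (simp add: mult.assoc mult_left_mono)
      thus "x \<bullet> (A *v x) \<le> x \<bullet> (M *v x) + s * (z \<bullet> z) * (x \<bullet> x)"
        using t by (simp add: Mx)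
    qed
    have l1: "l $ i \<le> l0 $ i + \<eta>" for i
      by (rule ordered_spectrum_upper[OF l l0(2)]) (use close in \<open>smt (verit)\<close>)
    have l2: "l0 $ i \<le> l $ i + \<eta>" for i
      by (rule ordered_spectrum_upper[OF l0(2) l]) (use close in \<open>smt (verit)\<close>)
    have "\<bar>(l - l0) $ i\<bar> \<le> 2 * \<eta>" for i
      using l1[of i] l2[of i] \<eta>(1) by simp
    hence "l \<in> ball l0 r"
      using norm_le_sum_components[of "l - l0"] \<eta>(2) by (fastforce simp: dist_norm norm_minus_commute)
    have "\<bar>(m - l0) $ i\<bar> \<le> 2 * \<eta>" for i
      using l1[of i] l2[of i] up[of i] lo[of i] s t by simp
    hence "m \<in> ball l0 r"
      using norm_le_sum_components[of "m - l0"] \<eta>(2) by (fastforce simp: dist_norm norm_minus_commute)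
    have "(\<Sum>i\<in>UNIV. l $ i + t - m $ i) = s * (z \<bullet> z)"
    proof -
      have "(\<Sum>i\<in>UNIV. m $ i) = (\<Sum>i\<in>UNIV. l $ i + t) - s * (z \<bullet> z)"
        using ordered_spectrum_trace[OF m] ordered_spectrum_trace[OF ordered_spectrum_add_scalar[OF l, of t]]
        by (simp add: M_def trace_sub trace_scaleR trace_outer)
      thus ?thesis by (simp add: sum_subtractf)
    qed
    hence "f m - f l \<le> C * t - c * s * (z \<bullet> z)"
      using inc[OF \<open>l \<in> ball l0 r\<close> \<open>m \<in> ball l0 r\<close> t(1) up] by (simp add: mult.assoc)
    thus "\<exists>m\<in>\<Gamma>. ordered_spectrum (A + t *\<^sub>R mat 1 - s *\<^sub>R outer z z) m
        \<and> f m - f l \<le> C * t - c * s * (z \<bullet> z)"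
      using m \<open>m \<in> ball l0 r\<close> rcC(4) unfolding M_def by blast
  qed
qed

section \<open>Comparison principles\<close>

locale elliptic_spectral_function =
  fixes \<Gamma> :: "(real^'n) set" and f :: "real^'n \<Rightarrow> real" and D :: "real^'n \<Rightarrow> real^'n"
  assumes open_domain: "open \<Gamma>" and convex_domain: "convex \<Gamma>"
    and deriv: "\<And>x. x \<in> \<Gamma> \<Longrightarrow> (f has_derivative (\<lambda>h. D x \<bullet> h)) (at x)"
    and cont_deriv: "continuous_on \<Gamma> D"
    and deriv_pos: "\<And>x i. x \<in> \<Gamma> \<Longrightarrow> 0 < D x $ i"
begin

text \<open>Membership of both spectra in \<open>\<Gamma>\<close> is included because \<open>f\<close> is controlled only there.\<close>
definition spectral_le :: "real^'n^'n \<Rightarrow> real^'n^'n \<Rightarrow> bool" where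
  "spectral_le A B \<longleftrightarrow> (\<exists>l\<in>\<Gamma>. \<exists>m\<in>\<Gamma>. ordered_spectrum A l \<and> ordered_spectrum B m \<and> f l \<le> f m)"

text \<open>Hopf's lemma for a pair of functions that are ordered inside a ball and touch at a boundary point. On
  the part near \<open>x0\<close> of a smaller ball that touches the given one from inside at \<open>x0\<close>, the difference
  \<open>q - p\<close> is compared with \<open>\<epsilon> h\<close> for the Gaussian barrier \<open>h\<close>. If \<open>q - p - \<epsilon> h\<close> were negative
  somewhere, it would have an interior minimum \<open>y0\<close>; there \<open>p\<close> has gradient \<open>Dq - \<epsilon> Dh\<close> and Hessian
  at most \<open>D\<^sup>2q - \<epsilon> D\<^sup>2h\<close>, and \<open>0 < q - p < \<epsilon> h\<close>, so \<open>S[p]\<close> is at most \<open>S[q] + t I - s z z\<^sup>T\<close> as a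
  form, with \<open>s\<close> larger than \<open>t\<close> by a factor proportional to the exponent of the barrier. Then
  \<open>f(\<lambda>(S[p])) < f(\<lambda>(S[q]))\<close>, against the assumption. So \<open>q - p \<ge> \<epsilon> h\<close> near \<open>x0\<close>, and the normal
  derivative of \<open>h\<close> at \<open>x0\<close> is positive.\<close>
lemma hopf_boundary_point:
  assumes hp: "has_hessian p gp Hp" and hq: "has_hessian q gq Hq" and p_pos: "\<And>x. 0 < p x"
    and R: "0 < R" and less: "\<And>y. y \<in> ball c R \<Longrightarrow> p y < q y"
    and x0: "norm (x0 - c) = R" "p x0 = q x0"
    and l0: "l0 \<in> \<Gamma>" "ordered_spectrum (schouten_form (q x0) (gq x0) (Hq x0)) l0"
    and eq: "\<And>y. y \<in> ball c R \<Longrightarrow>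
      spectral_le (schouten_form (q y) (gq y) (Hq y)) (schouten_form (p y) (gp y) (Hp y))"
  shows "0 < (gq x0 - gp x0) \<bullet> (c - x0)"
proof -
  note dp = has_hessianD[OF hp] and dq = has_hessianD[OF hq]
  define S where "S y = schouten_form (q y) (gq y) (Hq y)" for y
  have contS: "continuous_on UNIV S"
    unfolding S_def schouten_form_def by (intro continuous_intros dq) auto
  have symS: "transpose (S y) = S y" for y
    unfolding S_def by (rule schouten_form_symmetric[OF has_hessian_symmetric[OF hq]])
  obtain \<eta> cf Cf where \<eta>: "\<eta> > 0" and cf: "cf > 0" and Cf: "Cf > 0"
    and decrease: "\<And>A l s t z. \<lbrakk>transpose A = A; ordered_spectrum A l;
        \<And>x. \<bar>x \<bullet> (A *v x) - x \<bullet> (S x0 *v x)\<bar> \<le> \<eta> * (x \<bullet> x);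
        0 \<le> s; s * (z \<bullet> z) \<le> \<eta>; 0 \<le> t; t \<le> \<eta>\<rbrakk> \<Longrightarrow>
      \<exists>m\<in>\<Gamma>. ordered_spectrum (A + t *\<^sub>R mat 1 - s *\<^sub>R outer z z) m
        \<and> f m - f l \<le> Cf * t - cf * s * (z \<bullet> z)"
    by (rule spectral_function_decrease[OF open_domain deriv cont_deriv deriv_pos l0(1)])
      (use l0(2) in \<open>auto simp: S_def\<close>)
  \<comment> \<open>The closed ball of half the radius tangent at the boundary point meets the boundary of the given ball only there, so the two functions are strictly ordered on the rest of it.\<close>
  define c' where "c' = (1/2) *\<^sub>R (c + x0)"
  define r where "r = R / 2"
  have r: "r > 0" using R by (simp add: r_def)
  have c'c: "c' - c = x0 - c'" and x0c': "x0 - c' = (1/2) *\<^sub>R (x0 - c)"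
    by (auto simp: c'_def algebra_simps scaleR_2[symmetric])
  have nx0: "norm (x0 - c') = r" unfolding x0c' r_def using x0(1) by simp
  have inner_ball: "y \<in> ball c R" if "norm (y - c') \<le> r" "y \<noteq> x0" for y
  proof -
    have "y - c = (y - c') + (x0 - c')" using c'c by (simp add: algebra_simps)
    hence "(norm (y - c))\<^sup>2 + (norm (y - x0))\<^sup>2 = 2 * (norm (y - c'))\<^sup>2 + 2 * (norm (x0 - c'))\<^sup>2"
    proof -
      have "y - x0 = (y - c') - (x0 - c')" by simp
      moreover have "(norm (A + B))\<^sup>2 + (norm (A - B))\<^sup>2 = 2 * (norm A)\<^sup>2 + 2 * (norm B)\<^sup>2"
        for A B :: "real^'n"
        by (simp add: power2_norm_eq_inner inner_add_left inner_add_right inner_diff_left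
            inner_diff_right)
      ultimately show ?thesis using \<open>y - c = (y - c') + (x0 - c')\<close> by metis
    qed
    moreover have "(norm (y - c'))\<^sup>2 \<le> r\<^sup>2" using that(1) by (intro power_mono) auto
    moreover have "(norm (y - x0))\<^sup>2 > 0" using that(2) by simp
    moreover have "(norm (x0 - c'))\<^sup>2 = R\<^sup>2 / 4" "r\<^sup>2 = R\<^sup>2 / 4"
      unfolding nx0 by (simp_all add: r_def power_divide)
    ultimately have "(norm (y - c))\<^sup>2 < R\<^sup>2" by linarith
    hence "norm (y - c) < R" using R by (simp add: power2_less_imp_less)
    thus ?thesis by (simp add: dist_norm norm_minus_commute)
  qed
  define p1 where "p1 = p x0 / 2"
  define C1 where "C1 = norm (gq x0) + 1"
  define C2 where "C2 = norm (Hq x0) + 1"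
  define C3 where "C3 = q x0 + 1"
  \<comment> \<open>The bounds needed for the lower-order terms of the barrier: the gradient of q, the Hessian of q, and p < q.\<close>
  define C where "C = C2 + 2 * C3 + 2 * C1 * r"
  have pos: "p1 > 0" "C1 > 0" "C2 > 0" "C3 > 0"
    using p_pos[of x0] x0(2) by (auto simp: p1_def C1_def C2_def C3_def add_nonneg_pos)
  have C: "C > 0" unfolding C_def using pos r by (intro add_pos_pos mult_pos_pos) auto
  have "\<forall>\<^sub>F y in nhds x0. norm (S y - S x0) < \<eta> \<and> - p y < - p1 \<and> norm (gq y) < C1 \<and>
      norm (Hq y) < C2 \<and> q y < C3"
    by (intro eventually_conj eventually_nhds_less continuous_intros contS dp dq)
      (use \<eta> p_pos[of x0] in \<open>auto simp: p1_def C1_def C2_def C3_def\<close>)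
  then obtain d0 where d0: "d0 > 0" and near: "\<And>y. dist y x0 < d0 \<Longrightarrow> norm (S y - S x0) < \<eta> \<and>
      - p y < - p1 \<and> norm (gq y) < C1 \<and> norm (Hq y) < C2 \<and> q y < C3"
    unfolding eventually_nhds_metric by blast
  define \<delta> where "\<delta> = min (d0 / 2) (r / 2)"
  have \<delta>: "\<delta> > 0" "\<delta> < d0" "\<delta> \<le> r / 2" using d0 r by (auto simp: \<delta>_def)
  define W where "W y = q y - p y" for y
  have contW: "continuous_on UNIV W" unfolding W_def by (intro continuous_intros dp dq)
  have W_pos: "W y > 0" if "norm (y - c') \<le> r" "y \<noteq> x0" for y
    using less[OF inner_ball[OF that]] by (simp add: W_def)
  obtain m0 where m0: "m0 > 0" "\<And>y. y \<in> cball c' r \<inter> sphere x0 \<delta> \<Longrightarrow> m0 \<le> W y"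
  proof (cases "cball c' r \<inter> sphere x0 \<delta> = {}")
    case True thus thesis using that[of 1] by auto
  next
    case False
    have "compact (cball c' r \<inter> sphere x0 \<delta>)" by (intro compact_Int_closed) auto
    from continuous_attains_inf[OF this False continuous_on_subset[OF contW]]
    obtain y where y: "y \<in> cball c' r \<inter> sphere x0 \<delta>"
      "\<And>z. z \<in> cball c' r \<inter> sphere x0 \<delta> \<Longrightarrow> W y \<le> W z" by blast
    have "W y > 0" using y(1) \<delta>(1) by (intro W_pos) (auto simp: dist_norm norm_minus_commute)
    thus thesis using that[of "W y"] y(2) by blast
  qed
  \<comment> \<open>Large enough for the rank-one gain to beat the scalar loss; see the final estimate for the minimum point.\<close>
  define a where "a = 1 + Cf * C / (cf * p1 * r\<^sup>2)"
  have a1: "a \<ge> 1" unfolding a_def using Cf C cf pos r by simp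
  have a2: "Cf * C < cf * a * p1 * r\<^sup>2"
  proof -
    have "cf * p1 * r\<^sup>2 > 0" using cf pos r by simp
    moreover have "k * (1 + b / k) = k + b" if "0 < k" for k b :: real
      using that by (simp add: distrib_left)
    ultimately have "cf * p1 * r\<^sup>2 * a = cf * p1 * r\<^sup>2 + Cf * C" unfolding a_def by blast
    thus ?thesis using \<open>cf * p1 * r\<^sup>2 > 0\<close> by (simp add: mult_ac)
  qed
  \<comment> \<open>The first two entries keep the perturbation of the matrix within the range of the decrease estimate, the third makes the barrier lie below q - p on the spherical cap.\<close>
  define \<epsilon> where "\<epsilon> = Min {\<eta> / (a * C), \<eta> / (4 * a\<^sup>2 * p1 * r\<^sup>2), m0}"
  have \<epsilon>: "\<epsilon> > 0" unfolding \<epsilon>_def using \<eta> a1 C pos r m0(1) by (auto intro!: divide_pos_pos mult_pos_pos)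
  have "\<epsilon> \<le> \<eta> / (a * C)" "\<epsilon> \<le> \<eta> / (4 * a\<^sup>2 * p1 * r\<^sup>2)" and \<epsilon>m: "\<epsilon> \<le> m0"
    unfolding \<epsilon>_def by auto
  hence \<epsilon>1: "\<epsilon> * (a * C) \<le> \<eta>" and \<epsilon>2: "\<epsilon> * (4 * a\<^sup>2 * p1 * r\<^sup>2) \<le> \<eta>"
    using a1 C pos r by (simp_all add: pos_le_divide_eq)
  define E where "E y = exp (- a * ((y - c') \<bullet> (y - c')))" for y
  have E: "0 < E y" "E y \<le> 1" for y using a1 by (auto simp: E_def)
  define h where "h y = E y - exp (- a * r\<^sup>2)" for y
  define gh where "gh y = (- 2 * a * E y) *\<^sub>R (y - c')" for y
  define Hh where "Hh y = E y *\<^sub>R ((4 * a\<^sup>2) *\<^sub>R outer (y - c') (y - c') - (2 * a) *\<^sub>R mat 1)" for y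
  have hh: "has_hessian h gh Hh"
    using has_hessian_gaussian_barrier[of a c' "exp (- a * r\<^sup>2)"]
    unfolding h_def[abs_def] gh_def[abs_def] Hh_def[abs_def] E_def[abs_def] .
  have h_le: "h y \<le> E y" for y by (simp add: h_def)
  define \<Phi> where "\<Phi> y = W y - \<epsilon> * h y" for y
  have h\<Phi>: "has_hessian \<Phi> (\<lambda>y. gq y - gp y - \<epsilon> *\<^sub>R gh y) (\<lambda>y. Hq y - Hp y - \<epsilon> *\<^sub>R Hh y)"
    unfolding \<Phi>_def[abs_def] W_def by (intro has_hessian_diff has_hessian_cmult hp hq hh)
  note d\<Phi> = has_hessianD[OF h\<Phi>]
  have \<Phi>x0: "\<Phi> x0 = 0"
    using nx0 x0(2) by (simp add: \<Phi>_def W_def h_def E_def dot_square_norm)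
  have nonneg: "0 \<le> \<Phi> y" if y: "y \<in> cball c' r \<inter> cball x0 \<delta>" for y
  proof (rule ccontr)
    assume neg: "\<not> 0 \<le> \<Phi> y"
    have "compact (cball c' r \<inter> cball x0 \<delta>)" by (intro compact_Int_closed) auto
    from continuous_attains_inf[OF this _ continuous_on_subset[OF d\<Phi>(3)]] y
    obtain y0 where y0: "y0 \<in> cball c' r \<inter> cball x0 \<delta>"
      and min: "\<And>z. z \<in> cball c' r \<inter> cball x0 \<delta> \<Longrightarrow> \<Phi> y0 \<le> \<Phi> z" by blast
    have neg0: "\<Phi> y0 < 0" using min[OF y] neg by simp
    hence "y0 \<noteq> x0" using \<Phi>x0 by auto
    define z where "z = y0 - c'"
    have nz: "norm z \<le> r" using y0 by (simp add: z_def dist_norm norm_minus_commute)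
    have W0: "W y0 > 0" using W_pos[OF nz[unfolded z_def] \<open>y0 \<noteq> x0\<close>] .
    have yball: "y0 \<in> ball c R" using inner_ball[OF nz[unfolded z_def] \<open>y0 \<noteq> x0\<close>] .
    have "norm z \<noteq> r"
    proof
      assume "norm z = r"
      hence "h y0 = 0" by (simp add: h_def E_def z_def[symmetric] dot_square_norm)
      thus False using neg0 W0 by (simp add: \<Phi>_def)
    qed
    hence "y0 \<in> ball c' r" using nz by (simp add: z_def dist_norm norm_minus_commute)
    moreover have "y0 \<in> ball x0 \<delta>"
    proof (rule ccontr)
      assume "y0 \<notin> ball x0 \<delta>"
      hence "y0 \<in> cball c' r \<inter> sphere x0 \<delta>" using y0 by auto
      hence "m0 \<le> W y0" by (rule m0(2))
      moreover have "\<epsilon> * h y0 \<le> \<epsilon> * 1"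
        using h_le[of y0] E(2)[of y0] \<epsilon> by (intro mult_left_mono) auto
      ultimately show False using neg0 \<epsilon>m by (simp add: \<Phi>_def)
    qed
    ultimately have y0T: "y0 \<in> ball c' r \<inter> ball x0 \<delta>" by blast
    have T: "open (ball c' r \<inter> ball x0 \<delta>)" by auto
    have minT: "\<Phi> y0 \<le> \<Phi> y" if "y \<in> ball c' r \<inter> ball x0 \<delta>" for y
      using that by (intro min) auto
    have gp_eq: "gp y0 = gq y0 - \<epsilon> *\<^sub>R gh y0"
      using has_hessian_local_min(1)[OF h\<Phi> T y0T minT] by (simp add: algebra_simps)
    have Hess: "0 \<le> v \<bullet> ((Hq y0 - Hp y0 - \<epsilon> *\<^sub>R Hh y0) *v v)" for v
      by (rule has_hessian_local_min(2)[OF h\<Phi> T y0T minT])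
    have bounds: "norm (S y0 - S x0) < \<eta>" "p1 < p y0" "norm (gq y0) < C1" "norm (Hq y0) < C2" "q y0 < C3"
      using near[of y0] y0T \<delta>(2) by (auto simp: dist_commute)
    have "r / 2 \<le> norm z"
    proof -
      have "norm (x0 - c') \<le> norm (x0 - y0) + norm z"
        unfolding z_def using norm_triangle_ineq[of "x0 - y0" "y0 - c'"] by simp
      thus ?thesis using nx0 \<delta>(3) y0T by (simp add: dist_norm)
    qed
    hence zz: "r\<^sup>2 / 4 \<le> z \<bullet> z" "z \<bullet> z \<le> r\<^sup>2"
      using power_mono[of "r/2" "norm z" 2] power_mono[of "norm z" r 2] nz r
      by (auto simp: dot_square_norm power_divide)
    \<comment> \<open>The perturbation of the matrix at the minimum point, as an upper bound: a scalar part and a rank-one part.\<close>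
    define t where "t = \<epsilon> * E y0 * (a * C)"
    define s where "s = \<epsilon> * E y0 * (4 * a\<^sup>2 * p1)"
    have \<epsilon>E: "0 < \<epsilon> * E y0" "\<epsilon> * E y0 \<le> \<epsilon>" using \<epsilon> E[of y0] by (auto simp: mult_le_cancel_left1)
    have t: "0 \<le> t" "t \<le> \<eta>"
    proof -
      show "0 \<le> t" unfolding t_def using \<epsilon>E a1 C by simp
      have "t \<le> \<epsilon> * (a * C)" unfolding t_def using \<epsilon>E a1 C by (intro mult_right_mono) auto
      thus "t \<le> \<eta>" using \<epsilon>1 by simp
    qed
    have s: "0 \<le> s" "s * (z \<bullet> z) \<le> \<eta>"
    proof -
      show "0 \<le> s" unfolding s_def using \<epsilon>E a1 pos by simp
      have "s * (z \<bullet> z) \<le> (\<epsilon> * (4 * a\<^sup>2 * p1)) * r\<^sup>2"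
        unfolding s_def using \<epsilon>E a1 pos zz \<epsilon> by (intro mult_mono mult_right_mono) auto
      thus "s * (z \<bullet> z) \<le> \<eta>" using \<epsilon>2 by (simp add: mult_ac)
    qed
    obtain lp lq where lp: "lp \<in> \<Gamma>" "ordered_spectrum (schouten_form (p y0) (gp y0) (Hp y0)) lp"
      and lq: "lq \<in> \<Gamma>" "ordered_spectrum (S y0) lq" and fle: "f lq \<le> f lp"
      using eq[OF yball] unfolding spectral_le_def S_def by blast
    have "\<bar>x \<bullet> (S y0 *v x) - x \<bullet> (S x0 *v x)\<bar> \<le> \<eta> * (x \<bullet> x)" for x
    proof -
      have "\<bar>x \<bullet> ((S y0 - S x0) *v x)\<bar> \<le> norm (S y0 - S x0) * (x \<bullet> x)"
        by (rule quadratic_spectral_le_norm)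
      also have "\<dots> \<le> \<eta> * (x \<bullet> x)" using bounds(1) by (intro mult_right_mono) auto
      finally show ?thesis by (simp add: matrix_vector_mult_diff_rdistrib inner_diff_right)
    qed
    from decrease[OF symS lq(2) this s t]
    obtain m where m: "m \<in> \<Gamma>" "ordered_spectrum (S y0 + t *\<^sub>R mat 1 - s *\<^sub>R outer z z) m"
      "f m - f lq \<le> Cf * t - cf * s * (z \<bullet> z)" by blast
    have quad: "v \<bullet> (schouten_form (p y0) (gp y0) (Hp y0) *v v)
        \<le> v \<bullet> ((S y0 + t *\<^sub>R mat 1 - s *\<^sub>R outer z z) *v v)" for v
    proof -
      define V where "V = v \<bullet> v"
      define X where "X = (z \<bullet> v)\<^sup>2"
      define hq where "hq = v \<bullet> (Hq y0 *v v)"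
      have VX: "0 \<le> V" "0 \<le> X" by (auto simp: V_def X_def)
      have e0: "v \<bullet> (Hh y0 *v v) = E y0 * (4 * a\<^sup>2 * X - 2 * a * V)"
        by (simp add: Hh_def z_def[symmetric] scaleR_matrix_vector_assoc[symmetric]
            matrix_vector_mult_diff_rdistrib outer_mult_vec inner_diff_right X_def V_def
            power2_eq_square inner_commute)
      have e1: "v \<bullet> (Hp y0 *v v) \<le> hq - \<epsilon> * E y0 * (4 * a\<^sup>2 * X - 2 * a * V)"
        using Hess[of v] e0
        by (simp add: matrix_vector_mult_diff_rdistrib inner_diff_right hq_def
            scaleR_matrix_vector_assoc[symmetric] mult.assoc)
      \<comment> \<open>The value of p differs from that of q by less than the barrier.\<close>
      have e2: "- W y0 * hq \<le> \<epsilon> * E y0 * (C2 * V)"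
      proof -
        have "\<bar>hq\<bar> \<le> C2 * V" using quadratic_spectral_le_norm[of v "Hq y0"] bounds(4) VX
          unfolding hq_def V_def by (smt (verit) mult_right_mono)
        moreover have "W y0 \<le> \<epsilon> * E y0"
          using neg0 mult_left_mono[OF h_le[of y0] less_imp_le[OF \<epsilon>]] unfolding \<Phi>_def by linarith
        ultimately have "W y0 * \<bar>hq\<bar> \<le> \<epsilon> * E y0 * (C2 * V)"
          using W0 \<epsilon>E by (intro mult_mono) auto
        moreover have "- W y0 * hq \<le> W y0 * \<bar>hq\<bar>"
          using mult_left_mono[of "- hq" "\<bar>hq\<bar>" "W y0"] W0 by simp
        ultimately show ?thesis by linarith
      qed
      have e3: "gq y0 \<bullet> gq y0 - gp y0 \<bullet> gp y0 \<le> \<epsilon> * E y0 * (4 * a * C1 * r)"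
      proof -
        have "gp y0 \<bullet> gp y0 = gq y0 \<bullet> gq y0 - 2 * \<epsilon> * (gq y0 \<bullet> gh y0) + \<epsilon>\<^sup>2 * (gh y0 \<bullet> gh y0)"
          unfolding gp_eq by (simp add: inner_diff_left inner_diff_right inner_commute power2_eq_square)
        moreover have "0 \<le> \<epsilon>\<^sup>2 * (gh y0 \<bullet> gh y0)" by simp
        moreover have "2 * \<epsilon> * (gq y0 \<bullet> gh y0) = \<epsilon> * E y0 * (4 * a * (- (gq y0 \<bullet> z)))"
          by (simp add: gh_def z_def)
        moreover have "- (gq y0 \<bullet> z) \<le> C1 * r"
        proof -
          have "- (gq y0 \<bullet> z) \<le> norm (gq y0) * norm z"
            using Cauchy_Schwarz_ineq2[of "gq y0" z] by linarith
          also have "\<dots> \<le> C1 * r" using bounds(3) nz pos by (intro mult_mono) auto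
          finally show ?thesis .
        qed
        hence "\<epsilon> * E y0 * (4 * a * (- (gq y0 \<bullet> z))) \<le> \<epsilon> * E y0 * (4 * a * (C1 * r))"
          using \<epsilon>E a1 by (intro mult_left_mono) auto
        ultimately have "gq y0 \<bullet> gq y0 - gp y0 \<bullet> gp y0 \<le> \<epsilon> * E y0 * (4 * a * (C1 * r))" by linarith
        thus ?thesis by (simp only: mult.assoc)
      qed
      have pq: "p y0 = q y0 - W y0" "p1 \<le> p y0" "p y0 \<le> C3"
        using bounds W0 by (auto simp: W_def)
      have "v \<bullet> (schouten_form (p y0) (gp y0) (Hp y0) *v v)
          = p y0 * (v \<bullet> (Hp y0 *v v)) - (gp y0 \<bullet> gp y0) / 2 * V"
        by (simp add: schouten_form_quadratic V_def)
      also have "\<dots> \<le> p y0 * (hq - \<epsilon> * E y0 * (4 * a\<^sup>2 * X - 2 * a * V)) - (gp y0 \<bullet> gp y0) / 2 * V"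
        using mult_left_mono[OF e1, of "p y0"] p_pos[of y0] by simp
      also have "\<dots> = q y0 * hq - (gq y0 \<bullet> gq y0) / 2 * V + (- W y0 * hq)
          + (gq y0 \<bullet> gq y0 - gp y0 \<bullet> gp y0) / 2 * V
          + p y0 * (\<epsilon> * E y0 * (2 * a * V)) - p y0 * (\<epsilon> * E y0 * (4 * a\<^sup>2 * X))"
        by (simp add: pq(1) algebra_simps diff_divide_distrib)
      also have "\<dots> \<le> q y0 * hq - (gq y0 \<bullet> gq y0) / 2 * V + \<epsilon> * E y0 * (C2 * V)
          + (\<epsilon> * E y0 * (4 * a * C1 * r)) / 2 * V
          + C3 * (\<epsilon> * E y0 * (2 * a * V)) - p1 * (\<epsilon> * E y0 * (4 * a\<^sup>2 * X))"
        using e2 e3 pq VX \<epsilon>E a1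
        by (intro add_mono diff_mono mult_right_mono divide_right_mono order.refl) auto
      also have "\<dots> = q y0 * hq - (gq y0 \<bullet> gq y0) / 2 * V
          + \<epsilon> * E y0 * (C2 + a * (2 * C1 * r + 2 * C3)) * V - s * X"
        by (simp add: s_def algebra_simps)
      also have "\<dots> \<le> q y0 * hq - (gq y0 \<bullet> gq y0) / 2 * V + t * V - s * X"
      proof -
        have "C2 + a * (2 * C1 * r + 2 * C3) \<le> a * C"
          using mult_right_mono[OF a1, of C2] pos by (simp add: C_def algebra_simps)
        hence "\<epsilon> * E y0 * (C2 + a * (2 * C1 * r + 2 * C3)) * V \<le> t * V"
          unfolding t_def using \<epsilon>E VX by (intro mult_right_mono mult_left_mono) auto
        thus ?thesis by simp
      qed
      also have "\<dots> = v \<bullet> ((S y0 + t *\<^sub>R mat 1 - s *\<^sub>R outer z z) *v v)"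
        by (simp add: matrix_vector_mult_diff_rdistrib matrix_vector_mult_add_rdistrib inner_diff_right
            inner_add_right scaleR_matrix_vector_assoc[symmetric] outer_mult_vec power2_eq_square
            inner_commute S_def schouten_form_quadratic hq_def V_def X_def)
      finally show ?thesis .
    qed
    have "f lp \<le> f m"
      by (rule mono_if_gradient_nonneg[OF convex_domain deriv _ lp(1) m(1)])
        (auto intro: less_imp_le deriv_pos ordered_spectrum_mono[OF lp(2) m(2) quad])
    moreover have "Cf * t - cf * s * (z \<bullet> z) < 0"
    proof -
      have "Cf * t = \<epsilon> * E y0 * a * (Cf * C)" by (simp add: t_def)
      also have "\<dots> < \<epsilon> * E y0 * a * (cf * a * p1 * r\<^sup>2)"
        using a2 \<epsilon>E a1 by (intro mult_strict_left_mono) auto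
      also have "\<dots> = cf * s * (r\<^sup>2 / 4)" by (simp add: s_def power2_eq_square)
      also have "\<dots> \<le> cf * s * (z \<bullet> z)" using zz cf s by (intro mult_left_mono) auto
      finally show ?thesis by simp
    qed
    ultimately show False using m(3) fle by linarith
  qed
  have "0 \<le> (gq x0 - gp x0 - \<epsilon> *\<^sub>R gh x0) \<bullet> (c' - x0)"
  proof (rule ccontr)
    assume neg: "\<not> ?thesis"
    have "((\<lambda>s. x0 + s *\<^sub>R (c' - x0)) has_derivative (\<lambda>s. s *\<^sub>R (c' - x0))) (at 0)"
      by (auto intro!: derivative_eq_intros)
    from has_derivative_compose[OF this d\<Phi>(1)[of "x0 + 0 *\<^sub>R (c' - x0)"]]
    have "((\<lambda>s. \<Phi> (x0 + s *\<^sub>R (c' - x0))) has_real_derivative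
        (gq x0 - gp x0 - \<epsilon> *\<^sub>R gh x0) \<bullet> (c' - x0)) (at 0)"
      by (simp add: has_field_derivative_def mult_commute_abs)
    from DERIV_neg_dec_right[OF this] neg obtain d where d: "d > 0"
      "\<And>s. 0 < s \<Longrightarrow> s < d \<Longrightarrow> \<Phi> (x0 + s *\<^sub>R (c' - x0)) < 0" using \<Phi>x0 by auto
    define s where "s = Min {d / 2, 1, \<delta> / r}"
    have "s \<le> d / 2" unfolding s_def by (rule Min_le) auto
    hence "s < d" using d(1) by simp
    moreover have "0 < s" using d(1) \<delta>(1) r by (simp add: s_def)
    moreover have "s \<le> 1" "s \<le> \<delta> / r" by (simp_all add: s_def)
    ultimately have s: "0 < s" "s < d" "s \<le> 1" "s \<le> \<delta> / r" by blast+
    have "x0 + s *\<^sub>R (c' - x0) - c' = (1 - s) *\<^sub>R (x0 - c')" by (simp add: algebra_simps)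
    hence "norm (x0 + s *\<^sub>R (c' - x0) - c') \<le> r"
      using s r by (simp add: nx0 mult_left_le_one_le)
    moreover have "norm (s *\<^sub>R (c' - x0)) \<le> \<delta>"
      using s r nx0 by (simp add: norm_minus_commute[of c'] pos_le_divide_eq)
    ultimately have "x0 + s *\<^sub>R (c' - x0) \<in> cball c' r \<inter> cball x0 \<delta>"
      by (simp add: dist_norm norm_minus_commute[of c'])
    thus False using nonneg d(2)[OF s(1,2)] by force
  qed
  moreover have "\<epsilon> * (gh x0 \<bullet> (c' - x0)) = 2 * \<epsilon> * a * E x0 * r\<^sup>2"
  proof -
    have "(x0 - c') \<bullet> (c' - x0) = - r\<^sup>2"
      using nx0 dot_square_norm[of "x0 - c'"] by (simp add: inner_diff_left inner_diff_right inner_commute)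
    thus ?thesis by (simp add: gh_def)
  qed
  moreover have "2 * \<epsilon> * a * E x0 * r\<^sup>2 > 0" using \<epsilon> a1 E r by simp
  ultimately have "0 < (gq x0 - gp x0) \<bullet> (c' - x0)"
    by (simp add: inner_diff_left)
  moreover have "c - x0 = 2 *\<^sub>R (c' - x0)" by (simp add: c'_def algebra_simps scaleR_2)
  ultimately show ?thesis by simp
qed

text \<open>If both behaviours occurred, a ball inside the set where \<open>p < q\<close> would touch the
  coincidence set at an interior point \<open>x0\<close>. There \<open>q - p\<close> has an interior minimum and hence zero
  gradient, which Hopf's lemma excludes.\<close>
lemma strong_maximum_principle:
  assumes hp: "has_hessian p gp Hp" and hq: "has_hessian q gq Hq" and p_pos: "\<And>x. 0 < p x"
    and le: "\<And>y. y \<in> ball 0 \<rho> \<Longrightarrow> p y \<le> q y"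
    and eq: "\<And>y. y \<in> ball 0 \<rho> \<Longrightarrow>
      spectral_le (schouten_form (q y) (gq y) (Hq y)) (schouten_form (p y) (gp y) (Hp y))"
  shows "(\<forall>y\<in>ball 0 \<rho>. p y = q y) \<or> (\<forall>y\<in>ball 0 \<rho>. p y < q y)"
proof (rule ccontr)
  assume neg: "\<not> ?thesis"
  note dp = has_hessianD[OF hp] and dq = has_hessianD[OF hq]
  define T where "T = {y \<in> ball 0 \<rho>. p y = q y}"
  define U where "U = {y \<in> ball 0 \<rho>. p y < q y}"
  have TU: "ball 0 \<rho> \<subseteq> T \<union> U" "T \<inter> U = {}" using le by (force simp: T_def U_def)+
  have ne: "T \<noteq> {}" "U \<noteq> {}" using neg le by (force simp: T_def U_def)+
  have "open (ball 0 \<rho> \<inter> {y. p y < q y})"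
    by (intro open_Int open_ball open_Collect_less dp dq)
  hence "open U" unfolding U_def by (simp add: Int_def)
  have "\<not> open T"
    using connected_ball[of "0::real^'n" \<rho>] \<open>open U\<close> TU ne unfolding connected_def T_def U_def by blast
  then obtain z0 where z0: "z0 \<in> T" "\<And>e. e > 0 \<Longrightarrow> \<not> ball z0 e \<subseteq> T"
    unfolding open_contains_ball by blast
  have nz0: "norm z0 < \<rho>" using z0(1) by (simp add: T_def)
  then obtain y2 where y2: "dist z0 y2 < (\<rho> - norm z0) / 2" "y2 \<notin> T"
  proof -
    have "\<not> ball z0 ((\<rho> - norm z0) / 2) \<subseteq> T" using z0(2) nz0 by simp
    thus thesis using that by (metis mem_ball subsetI)
  qed
  have near: "x \<in> ball 0 \<rho>" if "dist y2 x \<le> dist y2 z0" for x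
  proof -
    have "norm x \<le> norm z0 + (dist z0 y2 + dist y2 x)"
      using norm_triangle_sub[of x z0] dist_triangle[of x z0 y2]
      by (simp add: dist_norm norm_minus_commute)
    thus ?thesis using that y2(1) by (simp add: dist_commute)
  qed
  have y2U: "p y2 < q y2"
    using near[of y2] y2(2) le[of y2] by (fastforce simp: T_def)
  define K where "K = cball y2 (dist y2 z0) \<inter> {y. p y = q y}"
  have "compact K" unfolding K_def
    by (intro compact_Int_closed compact_cball closed_Collect_eq dp dq)
  moreover have "z0 \<in> K" using z0(1) by (simp add: K_def T_def)
  ultimately obtain x0 where x0: "x0 \<in> K" "\<And>y. y \<in> K \<Longrightarrow> dist y2 x0 \<le> dist y2 y"
    using continuous_attains_inf[of K "\<lambda>y. dist y2 y", OF _ _ continuous_on_dist[OF continuous_on_const continuous_on_id]]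
    by blast
  define R where "R = dist y2 x0"
  have R: "R > 0" "R \<le> dist y2 z0"
    using x0(1) y2U by (auto simp: R_def K_def)
  have "0 < (gq x0 - gp x0) \<bullet> (y2 - x0)"
  proof -
    have x0b: "x0 \<in> ball 0 \<rho>" using near[of x0] R by (simp add: R_def)
    from eq[OF x0b] obtain l0 where
      "l0 \<in> \<Gamma>" "ordered_spectrum (schouten_form (q x0) (gq x0) (Hq x0)) l0"
      unfolding spectral_le_def by blast
    moreover have "p y < q y" if "y \<in> ball y2 R" for y
    proof -
      have yb: "y \<in> ball 0 \<rho>" using that R by (intro near) auto
      have "y \<notin> K" using that x0(2)[of y] by (auto simp: R_def)
      hence "p y \<noteq> q y" using that R by (auto simp: K_def)
      thus ?thesis using le[OF yb] by simp
    qed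
    moreover have "y \<in> ball 0 \<rho>" if "y \<in> ball y2 R" for y
      using that R by (intro near) auto
    moreover have "norm (x0 - y2) = R" "p x0 = q x0"
      using x0(1) by (auto simp: R_def dist_norm norm_minus_commute K_def)
    ultimately show ?thesis
      by (intro hopf_boundary_point[OF hp hq p_pos R(1)] eq) auto
  qed
  moreover have "gq x0 - gp x0 = 0"
  proof (rule has_hessian_local_min(1)[OF has_hessian_diff[OF hq hp] open_ball])
    show "x0 \<in> ball 0 \<rho>" using near[of x0] R by (simp add: R_def)
    show "q x0 - p x0 \<le> q y - p y" if "y \<in> ball 0 \<rho>" for y
      using x0(1) le[OF that] by (simp add: K_def)
  qed
  ultimately show False by simp
qed

section \<open>Moving spheres\<close>

text \<open>The moving sphere argument. The sphere of radius \<open>\<rho>\<close> is moved in from infinity as long as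
  \<open>P \<rho>\<close>, that is \<open>p \<le> q\<^sub>\<rho>\<close> on the ball of radius \<open>\<rho>\<close>, persists. By the Kelvin relation, \<open>P \<rho>\<close> compares
  \<open>p(s \<omega>)/s\<close> at the radii \<open>s\<close> and \<open>\<rho>\<^sup>2/s\<close>, and \<open>E/|y|\<^sup>2\<close> with \<open>E = Dp \<bullet> y - p\<close> is the radial
  derivative of this quotient. Thus \<open>E > 0\<close> on the sphere \<open>|y| = \<rho>\<close> is exactly the conclusion of Hopf's
  lemma, and it controls the comparison near the sphere for all neighbouring radii.\<close>
lemma kelvin_pair_radial_coincidence:
  assumes hp: "has_hessian p gp Hp" and hq: "has_hessian q gq Hq"
    and p_pos: "\<And>x. 0 < p x" and q_pos: "\<And>x. 0 < q x"
    and kelvin: "\<And>y. y \<noteq> 0 \<Longrightarrow> p y = (y \<bullet> y) * q ((1 / (y \<bullet> y)) *\<^sub>R y)"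
    and eq: "\<And>\<rho> y. 0 < \<rho> \<Longrightarrow> norm y \<le> \<rho> \<Longrightarrow>
      spectral_le (schouten_form (q ((1 / \<rho>\<^sup>2) *\<^sub>R y)) (gq ((1 / \<rho>\<^sup>2) *\<^sub>R y)) (Hq ((1 / \<rho>\<^sup>2) *\<^sub>R y)))
        (schouten_form (p y) (gp y) (Hp y))"
  shows "\<exists>\<rho>>0. \<forall>y\<in>ball 0 \<rho>. p y = \<rho>\<^sup>2 * q ((1 / \<rho>\<^sup>2) *\<^sub>R y)"
proof -
  note dp = has_hessianD[OF hp] and dq = has_hessianD[OF hq]
  have p_compose: "continuous_on S (\<lambda>x. p (k x))" if "continuous_on S k"
    for S :: "'z::topological_space set" and k
    using continuous_on_compose2[OF dp(3) that] by auto
  have q_compose: "continuous_on S (\<lambda>x. q (k x))" if "continuous_on S k"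
    for S :: "'z::topological_space set" and k
    using continuous_on_compose2[OF dq(3) that] by auto
  define E where "E y = gp y \<bullet> y - p y" for y
  have contE: "continuous_on UNIV E" unfolding E_def by (intro continuous_intros dp)
  define P where "P \<rho> \<longleftrightarrow> (\<forall>y. norm y \<le> \<rho> \<longrightarrow> p y \<le> \<rho>\<^sup>2 * q ((1 / \<rho>\<^sup>2) *\<^sub>R y))" for \<rho>
  have ray: "((\<lambda>t. p (t *\<^sub>R \<omega>)) has_real_derivative gp (t *\<^sub>R \<omega>) \<bullet> \<omega>) (at t)"
    and rayq: "((\<lambda>t. q (t *\<^sub>R \<omega>)) has_real_derivative gq (t *\<^sub>R \<omega>) \<bullet> \<omega>) (at t)" for t \<omega>
  proof -
    have "((\<lambda>t. t *\<^sub>R \<omega>) has_derivative (\<lambda>s. s *\<^sub>R \<omega>)) (at t)"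
      by (auto intro!: derivative_eq_intros)
    from has_derivative_compose[OF this dp(1)] has_derivative_compose[OF this dq(1)]
    show "((\<lambda>t. p (t *\<^sub>R \<omega>)) has_real_derivative gp (t *\<^sub>R \<omega>) \<bullet> \<omega>) (at t)"
      "((\<lambda>t. q (t *\<^sub>R \<omega>)) has_real_derivative gq (t *\<^sub>R \<omega>) \<bullet> \<omega>) (at t)"
      by (simp_all add: has_field_derivative_def mult_commute_abs)
  qed
  \<comment> \<open>Differentiate the Kelvin relation along the ray through z.\<close>
  have E_kelvin: "E z = (z \<bullet> z) * (q x - gq x \<bullet> x)" if "z \<noteq> 0" "x = (1 / (z \<bullet> z)) *\<^sub>R z" for z x
  proof -
    have zz: "z \<bullet> z > 0" using that by simp
    have "((\<lambda>t. t\<^sup>2 * (z \<bullet> z) * q ((1 / t) *\<^sub>R x)) has_real_derivative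
        2 * (z \<bullet> z) * q x - (z \<bullet> z) * (gq x \<bullet> x)) (at 1)"
      by (auto intro!: derivative_eq_intros DERIV_chain2[OF rayq] simp: power2_eq_square)
    moreover have "((\<lambda>t. p (t *\<^sub>R z)) has_real_derivative gp z \<bullet> z) (at 1)"
      using ray[of z 1] by simp
    hence "((\<lambda>t. t\<^sup>2 * (z \<bullet> z) * q ((1 / t) *\<^sub>R x)) has_real_derivative gp z \<bullet> z) (at 1)"
    proof (rule has_field_derivative_transform_within_open[where S = "{0<..}"])
      fix t :: real assume t: "t \<in> {0<..}"
      have "(1 / ((t *\<^sub>R z) \<bullet> (t *\<^sub>R z))) *\<^sub>R (t *\<^sub>R z) = (1 / t) *\<^sub>R x"
        using t that by (simp add: field_simps)
      thus "p (t *\<^sub>R z) = t\<^sup>2 * (z \<bullet> z) * q ((1 / t) *\<^sub>R x)"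
        using kelvin[of "t *\<^sub>R z"] t that by (simp add: power2_eq_square)
    qed auto
    ultimately have "gp z \<bullet> z = 2 * (z \<bullet> z) * q x - (z \<bullet> z) * (gq x \<bullet> x)"
      by (rule DERIV_unique[OF _ _, symmetric])
    thus ?thesis using kelvin[OF that(1)] that(2) by (simp add: E_def algebra_simps)
  qed
  have radial_mono: "p (s *\<^sub>R \<omega>) / s \<le> p (s' *\<^sub>R \<omega>) / s'"
    if "0 < s" "s \<le> s'" "\<And>t. s \<le> t \<Longrightarrow> t \<le> s' \<Longrightarrow> 0 \<le> E (t *\<^sub>R \<omega>)" for s s' \<omega>
  proof (rule DERIV_nonneg_imp_nondecreasing[OF that(2)])
    fix t assume t: "s \<le> t" "t \<le> s'"
    have "((\<lambda>t. p (t *\<^sub>R \<omega>) / t) has_real_derivative E (t *\<^sub>R \<omega>) / t\<^sup>2) (at t)"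
      using t that(1) by (auto intro!: derivative_eq_intros ray simp: E_def power2_eq_square)
    thus "\<exists>y. ((\<lambda>t. p (t *\<^sub>R \<omega>) / t) has_real_derivative y) (at t) \<and> 0 \<le> y"
      using that(3)[OF t] by (intro exI[of _ "E (t *\<^sub>R \<omega>) / t\<^sup>2"]) auto
  qed
  have reflect: "p y \<le> \<rho>\<^sup>2 * q ((1 / \<rho>\<^sup>2) *\<^sub>R y)"
    if "0 < norm y" "norm y \<le> \<rho>" "\<And>z. norm y \<le> norm z \<Longrightarrow> norm z \<le> \<rho>\<^sup>2 / norm y \<Longrightarrow> 0 \<le> E z" for y \<rho>
  proof -
    define s where "s = norm y"
    define s' where "s' = \<rho>\<^sup>2 / s"
    define \<omega> where "\<omega> = (1 / s) *\<^sub>R y"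
    have s: "0 < s" "s \<le> \<rho>" using that(1,2) by (auto simp: s_def)
    moreover have "0 < \<rho>\<^sup>2" using s by simp
    ultimately have s': "0 < s'" "s * s' = \<rho>\<^sup>2" by (auto simp: s'_def intro: divide_pos_pos)
    have "s * s \<le> \<rho>\<^sup>2" using s by (simp add: power2_eq_square mult_mono)
    hence "s \<le> s'" using s(1) by (simp add: s'_def pos_le_divide_eq)
    note s = s s' this
    have \<omega>: "norm \<omega> = 1" "y = s *\<^sub>R \<omega>" using s(1) by (auto simp: \<omega>_def s_def)
    have "p (s *\<^sub>R \<omega>) / s \<le> p (s' *\<^sub>R \<omega>) / s'"
      using s \<omega>(1) by (intro radial_mono that(3)) (auto simp: s_def[symmetric] s'_def[symmetric])
    also have "p (s' *\<^sub>R \<omega>) = s'\<^sup>2 * q ((1 / s') *\<^sub>R \<omega>)"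
    proof -
      have "s' *\<^sub>R \<omega> \<noteq> 0" using s \<omega>(1) by auto
      moreover have "(s' *\<^sub>R \<omega>) \<bullet> (s' *\<^sub>R \<omega>) = s'\<^sup>2" using \<omega>(1) by (simp add: dot_square_norm power2_eq_square)
      ultimately show ?thesis using kelvin[of "s' *\<^sub>R \<omega>"] s(3) by (simp add: power2_eq_square)
    qed
    also have "(1 / s') *\<^sub>R \<omega> = (1 / \<rho>\<^sup>2) *\<^sub>R y"
      using s by (simp add: \<omega>(2) s(4)[symmetric])
    finally have "p (s *\<^sub>R \<omega>) \<le> s * (s' * q ((1 / \<rho>\<^sup>2) *\<^sub>R y))"
      using s by (simp add: power2_eq_square pos_divide_le_eq mult.commute)
    thus ?thesis using \<omega>(2) s(4) by (simp add: mult.assoc[symmetric])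
  qed
  \<comment> \<open>Far out E is nonnegative because q is positive at 0; the bounded part of the ball is settled by the growth of the factor in front of q.\<close>
  have start: "\<exists>\<rho>0>0. \<forall>\<rho>\<ge>\<rho>0. P \<rho>"
  proof -
    have "\<forall>\<^sub>F x in nhds 0. - (q x - gq x \<bullet> x) < 0 \<and> - q x < - (q 0 / 2)"
      by (intro eventually_conj eventually_nhds_less continuous_intros dq) (use q_pos[of 0] in auto)
    then obtain d where d: "d > 0" "\<And>x. norm x < d \<Longrightarrow> 0 < q x - gq x \<bullet> x \<and> q 0 / 2 < q x"
      unfolding eventually_nhds_metric by auto
    define T where "T = 2 / d"
    have T: "T > 0" using d by (simp add: T_def)
    have E_far: "0 \<le> E z" if "T \<le> norm z" for z
    proof -
      have z: "z \<noteq> 0" using that T by auto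
      define x where "x = (1 / (z \<bullet> z)) *\<^sub>R z"
      have "norm x = 1 / norm z" using z by (simp add: x_def dot_square_norm power2_eq_square)
      also have "\<dots> \<le> 1 / T" using that T z by (intro divide_left_mono) auto
      also have "\<dots> < d" using d by (simp add: T_def)
      finally show ?thesis using E_kelvin[OF z x_def] d(2)[of x] by simp
    qed
    have "compact (cball (0::real^'n) T)" "cball (0::real^'n) T \<noteq> {}" using T by auto
    from continuous_attains_sup[OF this continuous_on_subset[OF dp(3)]]
    obtain ym where "\<forall>y\<in>cball 0 T. p y \<le> p ym" by blast
    hence ym: "p y \<le> p ym" if "norm y \<le> T" for y using that by simp
    define \<rho>0 where "\<rho>0 = 1 + T + T / d + 2 * p ym / q 0"
    have \<rho>0: "1 \<le> \<rho>0" "T \<le> \<rho>0" "T / d < \<rho>0" "2 * p ym / q 0 \<le> \<rho>0"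
      unfolding \<rho>0_def using T d(1) p_pos[of ym] q_pos[of 0] by (auto intro: add_pos_nonneg add_nonneg_nonneg)
    have "P \<rho>" if "\<rho> \<ge> \<rho>0" for \<rho>
      unfolding P_def
    proof (intro allI impI)
      fix y :: "real^'n" assume y: "norm y \<le> \<rho>"
      show "p y \<le> \<rho>\<^sup>2 * q ((1 / \<rho>\<^sup>2) *\<^sub>R y)"
      proof (cases "T \<le> norm y")
        case True
        thus ?thesis using y T E_far by (intro reflect) auto
      next
        case False
        have \<rho>2: "\<rho> \<le> \<rho>\<^sup>2" "0 < \<rho>" using that \<rho>0(1) self_le_power[of \<rho> 2] by auto
        have "norm ((1 / \<rho>\<^sup>2) *\<^sub>R y) < d"
        proof -
          have "norm y < d * \<rho>\<^sup>2"
            using False \<rho>0(3) that \<rho>2 d(1) by (smt (verit) mult.commute pos_divide_less_eq mult_left_mono)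
          thus ?thesis using \<rho>2 by (simp add: pos_divide_less_eq)
        qed
        hence "q 0 / 2 < q ((1 / \<rho>\<^sup>2) *\<^sub>R y)" using d(2) by blast
        hence "\<rho>\<^sup>2 * (q 0 / 2) \<le> \<rho>\<^sup>2 * q ((1 / \<rho>\<^sup>2) *\<^sub>R y)" using \<rho>2 by (intro mult_left_mono) auto
        moreover have "2 * p ym / q 0 \<le> \<rho>\<^sup>2" using \<rho>0(4) that \<rho>2 by linarith
        hence "p ym \<le> \<rho>\<^sup>2 * (q 0 / 2)" using q_pos[of 0] by (simp add: pos_divide_le_eq)
        moreover have "p y \<le> p ym" using False by (intro ym) auto
        ultimately show ?thesis by linarith
      qed
    qed
    thus ?thesis using \<rho>0(1) by (intro exI[of _ \<rho>0]) auto
  qed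
  \<comment> \<open>The radii down to which the comparison persists. At the centre of the ball the comparison forces the radius to stay away from 0.\<close>
  define A where "A = {\<rho>. 0 < \<rho> \<and> (\<forall>\<rho>'\<ge>\<rho>. P \<rho>')}"
  have A_low: "sqrt (p 0 / q 0) \<le> \<rho>" if "\<rho> \<in> A" for \<rho>
  proof -
    have "\<rho> > 0" "P \<rho>" using that by (auto simp: A_def)
    moreover have "norm (0::real^'n) \<le> \<rho>" using \<open>\<rho> > 0\<close> by simp
    ultimately have "p 0 \<le> \<rho>\<^sup>2 * q ((1 / \<rho>\<^sup>2) *\<^sub>R 0)" unfolding P_def by blast
    hence "p 0 \<le> \<rho>\<^sup>2 * q 0" by simp
    hence "p 0 / q 0 \<le> \<rho>\<^sup>2" using q_pos[of 0] by (simp add: pos_divide_le_eq)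
    thus ?thesis using \<open>\<rho> > 0\<close> by (simp add: real_le_lsqrt)
  qed
  have "A \<noteq> {}" using start by (auto simp: A_def)
  have bdd: "bdd_below A" using A_low by (auto simp: bdd_below_def)
  define r where "r = Inf A"
  have "sqrt (p 0 / q 0) \<le> r" unfolding r_def by (rule cInf_greatest[OF \<open>A \<noteq> {}\<close> A_low])
  moreover have "0 < sqrt (p 0 / q 0)" using p_pos[of 0] q_pos[of 0] by simp
  ultimately have r: "r > 0" by linarith
  have above: "P \<rho>" if "\<rho> > r" for \<rho>
  proof -
    have "Inf A < \<rho>" using that by (simp add: r_def)
    then obtain a where "a \<in> A" "a < \<rho>" using cInf_lessD[OF \<open>A \<noteq> {}\<close>] by blast
    thus ?thesis by (auto simp: A_def)
  qed
  have Pr: "P r" unfolding P_def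
  proof (intro allI impI)
    fix y :: "real^'n" assume y: "norm y \<le> r"
    have "continuous_on {0<..} (\<lambda>\<rho>::real. \<rho>\<^sup>2 * q ((1 / \<rho>\<^sup>2) *\<^sub>R y))"
      by (intro continuous_intros q_compose) auto
    hence "isCont (\<lambda>\<rho>::real. \<rho>\<^sup>2 * q ((1 / \<rho>\<^sup>2) *\<^sub>R y)) r"
      using r by (simp add: continuous_on_eq_continuous_at)
    hence "((\<lambda>\<rho>::real. \<rho>\<^sup>2 * q ((1 / \<rho>\<^sup>2) *\<^sub>R y)) \<longlongrightarrow> r\<^sup>2 * q ((1 / r\<^sup>2) *\<^sub>R y)) (at_right r)"
      unfolding isCont_def by (rule filterlim_mono) (auto simp: at_le)
    moreover have "\<forall>\<^sub>F \<rho> in at_right r. p y \<le> \<rho>\<^sup>2 * q ((1 / \<rho>\<^sup>2) *\<^sub>R y)"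
      using eventually_at_right_less[of r]
    proof eventually_elim
      case (elim \<rho>)
      thus ?case using above[OF elim] y by (auto simp: P_def)
    qed
    ultimately show "p y \<le> r\<^sup>2 * q ((1 / r\<^sup>2) *\<^sub>R y)"
      by (intro tendsto_lowerbound) auto
  qed
  define k where "k = 1 / r\<^sup>2"
  have k: "k > 0" "r\<^sup>2 * k = 1" using r by (auto simp: k_def)
  define qr where "qr y = r\<^sup>2 * q (k *\<^sub>R y)" for y
  have hqr: "has_hessian qr (\<lambda>y. gq (k *\<^sub>R y)) (\<lambda>y. k *\<^sub>R Hq (k *\<^sub>R y))"
    using has_hessian_cmult[OF has_hessian_dilation[OF hq, of k], of "r\<^sup>2"] k
    unfolding qr_def[abs_def] by (simp add: mult.assoc[symmetric])
  have sf: "schouten_form (qr y) (gq (k *\<^sub>R y)) (k *\<^sub>R Hq (k *\<^sub>R y)) =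
      schouten_form (q (k *\<^sub>R y)) (gq (k *\<^sub>R y)) (Hq (k *\<^sub>R y))" for y
    using k by (simp add: schouten_form_def qr_def mult_ac)
  have eqr: "spectral_le (schouten_form (qr y) (gq (k *\<^sub>R y)) (k *\<^sub>R Hq (k *\<^sub>R y)))
      (schouten_form (p y) (gp y) (Hp y))" if "norm y \<le> r" for y
    using eq[OF r that, folded k_def] unfolding sf .
  have "(\<forall>y\<in>ball 0 r. p y = qr y) \<or> (\<forall>y\<in>ball 0 r. p y < qr y)"
    by (rule strong_maximum_principle[OF hp hqr p_pos])
      (use Pr eqr in \<open>auto simp: P_def qr_def k_def\<close>)
  moreover have False if strict: "\<forall>y\<in>ball 0 r. p y < qr y"
  proof -
    \<comment> \<open>The inner normal derivative of the difference of the two functions equals 2 E / r, so this is the Hopf lemma on the critical ball itself.\<close>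
    have E_sphere: "E z > 0" if z: "norm z = r" for z
    proof -
      have zz: "z \<bullet> z = r\<^sup>2" using z by (simp add: dot_square_norm)
      have "z \<noteq> 0" using z r by auto
      have pz: "p z = qr z" using kelvin[OF \<open>z \<noteq> 0\<close>] by (simp add: zz qr_def k_def)
      obtain l0 where "l0 \<in> \<Gamma>" "ordered_spectrum (schouten_form (qr z) (gq (k *\<^sub>R z)) (k *\<^sub>R Hq (k *\<^sub>R z))) l0"
        using eqr[of z] z unfolding spectral_le_def by auto
      hence "0 < (gq (k *\<^sub>R z) - gp z) \<bullet> (0 - z)"
        using strict z eqr pz by (intro hopf_boundary_point[OF hp hqr p_pos r, of 0]) auto
      moreover have "E z = p z - gq (k *\<^sub>R z) \<bullet> z"
        using E_kelvin[OF \<open>z \<noteq> 0\<close> refl] pz k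
        by (simp add: zz k_def[symmetric] qr_def right_diff_distrib mult.assoc[symmetric])
      ultimately show ?thesis by (simp add: E_def inner_diff_left)
    qed
    obtain \<delta> where \<delta>: "0 < \<delta>" "\<delta> < r" "\<And>y. \<bar>norm y - r\<bar> < \<delta> \<Longrightarrow> 0 < E y"
    proof (cases "cball 0 (2 * r) \<inter> {y. E y \<le> 0} = {}")
      case True
      show thesis
      proof (rule that[of "r / 2"])
        fix y :: "real^'n" assume "\<bar>norm y - r\<bar> < r / 2"
        hence "norm y \<le> 2 * r" using r abs_ge_self[of "norm y - r"] by linarith
        hence "y \<in> cball 0 (2 * r)" by simp
        thus "0 < E y" using True by fastforce
      qed (use r in auto)
    next
      case False
      have "compact (cball 0 (2 * r) \<inter> {y. E y \<le> 0})"
        by (intro compact_Int_closed compact_cball closed_Collect_le contE continuous_on_const)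
      moreover have "continuous_on S (\<lambda>y::real^'n. \<bar>norm y - r\<bar>)" for S by (intro continuous_intros)
      ultimately obtain y1 where y1: "y1 \<in> cball 0 (2 * r) \<inter> {y. E y \<le> 0}"
        and inf: "\<forall>y\<in>cball 0 (2 * r) \<inter> {y. E y \<le> 0}. \<bar>norm y1 - r\<bar> \<le> \<bar>norm y - r\<bar>"
        using continuous_attains_inf[OF _ False] by blast
      have min: "\<bar>norm y1 - r\<bar> \<le> \<bar>norm y - r\<bar>" if "norm y \<le> 2 * r" "E y \<le> 0" for y
        using inf that by simp
      have "\<bar>norm y1 - r\<bar> > 0" using E_sphere[of y1] y1 by auto
      show thesis
      proof (rule that[of "min \<bar>norm y1 - r\<bar> (r / 2)"])
        fix y :: "real^'n" assume "\<bar>norm y - r\<bar> < min \<bar>norm y1 - r\<bar> (r / 2)"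
        moreover from this have "norm y \<le> 2 * r" using r abs_ge_self[of "norm y - r"] by linarith
        ultimately show "0 < E y" using min[of y] by (cases "E y \<le> 0") auto
      qed (use r \<open>\<bar>norm y1 - r\<bar> > 0\<close> in auto)
    qed
    \<comment> \<open>Reflection in a sphere of radius at most r maps the shell b <= |y| into the region where E is positive, since r^2 / b < r + delta.\<close>
    define b where "b = r - \<delta> / 2"
    have b: "0 < b" "b < r" using \<delta> by (auto simp: b_def)
    have outer_region: "p y \<le> \<rho>\<^sup>2 * q ((1 / \<rho>\<^sup>2) *\<^sub>R y)"
      if "b \<le> norm y" "norm y \<le> \<rho>" "\<rho> \<le> r" for y \<rho>
    proof (rule reflect)
      show "0 < norm y" using that b by linarith
      show "norm y \<le> \<rho>" by fact
      fix z :: "real^'n" assume z: "norm y \<le> norm z" "norm z \<le> \<rho>\<^sup>2 / norm y"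
      have "\<rho>\<^sup>2 / norm y \<le> r\<^sup>2 / b"
        using that b by (intro frac_le power_mono) auto
      also have "\<dots> < r + \<delta>"
      proof -
        have "(r + \<delta>) * b = r\<^sup>2 + \<delta> * (r - \<delta>) / 2"
          by (simp add: b_def power2_eq_square field_simps)
        moreover have "\<delta> * (r - \<delta>) > 0" using \<delta> by simp
        ultimately show ?thesis using b by (simp add: pos_divide_less_eq)
      qed
      finally have "\<bar>norm z - r\<bar> < \<delta>" using z that(1) \<delta> by (auto simp: b_def)
      thus "0 \<le> E z" using \<delta>(3) by (simp add: less_imp_le)
    qed
    \<comment> \<open>On the inner ball the inequality is strict at the critical radius, and compactness extends it to slightly smaller radii.\<close>
    define F where "F x = (fst x)\<^sup>2 * q ((1 / (fst x)\<^sup>2) *\<^sub>R snd x) - p (snd x)" for x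
    define C where "C = {b..r} \<times> cball (0::real^'n) b"
    have "compact C" unfolding C_def by (intro compact_Times) auto
    have "continuous_on C F"
      unfolding F_def by (intro continuous_intros q_compose p_compose) (use b in \<open>auto simp: C_def\<close>)
    hence "closed (C \<inter> F -` {..0})"
      using \<open>compact C\<close> by (intro continuous_closed_preimage) (auto simp: compact_imp_closed)
    hence K: "compact (C \<inter> F -` {..0})"
      using compact_Int_closed[OF \<open>compact C\<close>, of "C \<inter> F -` {..0}"] by simp
    obtain \<rho>1 where \<rho>1: "\<rho>1 < r" "b \<le> \<rho>1" "\<And>\<rho> y. \<rho>1 < \<rho> \<Longrightarrow> \<rho> \<le> r \<Longrightarrow> norm y \<le> b \<Longrightarrow> 0 < F (\<rho>, y)"
    proof (cases "C \<inter> F -` {..0} = {}")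
      case True
      show thesis
      proof (rule that[of b])
        fix \<rho> and y :: "real^'n" assume "b < \<rho>" "\<rho> \<le> r" "norm y \<le> b"
        hence "(\<rho>, y) \<in> C" by (simp add: C_def)
        thus "0 < F (\<rho>, y)" using True by (meson disjoint_iff vimageI atMost_iff not_le)
      qed (use b in auto)
    next
      case False
      obtain x where x: "x \<in> C \<inter> F -` {..0}" and sup: "\<forall>x'\<in>C \<inter> F -` {..0}. fst x' \<le> fst x"
        using continuous_attains_sup[OF K False continuous_on_fst[OF continuous_on_id]] by blast
      have max: "fst x' \<le> fst x" if "x' \<in> C" "F x' \<le> 0" for x' using sup that by simp
      have x: "x \<in> C" "F x \<le> 0" using x by auto
      have "fst x \<noteq> r"
      proof
        assume "fst x = r"
        hence "F x = qr (snd x) - p (snd x)" by (simp add: F_def qr_def k_def)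
        moreover have "snd x \<in> ball 0 r" using x(1) b by (auto simp: C_def)
        ultimately show False using x(2) strict by force
      qed
      show thesis
      proof (rule that[of "fst x"])
        show "fst x < r" "b \<le> fst x" using x(1) \<open>fst x \<noteq> r\<close> by (auto simp: C_def)
        fix \<rho> and y :: "real^'n" assume "fst x < \<rho>" "\<rho> \<le> r" "norm y \<le> b"
        moreover have "b \<le> fst x" using x(1) by (auto simp: C_def)
        ultimately have "(\<rho>, y) \<in> C" by (auto simp: C_def)
        thus "0 < F (\<rho>, y)" using max[of "(\<rho>, y)"] \<open>fst x < \<rho>\<close> by fastforce
      qed
    qed
    define \<rho>2 where "\<rho>2 = (\<rho>1 + r) / 2"
    have \<rho>2: "\<rho>1 < \<rho>2" "\<rho>2 < r" "0 < \<rho>2" using \<rho>1 b by (auto simp: \<rho>2_def)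
    have "P \<rho>" if "\<rho> \<ge> \<rho>2" for \<rho>
    proof (cases "\<rho> > r")
      case True thus ?thesis by (rule above)
    next
      case False
      show ?thesis unfolding P_def
      proof (intro allI impI)
        fix y :: "real^'n" assume y: "norm y \<le> \<rho>"
        show "p y \<le> \<rho>\<^sup>2 * q ((1 / \<rho>\<^sup>2) *\<^sub>R y)"
        proof (cases "norm y \<le> b")
          case True
          thus ?thesis using \<rho>1(3)[of \<rho> y] False that \<rho>2 by (simp add: F_def)
        next
          case outside: False
          thus ?thesis using outer_region[of y \<rho>] y False by simp
        qed
      qed
    qed
    hence "\<rho>2 \<in> A" using \<rho>2 by (simp add: A_def)
    hence "r \<le> \<rho>2" unfolding r_def using bdd by (rule cInf_lower)
    thus False using \<rho>2 by simp
  qed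
  ultimately show ?thesis using r unfolding qr_def k_def by blast
qed

end

section \<open>Conformal metrics on the sphere in stereographic coordinates\<close>

text \<open>The factor \<open>w\<close> for which \<open>w\<^sup>-\<^sup>2 I\<close> is the metric conformal to the round one by the power \<open>4/(n-2)\<close> of \<open>v\<close>, in the chart \<open>stereo e\<close>.\<close>
definition conformal_weight :: "((real^'n) \<times> real \<Rightarrow> real) \<Rightarrow> real \<Rightarrow> real^'n \<Rightarrow> real" where
  "conformal_weight v e x = (1 + x \<bullet> x) / 2 * v (stereo e x) powr (- 2 / (real CARD('n) - 2))"

lemma stereo_eq: "stereo e x = ((2 / (1 + x \<bullet> x)) *\<^sub>R x, e * (1 - 2 / (1 + x \<bullet> x)))"
proof -
  have "1 + x \<bullet> x > 0" by (simp add: add_pos_nonneg)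
  thus ?thesis unfolding stereo_def power2_norm_eq_inner by (simp add: field_simps)
qed

lemma stereo_in_sphere:
  assumes "e * e = 1" shows "stereo e x \<in> sphere 0 1"
proof -
  define s where "s = x \<bullet> x"
  have s: "1 + s > 0" by (simp add: s_def add_pos_nonneg)
  have "stereo e x \<bullet> stereo e x = (2 / (1 + s))\<^sup>2 * s + (e * e) * (1 - 2 / (1 + s))\<^sup>2"
    by (simp add: stereo_eq s_def[symmetric] power2_eq_square)
  also have "\<dots> = 1"
  proof -
    have ne: "1 + s \<noteq> 0" using s by simp
    have "t\<^sup>2 * s + 1 * (1 - t)\<^sup>2 = 1" if "t = 2 / (1 + s)" for t
    proof -
      have "t * (1 + s) = 2" using that unfolding nonzero_eq_divide_eq[OF ne] .
      hence "t * s = 2 - t" by (simp add: distrib_left)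
      hence "t\<^sup>2 * s = t * (2 - t)" by (simp add: power2_eq_square mult.assoc)
      thus ?thesis by (simp add: power2_eq_square algebra_simps)
    qed
    thus ?thesis unfolding assms by blast
  qed
  finally show ?thesis by (simp add: norm_eq_sqrt_inner)
qed

lemma stereo_inversion:
  assumes "y \<noteq> 0" shows "stereo (-1) y = stereo 1 ((1 / (y \<bullet> y)) *\<^sub>R y)"
proof -
  define s where "s = y \<bullet> y"
  have s: "s > 0" using assms by (simp add: s_def)
  have "2 / (1 + 1 / s) * (1 / s) = 2 / (1 + s)" "- (1 - 2 / (1 + s)) = 1 - 2 / (1 + 1 / s)"
    using s by (simp_all add: field_simps)
  thus ?thesis by (simp add: stereo_eq s_def[symmetric])
qed

text \<open>The transition between the two charts is the inversion \<open>y \<mapsto> y/|y|\<^sup>2\<close>, whose conformal factor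
  is \<open>|y|\<^sup>-\<^sup>2\<close>.\<close>
lemma conformal_weight_kelvin:
  assumes "y \<noteq> 0"
  shows "conformal_weight v (-1) y = (y \<bullet> y) * conformal_weight v 1 ((1 / (y \<bullet> y)) *\<^sub>R y)"
proof -
  define s where "s = y \<bullet> y"
  have s: "s > 0" using assms by (simp add: s_def)
  have "(1 + s) / 2 * t = s * ((1 + 1 / s) / 2 * t)" for t using s by (simp add: field_simps)
  moreover have "((1 / s) *\<^sub>R y) \<bullet> ((1 / s) *\<^sub>R y) = 1 / s" using s by (simp add: s_def[symmetric])
  ultimately show ?thesis
    unfolding conformal_weight_def stereo_inversion[OF assms] s_def[symmetric] by simp
qed

lemma stereo_partial:
  "partial i (stereo e) x =
     ((- (2 / (1 + x \<bullet> x))\<^sup>2 * x $ i) *\<^sub>R x + (2 / (1 + x \<bullet> x)) *\<^sub>R axis i 1, e * ((2 / (1 + x \<bullet> x))\<^sup>2 * x $ i))"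
proof -
  have nz: "1 + x \<bullet> x \<noteq> 0" using inner_ge_zero[of x] by linarith
  have s: "((\<lambda>y. 2 / (1 + y \<bullet> y)) has_derivative (\<lambda>h. - (2 / (1 + x \<bullet> x))\<^sup>2 * (x \<bullet> h))) (at x)"
    using nz by (auto intro!: derivative_eq_intros simp: inner_commute field_simps power2_eq_square)
  have "(stereo e has_derivative (\<lambda>h. ((2 / (1 + x \<bullet> x)) *\<^sub>R h + (- (2 / (1 + x \<bullet> x))\<^sup>2 * (x \<bullet> h)) *\<^sub>R x,
      e * (0 - - (2 / (1 + x \<bullet> x))\<^sup>2 * (x \<bullet> h))))) (at x)"
    unfolding stereo_eq[abs_def]
    by (intro has_derivative_Pair has_derivative_scaleR has_derivative_mult_right has_derivative_diff
        has_derivative_const has_derivative_ident s)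
  thus ?thesis by (simp add: partial_has_derivative inner_axis add.commute)
qed

lemma stereo_conformal:
  assumes "e * e = 1"
  shows "partial i (stereo e) x \<bullet> partial j (stereo e) x = (2 / (1 + x \<bullet> x))\<^sup>2 * kronecker i j"
proof -
  define s where "s = 2 / (1 + x \<bullet> x)"
  have ne: "1 + x \<bullet> x \<noteq> 0" using inner_ge_zero[of x] by linarith
  have "s * (1 + x \<bullet> x) = 2" using s_def unfolding nonzero_eq_divide_eq[OF ne] .
  hence s: "s * (x \<bullet> x) = 2 - s" by (simp add: distrib_left)
  have k: "(axis a 1 :: real^'a) $ b = kronecker a b" for a b by (simp add: axis_def kronecker_def)
  have "partial i (stereo e) x \<bullet> partial j (stereo e) x =
      s^3 * (x $ i * x $ j) * (s * (x \<bullet> x)) - 2 * s^3 * (x $ i * x $ j) + s\<^sup>2 * kronecker i j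
      + (e * e) * s^4 * (x $ i * x $ j)"
    unfolding stereo_partial s_def[symmetric]
    by (simp add: inner_add_left inner_add_right inner_axis inner_axis' k power2_eq_square
        power3_eq_cube power4_eq_xxxx algebra_simps)
  also have "\<dots> = s\<^sup>2 * kronecker i j"
    unfolding s assms by (simp add: power2_eq_square power3_eq_cube power4_eq_xxxx algebra_simps)
  finally show ?thesis by (simp add: s_def)
qed

lemma conformal_metric_in_coords:
  fixes v :: "(real^'n) \<times> real \<Rightarrow> real"
  assumes e: "e * e = 1" and n: "CARD('n) \<ge> 3" and v: "\<And>x. 0 < v (stereo e x)"
  shows "metric_in_coords (conformal_metric v) (stereo e) =
    (\<lambda>x. (1 / (conformal_weight v e x)\<^sup>2) *\<^sub>R mat 1)"
proof
  fix x :: "real^'n"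
  define a where "a = 2 / (real CARD('n) - 2)"
  define t where "t = 1 + x \<bullet> x"
  have t: "t > 0" unfolding t_def by (simp add: add_pos_nonneg)
  have "v (stereo e x) powr (4 / (real CARD('n) - 2)) = (v (stereo e x) powr a)\<^sup>2"
    unfolding power2_eq_square powr_add[symmetric] by (simp add: a_def)
  moreover have "conformal_weight v e x = t / 2 / (v (stereo e x) powr a)"
    by (simp add: conformal_weight_def t_def a_def powr_minus_divide)
  ultimately have "v (stereo e x) powr (4 / (real CARD('n) - 2)) * (2 / t)\<^sup>2 = 1 / (conformal_weight v e x)\<^sup>2"
    using t v[of x] by (simp add: power_divide power_mult_distrib)
  thus "metric_in_coords (conformal_metric v) (stereo e) x = (1 / (conformal_weight v e x)\<^sup>2) *\<^sub>R mat 1"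
    by (simp add: metric_in_coords_def conformal_metric_def round_metric_def stereo_conformal[OF e]
        vec_eq_iff mat_1_kronecker t_def mult.assoc[symmetric])
qed

lemma conformal_weight_pos: "0 < v (stereo e x) \<Longrightarrow> 0 < conformal_weight v e x"
  unfolding conformal_weight_def by (simp add: add_pos_nonneg)

lemma conformal_weight_has_hessian:
  fixes v :: "(real^'n) \<times> real \<Rightarrow> real"
  assumes "C2_on UNIV (v \<circ> stereo e)" and v: "\<And>x. 0 < v (stereo e x)"
  obtains g H where "has_hessian (conformal_weight v e) g H"
proof -
  obtain g H where u: "has_hessian (v \<circ> stereo e) g H" by (rule C2_on_has_hessian[OF assms(1)])
  define c where "c = - 2 / (real CARD('n) - 2)"
  have cu: "continuous_on UNIV (\<lambda>x. v (stereo e x))"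
    using has_hessianD(3)[OF u] by (simp add: o_def)
  have 1: "has_hessian (\<lambda>x. (v \<circ> stereo e) x powr c) (\<lambda>x. (c * (v \<circ> stereo e) x powr (c - 1)) *\<^sub>R g x)
    (\<lambda>x. (c * (v \<circ> stereo e) x powr (c - 1)) *\<^sub>R H x
      + (c * ((c - 1) * (v \<circ> stereo e) x powr (c - 1 - 1))) *\<^sub>R outer (g x) (g x))"
    by (rule has_hessian_compose_real[OF u, where \<psi> = "\<lambda>s. s powr c"
        and \<psi>' = "\<lambda>s. c * s powr (c - 1)" and \<psi>'' = "\<lambda>s. c * ((c - 1) * s powr (c - 1 - 1))"])
      (use v in \<open>auto intro!: derivative_eq_intros continuous_intros cu less_imp_neq[symmetric]
        simp: less_imp_neq[symmetric]\<close>)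
  have 2: "has_hessian (\<lambda>x. 1 / 2 * (1 + (x - 0) \<bullet> (x - 0))) (\<lambda>x. (1 / 2) *\<^sub>R (0 + 2 *\<^sub>R (x - 0)))
      (\<lambda>x. (1 / 2) *\<^sub>R (0 + 2 *\<^sub>R mat 1 :: real^'n^'n))"
    by (intro has_hessian_cmult has_hessian_add has_hessian_const has_hessian_norm_square)
  have weight: "conformal_weight v e = (\<lambda>x. 1 / 2 * (1 + (x - 0) \<bullet> (x - 0)) * (v \<circ> stereo e) x powr c)"
    by (simp add: fun_eq_iff conformal_weight_def c_def)
  from has_hessian_mult[OF 2 1] show thesis unfolding weight[symmetric] by (rule that)
qed

text \<open>The metric and its Schouten tensor carry the same factor \<open>w\<^sup>-\<^sup>2\<close>, which cancels from the
  eigenvalue equation.\<close>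
lemma schouten_eigenvalues_ordered_spectrum:
  fixes v :: "(real^'n) \<times> real \<Rightarrow> real"
  assumes e: "e = 1 \<or> e = -1" and n: "CARD('n) \<ge> 3" and v: "\<And>x. 0 < v (stereo e x)"
    and h: "has_hessian (conformal_weight v e) g H"
    and l: "schouten_eigenvalues (conformal_metric v) (stereo e x) l"
  shows "\<exists>\<sigma>. bij \<sigma> \<and>
    ordered_spectrum (schouten_form (conformal_weight v e x) (g x) (H x)) (permute \<sigma> l)"
proof (rule eigenvalues_ordered_spectrum)
  let ?w = "conformal_weight v e" and ?S = "schouten_form (conformal_weight v e x) (g x) (H x)"
  have ee: "e * e = 1" using e by auto
  show "transpose ?S = ?S"
    by (rule schouten_form_symmetric[OF has_hessian_symmetric[OF h]])
  have w: "0 < ?w y" for y by (rule conformal_weight_pos[where v = v and e = e, OF v])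
  define c where "c = 1 / (?w x)\<^sup>2"
  have c: "c \<noteq> 0" using w[of x] by (simp add: c_def)
  have "stereo e \<in> sphere_params" using e by (auto simp: sphere_params_def)
  hence "eigenvalues_wrt (metric_in_coords (conformal_metric v) (stereo e) x)
      (schouten (metric_in_coords (conformal_metric v) (stereo e)) x) l"
    using l unfolding schouten_eigenvalues_def by blast
  hence "eigenvalues_wrt (c *\<^sub>R mat 1) (c *\<^sub>R ?S) l"
    unfolding conformal_metric_in_coords[where v = v and e = e, OF ee n v] schouten_conformally_flat[OF n h w]
    by (simp add: c_def)
  moreover have "(c *\<^sub>R ?S) *v X = \<mu> *\<^sub>R ((c *\<^sub>R mat 1) *v X) \<longleftrightarrow> ?S *v X = \<mu> *\<^sub>R X" for X \<mu>
  proof -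
    have scale: "(c *\<^sub>R ?S) *v X = c *\<^sub>R (?S *v X)" "\<mu> *\<^sub>R ((c *\<^sub>R mat 1) *v X) = c *\<^sub>R (\<mu> *\<^sub>R X)"
      by (simp_all add: scaleR_matrix_vector_assoc[symmetric])
    show ?thesis unfolding scale scaleR_cancel_left using c by simp
  qed
  ultimately show "card {i. l $ i = \<mu>} = dim {X. ?S *v X = \<mu> *\<^sub>R X}" for \<mu>
    unfolding eigenvalues_wrt_def by simp
qed

section \<open>Meridians\<close>

lemma polar_eq_stereo:
  assumes "norm \<omega> = 1"
  shows "polar \<omega> (2 * arctan s) = stereo 1 (s *\<^sub>R \<omega>)"
proof -
  have pos: "1 + s\<^sup>2 > 0" by (simp add: add_pos_nonneg)
  have "sin (2 * arctan s) = 2 * s / (1 + s\<^sup>2)"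
    using pos by (simp add: sin_double sin_arctan cos_arctan power2_eq_square[symmetric] flip: real_sqrt_mult)
  moreover have "- cos (2 * arctan s) = 1 - 2 / (1 + s\<^sup>2)"
    using pos by (simp add: cos_double_cos cos_arctan power_divide)
  moreover have "(s *\<^sub>R \<omega>) \<bullet> (s *\<^sub>R \<omega>) = s\<^sup>2"
    using assms by (simp add: dot_square_norm power_mult_distrib)
  ultimately show ?thesis unfolding polar_def stereo_eq by simp
qed

text \<open>Smoothness of \<open>K\<close> is given in stereographic charts, its monotonicity in polar coordinates; the
  radii are related by \<open>s = tan (t/2)\<close>.\<close>
lemma polar_eq_stereo_tan:
  assumes "norm \<omega> = 1" "0 < t" "t < pi"
  shows "polar \<omega> t = stereo 1 (tan (t / 2) *\<^sub>R \<omega>)"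
proof -
  have "arctan (tan (t / 2)) = t / 2" using assms(2,3) by (intro arctan_tan) auto
  hence angle: "2 * arctan (tan (t / 2)) = t" by simp
  show ?thesis using polar_eq_stereo[OF assms(1), of "tan (t / 2)"] unfolding angle .
qed

lemma meridian_has_derivative:
  assumes "C1_sphere K" "norm \<omega> = 1" "0 < t" "t < pi"
  shows "((\<lambda>t. K (polar \<omega> t)) has_real_derivative meridian_deriv K \<omega> t) (at t)"
proof -
  have "C1_on UNIV (K \<circ> stereo 1)" using assms(1) by (simp add: C1_sphere_def sphere_params_def)
  then obtain g where g: "\<And>x. ((K \<circ> stereo 1) has_derivative (\<lambda>h. g x \<bullet> h)) (at x)"
    using C1_on_gradient by (metis UNIV_I)
  have cos: "cos (t / 2) \<noteq> 0" using assms(3,4) cos_gt_zero_pi[of "t / 2"] by simp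
  define d where "d = inverse ((cos (t / 2))\<^sup>2) * (1 / 2)"
  have d: "((\<lambda>t. tan (t / 2)) has_real_derivative d) (at t)"
    unfolding d_def by (rule DERIV_chain2[where f = tan and g = "\<lambda>t. t / 2", OF DERIV_tan[OF cos]]) (auto intro!: derivative_eq_intros)
  have "((\<lambda>t. tan (t / 2) *\<^sub>R \<omega>) has_derivative (\<lambda>h. (d * h) *\<^sub>R \<omega>)) (at t)"
    using has_derivative_scaleR_left[OF d[unfolded has_field_derivative_def], of \<omega>] .
  note composed = has_derivative_compose[OF this g]
  have "(\<lambda>h. g (tan (t / 2) *\<^sub>R \<omega>) \<bullet> ((d * h) *\<^sub>R \<omega>)) = (*) (d * (g (tan (t / 2) *\<^sub>R \<omega>) \<bullet> \<omega>))"
    by (simp add: fun_eq_iff mult_ac)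
  with composed have "((\<lambda>t. K (stereo 1 (tan (t / 2) *\<^sub>R \<omega>))) has_real_derivative d * (g (tan (t / 2) *\<^sub>R \<omega>) \<bullet> \<omega>)) (at t)"
    unfolding has_field_derivative_def o_def by simp
  hence "((\<lambda>t. K (polar \<omega> t)) has_real_derivative d * (g (tan (t / 2) *\<^sub>R \<omega>) \<bullet> \<omega>)) (at t)"
    by (rule has_field_derivative_transform_within_open[where S = "{0<..<pi}"])
      (use assms polar_eq_stereo_tan[OF assms(2)] in auto)
  thus ?thesis unfolding meridian_deriv_def using DERIV_imp_deriv by fastforce
qed

lemma nondecreasing_along_meridian:
  assumes "C1_sphere K" "norm \<omega> = 1" "\<And>t. 0 < t \<Longrightarrow> t < pi \<Longrightarrow> 0 \<le> meridian_deriv K \<omega> t"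
    and "0 < s" "s \<le> s'"
  shows "K (stereo 1 (s *\<^sub>R \<omega>)) \<le> K (stereo 1 (s' *\<^sub>R \<omega>))"
proof -
  have "K (polar \<omega> (2 * arctan s)) \<le> K (polar \<omega> (2 * arctan s'))"
  proof (rule DERIV_nonneg_imp_nondecreasing[where f = "\<lambda>t. K (polar \<omega> t)"])
    show "2 * arctan s \<le> 2 * arctan s'" using assms(5) by (simp add: arctan_monotone')
    fix t assume "2 * arctan s \<le> t" "t \<le> 2 * arctan s'"
    hence t: "0 < t" "t < pi"
      using assms(4) zero_less_arctan_iff[of s] arctan_ubound[of s'] by linarith+
    show "\<exists>y. ((\<lambda>t. K (polar \<omega> t)) has_real_derivative y) (at t) \<and> 0 \<le> y"
      using meridian_has_derivative[OF assms(1,2) t] assms(3)[OF t] by blast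
  qed
  thus ?thesis by (simp only: polar_eq_stereo[OF assms(2)])
qed

section \<open>Nonexistence\<close>

theorem theorem1p9:
  fixes \<Gamma> :: "(real^'n) set"
    and f :: "real^'n \<Rightarrow> real"
    and K :: "(real^'n) \<times> real \<Rightarrow> real"
  assumes "CARD('n) \<ge> 3"
    and "open_cone \<Gamma>" and "convex \<Gamma>" and "symmetric_set \<Gamma>"
    and "Gamma_n \<subseteq> \<Gamma>" and "\<Gamma> \<subseteq> Gamma_1"
    and "C1_on \<Gamma> f" and "symmetric_fun_on \<Gamma> f"
    and "\<forall>l\<in>\<Gamma>. f l > 0"
    and "\<forall>l\<in>\<Gamma>. \<forall>i. partial i f l > 0"
    and "C1_sphere K" and "\<forall>\<theta>\<in>sphere 0 1. K \<theta> > 0"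
    and "\<forall>\<omega>\<in>sphere 0 1. \<forall>r\<in>{0<..<pi}. meridian_deriv K \<omega> r \<ge> 0"
    and "\<exists>\<omega>\<in>sphere 0 1. \<exists>r\<in>{0<..<pi}. meridian_deriv K \<omega> r \<noteq> 0"
  shows "\<not> (\<exists>v :: (real^'n) \<times> real \<Rightarrow> real. C2_sphere v \<and>
            (\<forall>\<theta>\<in>sphere 0 1. v \<theta> > 0 \<and>
               (\<exists>l. schouten_eigenvalues (conformal_metric v) \<theta> l \<and> l \<in> \<Gamma> \<and> f l = K \<theta>)))"
proof
  assume "\<exists>v :: (real^'n) \<times> real \<Rightarrow> real. C2_sphere v \<and>
            (\<forall>\<theta>\<in>sphere 0 1. v \<theta> > 0 \<and>
               (\<exists>l. schouten_eigenvalues (conformal_metric v) \<theta> l \<and> l \<in> \<Gamma> \<and> f l = K \<theta>))"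
  then obtain v :: "(real^'n) \<times> real \<Rightarrow> real" where C2: "C2_sphere v"
    and v_sphere: "\<And>\<theta>. \<theta> \<in> sphere 0 1 \<Longrightarrow> v \<theta> > 0"
    and sol: "\<And>\<theta>. \<theta> \<in> sphere 0 1 \<Longrightarrow>
      \<exists>l. schouten_eigenvalues (conformal_metric v) \<theta> l \<and> l \<in> \<Gamma> \<and> f l = K \<theta>" by blast
  have n: "CARD('n) \<ge> 3" by fact
  have K_C1: "C1_sphere K" by fact
  obtain D where D: "\<And>x. x \<in> \<Gamma> \<Longrightarrow> (f has_derivative (\<lambda>h. D x \<bullet> h)) (at x)" "continuous_on \<Gamma> D"
    using C1_on_gradient[OF \<open>C1_on \<Gamma> f\<close>] by blast
  interpret elliptic_spectral_function \<Gamma> f D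
  proof
    show "open \<Gamma>" using \<open>open_cone \<Gamma>\<close> by (simp add: open_cone_def)
    fix x i assume x: "x \<in> \<Gamma>"
    have "partial i f x > 0" using x assms(10) by blast
    thus "0 < D x $ i" by (simp add: partial_has_derivative[OF D(1)[OF x]] inner_axis)
  qed (use D assms in auto)
  define p where "p = conformal_weight v (-1)"
  define q where "q = conformal_weight v 1"
  have sphere_e: "stereo e x \<in> sphere 0 1" if "e = 1 \<or> e = -1" for e and x :: "real^'n"
    using that by (intro stereo_in_sphere) auto
  have v_pos: "0 < v (stereo e x)" if "e = 1 \<or> e = -1" for e x
    using v_sphere[OF sphere_e[OF that]] .
  have C2e: "C2_on UNIV (v \<circ> stereo e)" if "e = 1 \<or> e = -1" for e
    using C2 that by (auto simp: C2_sphere_def sphere_params_def)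
  obtain gp Hp where hp: "has_hessian p gp Hp"
    unfolding p_def using conformal_weight_has_hessian[OF C2e v_pos, of "-1"] by auto
  obtain gq Hq where hq: "has_hessian q gq Hq"
    unfolding q_def using conformal_weight_has_hessian[OF C2e v_pos, of 1] by auto
  have pos: "0 < p x" "0 < q x" for x
    unfolding p_def q_def by (intro conformal_weight_pos v_pos; simp)+
  have spec: "\<exists>l\<in>\<Gamma>. ordered_spectrum (schouten_form (conformal_weight v e x) (g x) (H x)) l
      \<and> f l = K (stereo e x)"
    if e: "e = 1 \<or> e = -1" and h: "has_hessian (conformal_weight v e) g H" for e g H x
  proof -
    obtain l where l: "schouten_eigenvalues (conformal_metric v) (stereo e x) l" "l \<in> \<Gamma>"
      "f l = K (stereo e x)" using sol[OF sphere_e[OF e]] by blast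
    obtain \<sigma> where \<sigma>: "bij \<sigma>" "ordered_spectrum (schouten_form (conformal_weight v e x) (g x) (H x)) (permute \<sigma> l)"
      using schouten_eigenvalues_ordered_spectrum[OF e n v_pos[OF e] h l(1)] by blast
    have "permute \<sigma> l \<in> \<Gamma>" "f (permute \<sigma> l) = K (stereo e x)"
      using \<sigma>(1) l(2,3) \<open>symmetric_set \<Gamma>\<close> \<open>symmetric_fun_on \<Gamma> f\<close>
      by (auto simp: symmetric_set_def symmetric_fun_on_def)
    thus ?thesis using \<sigma>(2) by blast
  qed
  have spec_p: "\<exists>l\<in>\<Gamma>. ordered_spectrum (schouten_form (p y) (gp y) (Hp y)) l \<and> f l = K (stereo (-1) y)" for y
    using spec[of "-1"] hp unfolding p_def by blast
  have spec_q: "\<exists>l\<in>\<Gamma>. ordered_spectrum (schouten_form (q y) (gq y) (Hq y)) l \<and> f l = K (stereo 1 y)" for y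
    using spec[of 1] hq unfolding q_def by blast
  \<comment> \<open>Everything along meridians is expressed in the radius s of the chart centred at the south pole.\<close>
  have mono: "K (stereo 1 (s *\<^sub>R \<omega>)) \<le> K (stereo 1 (s' *\<^sub>R \<omega>))"
    if "norm \<omega> = 1" "0 < s" "s \<le> s'" for s s' \<omega>
    using nondecreasing_along_meridian[OF K_C1 that(1) _ that(2,3)] that(1) assms(13) by auto
  \<comment> \<open>The two points have chart radii |y| / rho^2 and 1 / |y|. At y = 0 they are the two poles, reached by continuity.\<close>
  have K_le: "K (stereo 1 ((1 / \<rho>\<^sup>2) *\<^sub>R y)) \<le> K (stereo (-1) y)" if \<rho>: "0 < \<rho>" and y: "norm y \<le> \<rho>" for \<rho> y
  proof -
    have nonzero: "K (stereo 1 ((1 / \<rho>\<^sup>2) *\<^sub>R z)) \<le> K (stereo (-1) z)" if z: "z \<noteq> 0" "norm z \<le> \<rho>" for z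
    proof -
      define \<omega> where "\<omega> = (1 / norm z) *\<^sub>R z"
      have \<omega>: "norm \<omega> = 1" "(1 / \<rho>\<^sup>2) *\<^sub>R z = (norm z / \<rho>\<^sup>2) *\<^sub>R \<omega>"
        "(1 / (z \<bullet> z)) *\<^sub>R z = (1 / norm z) *\<^sub>R \<omega>"
        using z by (auto simp: \<omega>_def dot_square_norm power2_eq_square)
      have "norm z / \<rho>\<^sup>2 \<le> 1 / norm z"
        using z \<rho> mult_mono[of "norm z" \<rho> "norm z" \<rho>] by (simp add: field_simps power2_eq_square)
      thus ?thesis unfolding stereo_inversion[OF z(1)] \<omega>(2,3)
        using z \<rho> by (intro mono[OF \<omega>(1)]) auto
    qed
    show ?thesis
    proof (cases "y = 0")
      case False thus ?thesis using nonzero y by blast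
    next
      case True
      have cont: "continuous_on UNIV (\<lambda>z. K (stereo e z))" if "e = 1 \<or> e = -1" for e
      proof -
        have "C1_on UNIV (K \<circ> stereo e)" using K_C1 that by (auto simp: C1_sphere_def sphere_params_def)
        then obtain g where g: "\<And>x. ((K \<circ> stereo e) has_derivative (\<lambda>h. g x \<bullet> h)) (at x)"
          using C1_on_gradient by (metis UNIV_I)
        thus ?thesis using has_derivative_continuous[OF g]
          by (simp add: continuous_on_eq_continuous_at o_def)
      qed
      have "continuous_on UNIV (\<lambda>z. K (stereo (-1) z) - K (stereo 1 ((1 / \<rho>\<^sup>2) *\<^sub>R z)))"
        by (intro continuous_on_diff cont continuous_on_compose2[OF cont[of 1]] continuous_intros) auto
      hence "((\<lambda>z. K (stereo (-1) z) - K (stereo 1 ((1 / \<rho>\<^sup>2) *\<^sub>R z))) \<longlongrightarrow>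
          K (stereo (-1) 0) - K (stereo 1 ((1 / \<rho>\<^sup>2) *\<^sub>R 0))) (at (0::real^'n))"
        by (simp only: continuous_on_def) blast
      moreover have "\<forall>\<^sub>F z in at (0::real^'n). 0 \<le> K (stereo (-1) z) - K (stereo 1 ((1 / \<rho>\<^sup>2) *\<^sub>R z))"
        unfolding eventually_at by (rule exI[of _ \<rho>]) (use \<rho> nonzero in auto)
      ultimately have "0 \<le> K (stereo (-1) 0) - K (stereo 1 ((1 / \<rho>\<^sup>2) *\<^sub>R (0::real^'n)))"
        by (intro tendsto_lowerbound) auto
      thus ?thesis using True by simp
    qed
  qed
  have "\<exists>\<rho>>0. \<forall>y\<in>ball 0 \<rho>. p y = \<rho>\<^sup>2 * q ((1 / \<rho>\<^sup>2) *\<^sub>R y)"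
  proof (rule kelvin_pair_radial_coincidence[OF hp hq pos])
    show "p y = (y \<bullet> y) * q ((1 / (y \<bullet> y)) *\<^sub>R y)" if "y \<noteq> 0" for y
      using conformal_weight_kelvin[OF that] by (simp add: p_def q_def)
    show "spectral_le (schouten_form (q ((1 / \<rho>\<^sup>2) *\<^sub>R y)) (gq ((1 / \<rho>\<^sup>2) *\<^sub>R y)) (Hq ((1 / \<rho>\<^sup>2) *\<^sub>R y)))
        (schouten_form (p y) (gp y) (Hp y))" if "0 < \<rho>" "norm y \<le> \<rho>" for \<rho> y
      using spec_q[of "(1 / \<rho>\<^sup>2) *\<^sub>R y"] spec_p[of y] K_le[OF that] unfolding spectral_le_def by fastforce
  qed
  then obtain \<rho> where \<rho>: "0 < \<rho>" and coincide: "\<And>y. y \<in> ball 0 \<rho> \<Longrightarrow> p y = \<rho>\<^sup>2 * q ((1 / \<rho>\<^sup>2) *\<^sub>R y)"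
    by blast
  have K_eq: "K (stereo (-1) y) = K (stereo 1 ((1 / \<rho>\<^sup>2) *\<^sub>R y))" if y: "y \<in> ball 0 \<rho>" for y
  proof -
    define k where "k = 1 / \<rho>\<^sup>2"
    have k: "\<rho>\<^sup>2 * k = 1" using \<rho> by (simp add: k_def)
    define qr where "qr y = \<rho>\<^sup>2 * q (k *\<^sub>R y)" for y
    have hqr: "has_hessian qr (\<lambda>y. gq (k *\<^sub>R y)) (\<lambda>y. k *\<^sub>R Hq (k *\<^sub>R y))"
      using has_hessian_cmult[OF has_hessian_dilation[OF hq, of k], of "\<rho>\<^sup>2"] k
      unfolding qr_def[abs_def] by (simp add: mult.assoc[symmetric])
    have eq: "p z = qr z" if "z \<in> ball 0 \<rho>" for z using coincide[OF that] by (simp add: qr_def k_def)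
    \<comment> \<open>On the open ball both differences of the two functions attain a minimum at every point, so gradients and Hessian forms agree.\<close>
    have g: "gp y = gq (k *\<^sub>R y)"
      using has_hessian_local_min(1)[OF has_hessian_diff[OF hp hqr] open_ball y] eq y by simp
    have Hess: "x \<bullet> (Hp y *v x) = k * (x \<bullet> (Hq (k *\<^sub>R y) *v x))" for x
      using has_hessian_local_min(2)[OF has_hessian_diff[OF hp hqr] open_ball y, of x]
        has_hessian_local_min(2)[OF has_hessian_diff[OF hqr hp] open_ball y, of x] eq y
      by (simp add: matrix_vector_mult_diff_rdistrib inner_diff_right scaleR_matrix_vector_assoc[symmetric])
    have same: "x \<bullet> (schouten_form (p y) (gp y) (Hp y) *v x)
        = x \<bullet> (schouten_form (q (k *\<^sub>R y)) (gq (k *\<^sub>R y)) (Hq (k *\<^sub>R y)) *v x)" for x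
      using k eq[OF y] by (simp add: schouten_form_quadratic g Hess qr_def)
    obtain l where l: "ordered_spectrum (schouten_form (p y) (gp y) (Hp y)) l" "f l = K (stereo (-1) y)"
      using spec_p by blast
    obtain m where m: "ordered_spectrum (schouten_form (q (k *\<^sub>R y)) (gq (k *\<^sub>R y)) (Hq (k *\<^sub>R y))) m"
      "f m = K (stereo 1 (k *\<^sub>R y))" using spec_q by blast
    have "l $ i = m $ i" for i
      using ordered_spectrum_mono[OF l(1) m(1), of i] ordered_spectrum_mono[OF m(1) l(1), of i] same
      by (simp add: order_antisym)
    hence "l = m" by (simp add: vec_eq_iff)
    thus ?thesis using l(2) m(2) by (simp add: k_def)
  qed
  have const: "K (stereo 1 (s *\<^sub>R \<omega>)) = K (stereo 1 (s' *\<^sub>R \<omega>))"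
    if \<omega>: "norm \<omega> = 1" and s: "0 < s" "s \<le> s'" for s s' \<omega>
  proof -
    \<comment> \<open>The radii S and 1 / (rho^2 S) form one of the pairs on which K agrees, and they enclose both given radii.\<close>
    define S where "S = s' + 1 / (\<rho>\<^sup>2 * s) + 2 / \<rho>"
    have "0 < 1 / (\<rho>\<^sup>2 * s)" "0 < 2 / \<rho>" using s \<rho> by simp_all
    hence S: "s' \<le> S" "1 / (\<rho>\<^sup>2 * s) \<le> S" "2 / \<rho> \<le> S" "0 < S" using s unfolding S_def by linarith+
    have low: "1 / (\<rho>\<^sup>2 * S) \<le> s"
      using S(2,4) s \<rho> by (simp add: field_simps)
    have "1 / S < \<rho>" using S(3,4) \<rho> by (simp add: field_simps)
    hence y: "(1 / S) *\<^sub>R \<omega> \<in> ball 0 \<rho>" "(1 / S) *\<^sub>R \<omega> \<noteq> 0" using S(4) \<omega> by auto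
    have inv: "(1 / (((1 / S) *\<^sub>R \<omega>) \<bullet> ((1 / S) *\<^sub>R \<omega>))) *\<^sub>R ((1 / S) *\<^sub>R \<omega>) = S *\<^sub>R \<omega>"
      using \<omega> S(4) by (simp add: dot_square_norm power2_eq_square)
    have "K (stereo 1 (S *\<^sub>R \<omega>)) = K (stereo 1 ((1 / (\<rho>\<^sup>2 * S)) *\<^sub>R \<omega>))"
      using K_eq[OF y(1)] unfolding stereo_inversion[OF y(2)] inv by simp
    moreover have "K (stereo 1 ((1 / (\<rho>\<^sup>2 * S)) *\<^sub>R \<omega>)) \<le> K (stereo 1 (s *\<^sub>R \<omega>))"
      using low S(4) \<rho> by (intro mono \<omega>) auto
    moreover have "K (stereo 1 (s *\<^sub>R \<omega>)) \<le> K (stereo 1 (s' *\<^sub>R \<omega>))" using s by (intro mono \<omega>)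
    moreover have "K (stereo 1 (s' *\<^sub>R \<omega>)) \<le> K (stereo 1 (S *\<^sub>R \<omega>))" using s S by (intro mono \<omega>) auto
    ultimately show ?thesis by linarith
  qed
  obtain \<omega> r where \<omega>: "norm \<omega> = 1" and r: "0 < r" "r < pi" "meridian_deriv K \<omega> r \<noteq> 0"
    using assms(14) by auto
  have "((\<lambda>t. K (polar \<omega> t)) has_real_derivative 0) (at r)"
  proof (rule has_field_derivative_transform_within_open[where S = "{0<..<pi}" and f = "\<lambda>_. K (polar \<omega> r)"])
    fix t assume t: "t \<in> {0<..<pi}"
    hence t: "0 < t" "t < pi" by auto
    have tan: "0 < tan (t / 2)" "0 < tan (r / 2)" using t r by (auto intro!: tan_gt_zero)
    show "K (polar \<omega> r) = K (polar \<omega> t)"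
      unfolding polar_eq_stereo_tan[OF \<omega> r(1,2)] polar_eq_stereo_tan[OF \<omega> t]
    proof (cases "tan (r / 2) \<le> tan (t / 2)")
      case True
      thus "K (stereo 1 (tan (r / 2) *\<^sub>R \<omega>)) = K (stereo 1 (tan (t / 2) *\<^sub>R \<omega>))"
        by (rule const[OF \<omega> tan(2)])
    next
      case False
      hence "tan (t / 2) \<le> tan (r / 2)" by simp
      thus "K (stereo 1 (tan (r / 2) *\<^sub>R \<omega>)) = K (stereo 1 (tan (t / 2) *\<^sub>R \<omega>))"
        by (rule const[OF \<omega> tan(1), symmetric])
    qed
  qed (use r in auto)
  hence "meridian_deriv K \<omega> r = 0" unfolding meridian_deriv_def by (rule DERIV_imp_deriv)
  thus False using r(3) by simp
qed

end
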